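(* Let $d\ge3$ and $1\le k<d$ be integers and let $X\subseteq\mathbb{R}^d$ be a Borel set. Write $$B(u)=k(d-k)+\inf_{\theta\in(0,1]}\frac{u-\dim_{\mathrm F}^{\theta}X}{\theta}.$$ Suppose that $\dim_{\mathrm F}^{\theta}X>\theta\max\{k,\dim_{\mathrm H}X\}$ for some $\theta\in[0,1)$. Then for all sufficiently small $u>0$, $$\dim_{\mathrm H}\{V\in G(d,k):\dim_{\mathrm H}P_V(X)<u\}\le\max\{0,B(u)\},$$ where $B(u)$ is strictly smaller than both the Peres--Schlag bound and the Mattila bound, i.e. $$B(u)<k(d-k)+u-\dim_{\mathrm H}X\qquad\text{and}\qquad B(u)<k(d-k-1)+u.$$
   Context: $G(d,k)$ is the Grassmannian of $k$-dimensional linear subspaces $V$ of $\mathbb{R}^d$, with its usual metric (e.g. $\|P_V-P_W\|$), with respect to which Hausdorff dimensions of its subsets are taken. $P_V:\mathbb{R}^d\to V$ is orthogonal projection. $\dim_{\mathrm H}$ is Hausdorff dimension, with $\dim_{\mathrm H}\varnothing=0$. For $X\subseteq\mathbb{R}^d$, $\mathcal M(X)$ is the set of Borel measures $\mu$ compactly supported on $X$ with $0<\mu(X)<\infty$. The Fourier transform is $\widehat\mu(z)=\int e^{-2\pi i z\cdot x}\,d\mu(x)$. For $\mu\in\mathcal M(\mathbb{R}^d)$ and $\theta\in(0,1]$ put $$\mathcal J_{s,\theta}(\mu)=\Big(\int_{\mathbb{R}^d}|\widehat\mu(z)|^{2/\theta}|z|^{s/\theta-d}\,dz\Big)^{\theta},\qquad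 \mathcal J_{s,0}(\mu)=\sup_{z\in\mathbb{R}^d}|\widehat\mu(z)|^2|z|^s.$$ The Fourier spectrum of $\mu$ at $\theta\in[0,1]$ is $\dim_{\mathrm F}^{\theta}\mu=\sup\{s\in\mathbb{R}:\mathcal J_{s,\theta}(\mu)<\infty\}$, and of a Borel set $X\subseteq\mathbb{R}^d$ it is $\dim_{\mathrm F}^{\theta}X=\sup\{\min\{\dim_{\mathrm F}^{\theta}\mu,d\}:\mu\in\mathcal M(X)\}$ (suprema over empty sets are $0$). The Peres--Schlag bound states $\dim_{\mathrm H}\{V\in G(d,k):\dim_{\mathrm H}P_V(X)<u\}\le k(d-k)+u-\dim_{\mathrm H}X$ for $u\in[0,k]$; the Mattila bound states that, if $\dim_{\mathrm H}X\le k$, then the same dimension is at most $k(d-k-1)+u$ for $u\in[0,\dim_{\mathrm H}X]$. *)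

theory Defs
  imports "HOL-Analysis.Analysis"
begin

section \<open>Hausdorff dimension\<close>

definition mdiameter :: "'a metric \<Rightarrow> 'a set \<Rightarrow> real" where
  "mdiameter m U = (if U = {} then 0 else SUP (x, y)\<in>U \<times> U. mdist m x y)"

text \<open>The diameter to the power \<open>s\<close>, with the usual conventions at \<open>s = 0\<close>: the empty set
  contributes 0 and every nonempty set contributes 1 (whereas \<open>0 powr 0 = 0\<close>).\<close>

definition hausdorff_gauge :: "'a metric \<Rightarrow> real \<Rightarrow> 'a set \<Rightarrow> ennreal" where
  "hausdorff_gauge m s U =
    (if U = {} then 0 else if s = 0 then 1 else ennreal (mdiameter m U powr s))"

text \<open>Countable covers of \<open>S\<close> by sets of diameter at most \<open>\<delta>\<close>.  The diameter condition is spelled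
  out pointwise because a real supremum carries no information about unbounded sets.\<close>

definition delta_covers :: "'a metric \<Rightarrow> real \<Rightarrow> 'a set \<Rightarrow> (nat \<Rightarrow> 'a set) set" where
  "delta_covers m \<delta> S =
    {U. (\<forall>i. U i \<subseteq> mspace m \<and> (\<forall>x\<in>U i. \<forall>y\<in>U i. mdist m x y \<le> \<delta>)) \<and> S \<subseteq> (\<Union>i. U i)}"

definition hausdorff_outer_measure :: "'a metric \<Rightarrow> real \<Rightarrow> 'a set \<Rightarrow> ennreal" where
  "hausdorff_outer_measure m s S =
    (SUP \<delta>\<in>{0<..}. INF U\<in>delta_covers m \<delta> S. \<Sum>i. hausdorff_gauge m s (U i))"

definition hausdorff_dim :: "'a metric \<Rightarrow> 'a set \<Rightarrow> ereal" where
  "hausdorff_dim m S = Inf {ereal s |s. 0 \<le> s \<and> hausdorff_outer_measure m s S = 0}"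


section \<open>The Grassmannian\<close>

definition orth_proj :: "'a::euclidean_space set \<Rightarrow> 'a \<Rightarrow> 'a" where
  "orth_proj V x = (THE v. v \<in> V \<and> (\<forall>w\<in>V. orthogonal (x - v) w))"

definition grassmannian :: "nat \<Rightarrow> 'a::euclidean_space set set" where
  "grassmannian k = {V. subspace V \<and> dim V = k}"

text \<open>The distance of \<open>V\<close> and \<open>W\<close> is the operator norm of the difference of their projections.\<close>

definition grassmannian_metric :: "nat \<Rightarrow> 'a::euclidean_space set metric" where
  "grassmannian_metric k =
    metric (grassmannian k, \<lambda>V W. norm (Blinfun (orth_proj V) - Blinfun (orth_proj W)))"

lemma orth_proj_eqI:
  assumes "subspace V" "v \<in> V" "\<And>w. w \<in> V \<Longrightarrow> orthogonal (x - v) w"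
  shows "orth_proj V x = v"
  unfolding orth_proj_def
proof (rule the_equality)
  fix v' assume v': "v' \<in> V \<and> (\<forall>w\<in>V. orthogonal (x - v') w)"
  have "v - v' \<in> V" using assms v' by (simp add: subspace_diff)
  then have "(x - v') \<bullet> (v - v') = 0" "(x - v) \<bullet> (v - v') = 0"
    using assms v' by (auto simp: orthogonal_def)
  then have "(v - v') \<bullet> (v - v') = 0" by (simp add: inner_diff_left)
  then show "v' = v" by simp
qed (use assms in auto)

lemma orth_proj:
  assumes "subspace V"
  shows orth_proj_in: "orth_proj V x \<in> V"
    and orth_proj_orthogonal: "w \<in> V \<Longrightarrow> orthogonal (x - orth_proj V x) w"
proof -
  obtain y z where "y \<in> span V" "\<And>w. w \<in> span V \<Longrightarrow> orthogonal z w" "x = y + z"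
    using orthogonal_subspace_decomp_exists by metis
  moreover have "span V = V" using assms by (simp add: span_eq_iff)
  ultimately have yz: "y \<in> V" "\<And>w. w \<in> V \<Longrightarrow> orthogonal (x - y) w" by auto
  then have "orth_proj V x = y" using assms by (intro orth_proj_eqI)
  with yz show "orth_proj V x \<in> V" "w \<in> V \<Longrightarrow> orthogonal (x - orth_proj V x) w" by auto
qed

lemma bounded_linear_orth_proj:
  fixes V :: "'a::euclidean_space set"
  assumes "subspace V"
  shows "bounded_linear (orth_proj V)"
proof -
  have "linear (orth_proj V)"
  proof (rule linearI)
    fix x y :: 'a
    have "orthogonal (x + y - (orth_proj V x + orth_proj V y)) w" if "w \<in> V" for w
      using orth_proj_orthogonal[OF assms that, of x] orth_proj_orthogonal[OF assms that, of y]
      by (simp add: orthogonal_def inner_diff_left inner_add_left)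
    then show "orth_proj V (x + y) = orth_proj V x + orth_proj V y"
      using assms by (intro orth_proj_eqI) (auto intro: subspace_add orth_proj_in)
  next
    fix r :: real and x :: 'a
    have "orthogonal (r *\<^sub>R x - r *\<^sub>R orth_proj V x) w" if "w \<in> V" for w
      using orth_proj_orthogonal[OF assms that, of x]
      by (simp add: orthogonal_def inner_diff_left)
    then show "orth_proj V (r *\<^sub>R x) = r *\<^sub>R orth_proj V x"
      using assms by (intro orth_proj_eqI) (auto intro: subspace_scale orth_proj_in)
  qed
  then show ?thesis by (simp add: linear_conv_bounded_linear)
qed

lemma orth_proj_id: "subspace V \<Longrightarrow> x \<in> V \<Longrightarrow> orth_proj V x = x"
  by (rule orth_proj_eqI) (auto simp: orthogonal_def)

lemma range_orth_proj: "subspace V \<Longrightarrow> range (orth_proj V) = V"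
  using orth_proj_in orth_proj_id by (metis (no_types, lifting) image_subset_iff rangeI subsetI subset_antisym)

lemma Metric_space_grassmannian:
  "Metric_space (grassmannian k)
    (\<lambda>V W :: 'a::euclidean_space set. norm (Blinfun (orth_proj V) - Blinfun (orth_proj W)))"
proof
  fix V W U :: "'a set"
  show "0 \<le> norm (Blinfun (orth_proj V) - Blinfun (orth_proj W))" by simp
  show "norm (Blinfun (orth_proj V) - Blinfun (orth_proj W))
      = norm (Blinfun (orth_proj W) - Blinfun (orth_proj V))"
    by (simp add: norm_minus_commute)
  show "norm (Blinfun (orth_proj V) - Blinfun (orth_proj U))
      \<le> norm (Blinfun (orth_proj V) - Blinfun (orth_proj W))
        + norm (Blinfun (orth_proj W) - Blinfun (orth_proj U))"
    by (metis dist_norm dist_triangle)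
  assume "V \<in> grassmannian k" "W \<in> grassmannian k"
  then have VW: "subspace V" "subspace W" by (auto simp: grassmannian_def)
  show "norm (Blinfun (orth_proj V) - Blinfun (orth_proj W)) = 0 \<longleftrightarrow> V = W"
  proof
    assume "norm (Blinfun (orth_proj V) - Blinfun (orth_proj W)) = 0"
    then have "Blinfun (orth_proj V) = Blinfun (orth_proj W)" by simp
    then have "orth_proj V = orth_proj W"
      using VW by (metis bounded_linear_Blinfun_apply bounded_linear_orth_proj)
    then show "V = W" using VW range_orth_proj by metis
  qed simp
qed

lemma mspace_grassmannian_metric [simp]: "mspace (grassmannian_metric k) = grassmannian k"
  by (simp add: grassmannian_metric_def Metric_space_grassmannian Metric_space.mspace_metric)

lemma mdist_grassmannian_metric [simp]:
  "mdist (grassmannian_metric k) V W = norm (Blinfun (orth_proj V) - Blinfun (orth_proj W))"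
  by (simp add: grassmannian_metric_def Metric_space_grassmannian Metric_space.mdist_metric)


section \<open>The Fourier spectrum\<close>

definition compact_measures_on :: "'a::euclidean_space set \<Rightarrow> 'a measure set" where
  "compact_measures_on X =
    {\<mu>. sets \<mu> = sets borel \<and> (\<exists>K. compact K \<and> K \<subseteq> X \<and> emeasure \<mu> (- K) = 0)
        \<and> 0 < emeasure \<mu> X \<and> emeasure \<mu> X < \<infinity>}"

definition fourier_transform :: "'a::euclidean_space measure \<Rightarrow> 'a \<Rightarrow> complex" where
  "fourier_transform \<mu> z =
    (LINT x|\<mu>. exp (- 2 * complex_of_real pi * \<i> * complex_of_real (z \<bullet> x)))"

definition ennreal_powr :: "ennreal \<Rightarrow> real \<Rightarrow> ennreal" where
  "ennreal_powr x a = (if x = \<infinity> then \<infinity> else ennreal (enn2real x powr a))"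

text \<open>The convention \<open>0 powr a = 0\<close> does not affect which of these energies are finite: the
  integral ignores the point \<open>z = 0\<close>, and the supremum, if \<open>s < 0\<close>, is already infinite because of
  \<open>z\<close> near \<open>0\<close>.\<close>

definition fourier_energy :: "real \<Rightarrow> real \<Rightarrow> 'a::euclidean_space measure \<Rightarrow> ennreal" where
  "fourier_energy s \<theta> \<mu> =
    (if \<theta> = 0 then (SUP z. ennreal (cmod (fourier_transform \<mu> z) ^ 2 * norm z powr s))
     else ennreal_powr
       (\<integral>\<^sup>+ z. ennreal (cmod (fourier_transform \<mu> z) powr (2 / \<theta>)
                   * norm z powr (s / \<theta> - DIM('a))) \<partial>lborel) \<theta>)"

text \<open>Supremum with the convention that the empty set has supremum 0 (not \<open>-\<infinity>\<close>).\<close>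

definition Sup0 :: "ereal set \<Rightarrow> ereal" where
  "Sup0 A = (if A = {} then 0 else Sup A)"

definition fourier_spectrum_measure :: "real \<Rightarrow> 'a::euclidean_space measure \<Rightarrow> ereal" where
  "fourier_spectrum_measure \<theta> \<mu> = Sup0 {ereal s |s. fourier_energy s \<theta> \<mu> < \<infinity>}"

definition fourier_spectrum :: "real \<Rightarrow> 'a::euclidean_space set \<Rightarrow> ereal" where
  "fourier_spectrum \<theta> X =
    Sup0 ((\<lambda>\<mu>. min (fourier_spectrum_measure \<theta> \<mu>) (ereal DIM('a))) ` compact_measures_on X)"

text \<open>The bound \<open>B(u)\<close>.  It is extended real because the infimum is \<open>-\<infinity>\<close> whenever \<open>u\<close> is smaller
  than the Fourier dimension of \<open>X\<close>.\<close>

definition fourier_bound :: "nat \<Rightarrow> 'a::euclidean_space set \<Rightarrow> real \<Rightarrow> ereal" where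
  "fourier_bound k X u =
    ereal (real k * (real DIM('a) - real k))
      + (INF \<theta>\<in>{0<..1}. (ereal u - fourier_spectrum \<theta> X) / ereal \<theta>)"

end

theory Submission
  imports Defs
begin

text \<open>
  Let \<open>\<mu>\<close> be a measure on \<open>X\<close> and \<open>F\<close> the modulus of its Fourier transform.  If the projection of \<open>X\<close> to \<open>V\<close>
  has dimension less than \<open>u\<close>, then for \<open>u < w < k\<close> and infinitely many \<open>l\<close> the integral of \<open>F\<^sup>2\<close> over the
  frequencies of size about \<open>2 ^ l\<close> at distance at most 1 from \<open>V\<close> exceeds \<open>2 powr ((k - w) * l)\<close>.
  With \<open>p = 1 / \<theta>\<close>, discarding the part of \<open>F\<^sup>2\<close> below a suitable threshold turns this into
  a lower bound for the mass of that region under the finite measure with density \<open>F powr (2 * p) * norm z powr (s * p - d)\<close>.  On the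
  other hand, a frequency of size \<open>2 ^ l\<close> is near at most \<open>O(2 ^ (l * (k - 1) * (d - k)))\<close> members of a
  \<open>2 ^ - l\<close>-separated family of subspaces.  Summing the mass over a maximal separated family of bad \<open>V\<close>
  bounds the covering numbers of the bad set at scale \<open>2 ^ - l\<close>, and the exceptional set is contained
  in the limit superior of the bad sets.
\<close>

section \<open>Orthogonal projections and plates\<close>

text \<open>The leading term \<open>k * (d - k)\<close> has two sources. Counting the subspaces near
  one frequency gives \<open>(k - 1) * (d - k)\<close>. The other \<open>d - k\<close> appears
  because the weight \<open>norm z powr (s * p - d)\<close> carries \<open>- d\<close> while a shell
  around a \<open>k\<close>-plane has volume about \<open>2 ^ (k * l)\<close>. The rest,
  \<open>(w - s) * p\<close>, tends to \<open>(u - s) / \<theta>\<close> as \<open>w\<close>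
  decreases to \<open>u\<close>. Correlations of the projected measure at scale \<delta> are written
  as double integrals over \<mu>, which Fubini turns into integrals of the squared transform over a
  plate around \<open>V\<close>. All volume comparisons rest on covers by translates and are
  therefore uniform in \<open>V\<close>. The hypothesis admits \<theta> = 0, but the infimum in
  \<open>fourier_bound\<close> does not. Decay of the transform bounds the spectrum below by one
  positive constant for all \<theta> > 0, so some positive \<theta> satisfies the strict hypothesis
  as well. With m the maximum of k and the dimension of X, \<open>\<theta> * m < s\<close> gives
  \<open>(u - s) / \<theta> < - m\<close> for small u, and both strict comparisons follow from this
  one \<theta>.\<close>

lemma grassmannianD:
  assumes "V \<in> grassmannian k"
  shows "subspace V" "dim V = k"
  using assms by (auto simp: grassmannian_def)

lemma linear_orth_proj: "subspace V \<Longrightarrow> linear (orth_proj V)"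
  using bounded_linear_orth_proj bounded_linear.linear by blast

lemma orth_proj_diff: "subspace V \<Longrightarrow> orth_proj V (x - y) = orth_proj V x - orth_proj V y"
  and orth_proj_scaleR: "subspace V \<Longrightarrow> orth_proj V (c *\<^sub>R x) = c *\<^sub>R orth_proj V x"
  using linear_orth_proj[of V] by (simp_all add: linear_diff linear_cmul)

lemma inner_orth_proj:
  assumes "subspace V"
  shows "orth_proj V x \<bullet> y = x \<bullet> orth_proj V y"
    and "orth_proj V x \<bullet> y = orth_proj V x \<bullet> orth_proj V y"
proof -
  have "(x - orth_proj V x) \<bullet> orth_proj V y = 0" "(y - orth_proj V y) \<bullet> orth_proj V x = 0"
    using orth_proj[OF assms] unfolding orthogonal_def by blast+
  then show "orth_proj V x \<bullet> y = x \<bullet> orth_proj V y"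
    and "orth_proj V x \<bullet> y = orth_proj V x \<bullet> orth_proj V y"
    by (simp_all add: inner_diff_left inner_commute[of y] inner_commute[of "orth_proj V y"])
qed

lemma norm_orth_proj_pythagoras:
  assumes "subspace V"
  shows "(norm x)\<^sup>2 = (norm (orth_proj V x))\<^sup>2 + (norm (x - orth_proj V x))\<^sup>2"
proof -
  have "orthogonal (orth_proj V x) (x - orth_proj V x)"
    using orth_proj[OF assms] by (simp add: orthogonal_commute)
  then show ?thesis using norm_add_Pythagorean by fastforce
qed

lemma norm_orth_proj_le: "subspace V \<Longrightarrow> norm (orth_proj V x) \<le> norm x"
  and norm_orth_proj_residual_le: "subspace V \<Longrightarrow> norm (x - orth_proj V x) \<le> norm x"
proof -
  assume "subspace V"
  note eq = norm_orth_proj_pythagoras[OF this, of x]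
  show "norm (orth_proj V x) \<le> norm x" "norm (x - orth_proj V x) \<le> norm x"
    by (rule power2_le_imp_le; use eq in simp)+
qed

lemma norm_le_orth_proj_add: "norm x \<le> norm (orth_proj V x) + norm (x - orth_proj V x)"
  using norm_triangle_ineq[of "orth_proj V x" "x - orth_proj V x"] by simp

lemma continuous_on_orth_proj [continuous_intros]:
  assumes "subspace V" "continuous_on S f"
  shows "continuous_on S (\<lambda>x. orth_proj V (f x))"
  using bounded_linear.continuous_on[OF bounded_linear_orth_proj] assms by blast

lemma orth_proj_measurable [measurable]:
  "subspace V \<Longrightarrow> orth_proj V \<in> borel_measurable borel"
  by (intro borel_measurable_continuous_onI continuous_intros) auto

section \<open>Orthonormal coordinates, finite nets and volumes of plates\<close>

lemma orth_proj_eq_sum: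
  assumes "subspace V" "finite B" "B \<subseteq> V" "span B = V"
    and "\<And>b c. b \<in> B \<Longrightarrow> c \<in> B \<Longrightarrow> b \<bullet> c = (if b = c then 1 else 0)"
  shows "orth_proj V x = (\<Sum>b\<in>B. (x \<bullet> b) *\<^sub>R b)"
proof (rule orth_proj_eqI)
  show "(\<Sum>b\<in>B. (x \<bullet> b) *\<^sub>R b) \<in> V"
    using assms by (intro subspace_sum) (auto intro: subspace_scale)
  fix w assume "w \<in> V"
  have "orthogonal (x - (\<Sum>b\<in>B. (x \<bullet> b) *\<^sub>R b)) c" if "c \<in> B" for c
  proof -
    have "(\<Sum>b\<in>B. (x \<bullet> b) *\<^sub>R b) \<bullet> c = (\<Sum>b\<in>B. (x \<bullet> b) * (if b = c then 1 else 0))"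
      using that assms(5) by (auto simp: inner_sum_left intro!: sum.cong)
    also have "\<dots> = x \<bullet> c" using that assms(2) by (simp add: if_distrib cong: if_cong)
    finally show ?thesis by (simp add: orthogonal_def inner_diff_left)
  qed
  then show "orthogonal (x - (\<Sum>b\<in>B. (x \<bullet> b) *\<^sub>R b)) w"
    using \<open>w \<in> V\<close> assms(4) orthogonal_to_span[of w B] by simp
qed (fact assms)

lemma orthonormal_basis_inner:
  fixes V :: "'a::euclidean_space set"
  assumes "subspace V"
  obtains B where "finite B" "B \<subseteq> V" "card B = dim V" "span B = V"
    "\<And>b c. b \<in> B \<Longrightarrow> c \<in> B \<Longrightarrow> b \<bullet> c = (if b = c then 1 else 0)"
proof -
  obtain B where B: "B \<subseteq> V" "pairwise orthogonal B" "\<And>x. x \<in> B \<Longrightarrow> norm x = 1"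
    "independent B" "card B = dim V" "span B = V"
    using orthonormal_basis_subspace[OF assms] by metis
  have "b \<bullet> c = (if b = c then 1 else 0)" if "b \<in> B" "c \<in> B" for b c
    using B(2,3) that by (auto simp: norm_eq_1 pairwise_def orthogonal_def)
  with B show thesis using independent_imp_finite[OF B(4)] by (intro that[of B])
qed

lemma subspace_net:
  fixes V :: "'a::euclidean_space set"
  assumes "subspace V" "0 < r" "r \<le> a"
  obtains Y where "finite Y" "Y \<subseteq> V" "real (card Y) \<le> (5 * (real DIM('a) + 1) * a / r) ^ dim V"
    "\<And>z. z \<in> V \<Longrightarrow> norm z \<le> a \<Longrightarrow> \<exists>y\<in>Y. norm (z - y) \<le> r"
proof -
  obtain B where B: "finite B" "B \<subseteq> V" "card B = dim V" "span B = V"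
    and on: "\<And>b c. b \<in> B \<Longrightarrow> c \<in> B \<Longrightarrow> b \<bullet> c = (if b = c then 1 else 0)"
    using orthonormal_basis_inner[OF assms(1)] by blast
  \<comment> \<open>Rounding errs by at most \<open>h\<close> in each of the
    \<open>dim V \<le> DIM('a)\<close> coordinates, so this mesh keeps the total error within
    \<open>r\<close>.\<close>
  define h where "h = r / (real DIM('a) + 1)"
  define n where "n = \<lceil>a / h\<rceil>"
  define Y where "Y = (\<lambda>q. \<Sum>b\<in>B. (h * of_int (q b)) *\<^sub>R b) ` (B \<rightarrow>\<^sub>E {-n..n})"
  have h: "h > 0" "h \<le> a" using assms by (auto simp: h_def divide_le_eq mult_le_cancel_left1 intro: order_trans)
  have "n \<ge> 0" using h by (simp add: n_def less_le_trans[of "-1" 0])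
  have dimle: "dim V \<le> DIM('a)" by (simp add: dim_subset_UNIV)
  show thesis
  proof
    show "finite Y" using B by (auto simp: Y_def intro!: finite_PiE)
    show "Y \<subseteq> V" using B assms(1) unfolding Y_def
      by (auto intro!: subspace_sum subspace_scale)
    have "card Y \<le> card (B \<rightarrow>\<^sub>E {-n..n})" unfolding Y_def by (intro card_image_le finite_PiE B) auto
    also have "\<dots> = (nat (2 * n + 1)) ^ dim V" using B by (simp add: card_PiE)
    finally have "real (card Y) \<le> real (nat (2 * n + 1) ^ dim V)" using of_nat_le_iff by blast
    also have "\<dots> = (2 * real_of_int n + 1) ^ dim V" using \<open>n \<ge> 0\<close> by simp
    also have "\<dots> \<le> (5 * (real DIM('a) + 1) * a / r) ^ dim V"
    proof (rule power_mono)
      have "real_of_int n \<le> a / h + 1" by (simp add: n_def)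
      moreover have "a / h \<ge> 1" using h by (simp add: le_divide_eq)
      \<comment> \<open>The factor 5 comes from
        \<open>2 * (a / h + 1) + 1 \<le> 5 * (a / h)\<close>, valid because
        \<open>a / h \<ge> 1\<close>.\<close>
      ultimately have "2 * real_of_int n + 1 \<le> 5 * (a / h)" by linarith
      also have "\<dots> = 5 * (real DIM('a) + 1) * a / r" using assms by (simp add: h_def field_simps)
      finally show "2 * real_of_int n + 1 \<le> 5 * (real DIM('a) + 1) * a / r" .
    qed (use \<open>n \<ge> 0\<close> in simp)
    finally show "real (card Y) \<le> (5 * (real DIM('a) + 1) * a / r) ^ dim V" .
    fix z assume z: "z \<in> V" "norm z \<le> a"
    define q where "q = restrict (\<lambda>b. \<lfloor>(z \<bullet> b) / h\<rfloor>) B"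
    have "q \<in> B \<rightarrow>\<^sub>E {-n..n}"
    proof -
      have "\<lfloor>(z \<bullet> b) / h\<rfloor> \<in> {-n..n}" if "b \<in> B" for b
      proof -
        have "norm b = 1" using on[OF that that] by (simp add: norm_eq_1)
        then have "\<bar>z \<bullet> b\<bar> \<le> a" using z Cauchy_Schwarz_ineq2[of z b] by simp
        then have "(z \<bullet> b) / h \<le> a / h" "- (a / h) \<le> (z \<bullet> b) / h"
          using h by (auto simp: divide_simps abs_le_iff)
        then show ?thesis unfolding n_def
          by (simp add: le_floor_iff floor_le_iff) linarith
      qed
      then show ?thesis by (auto simp: q_def)
    qed
    moreover have "norm (z - (\<Sum>b\<in>B. (h * of_int (q b)) *\<^sub>R b)) \<le> r"
    proof -
      have "z = (\<Sum>b\<in>B. (z \<bullet> b) *\<^sub>R b)"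
        using orth_proj_eq_sum[OF assms(1) B(1,2,4) on, of z] orth_proj_id[OF assms(1) z(1)] by simp
      then have "z - (\<Sum>b\<in>B. (h * of_int (q b)) *\<^sub>R b) = (\<Sum>b\<in>B. ((z \<bullet> b) - h * of_int (q b)) *\<^sub>R b)"
        by (simp add: scaleR_diff_left sum_subtractf)
      also have "norm \<dots> \<le> (\<Sum>b\<in>B. h)"
      proof (rule sum_norm_le)
        fix b assume b: "b \<in> B"
        have "norm b = 1" using on[OF b b] by (simp add: norm_eq_1)
        moreover have "\<bar>(z \<bullet> b) - h * of_int \<lfloor>(z \<bullet> b) / h\<rfloor>\<bar> \<le> h"
        proof -
          define f where "f = real_of_int \<lfloor>(z \<bullet> b) / h\<rfloor>"
          have "f \<le> (z \<bullet> b) / h" "(z \<bullet> b) / h \<le> f + 1" unfolding f_def by linarith+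
          then have "f * h \<le> z \<bullet> b" "z \<bullet> b \<le> (f + 1) * h"
            using h by (simp_all add: pos_le_divide_eq pos_divide_le_eq)
          then have "\<bar>(z \<bullet> b) - h * f\<bar> \<le> h" by (simp add: algebra_simps)
          then show ?thesis by (simp add: f_def)
        qed
        ultimately show "norm (((z \<bullet> b) - h * of_int (q b)) *\<^sub>R b) \<le> h" using b by (simp add: q_def)
      qed
      also have "\<dots> = dim V * h" using B by simp
      also have "\<dots> \<le> (real DIM('a) + 1) * h" using dimle h by (intro mult_right_mono) auto
      also have "\<dots> = r" by (simp add: h_def)
      finally show ?thesis .
    qed
    ultimately show "\<exists>y\<in>Y. norm (z - y) \<le> r" unfolding Y_def by blast
  qed
qed

definition plate :: "'a::euclidean_space set \<Rightarrow> real \<Rightarrow> real \<Rightarrow> 'a set" where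
  "plate V a b = {z. norm (orth_proj V z) \<le> a \<and> norm (z - orth_proj V z) \<le> b}"

lemma closed_plate: "subspace V \<Longrightarrow> closed (plate V a b)"
  unfolding plate_def
  by (intro closed_Collect_conj closed_Collect_le continuous_intros) auto

lemma plate_borel: "subspace V \<Longrightarrow> plate V a b \<in> sets borel"
  by (simp add: closed_plate)

lemma plate_subset_cball: "plate V a b \<subseteq> cball 0 (a + b)"
proof
  fix z assume "z \<in> plate V a b"
  then show "z \<in> cball 0 (a + b)" using norm_le_orth_proj_add[of z V] by (simp add: plate_def)
qed

lemma emeasure_lborel_translate:
  fixes S :: "'a::euclidean_space set"
  assumes "S \<in> sets borel"
  shows "emeasure lborel ((+) y ` S) = emeasure lborel S"
proof -
  have S': "(+) y ` S = (+) (-y) -` S" by (force simp: image_iff)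
  have "emeasure lborel S = emeasure (distr lborel borel ((+) (-y))) S"
    by (simp add: lborel_distr_plus)
  also have "\<dots> = emeasure lborel ((+) y ` S)"
    using assms by (subst emeasure_distr) (auto simp: S')
  finally show ?thesis by simp
qed

lemma emeasure_le_translates:
  fixes S T :: "'a::euclidean_space set"
  assumes "T \<in> sets borel" "finite Y" "S \<subseteq> (\<Union>y\<in>Y. (+) y ` T)" "real (card Y) \<le> c"
  shows "emeasure lborel S \<le> ennreal c * emeasure lborel T"
proof -
  have tr: "(+) y ` T \<in> sets lborel" for y
  proof -
    have "(+) y ` T = (+) (-y) -` T \<inter> space borel" by (force simp: image_iff)
    also have "\<dots> \<in> sets borel" by (rule measurable_sets[OF _ assms(1)]) simp
    finally show ?thesis by simp
  qed
  have "emeasure lborel S \<le> emeasure lborel (\<Union>y\<in>Y. (+) y ` T)"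
    by (intro emeasure_mono assms sets.finite_UN tr)
  also have "\<dots> \<le> (\<Sum>y\<in>Y. emeasure lborel ((+) y ` T))"
    by (intro emeasure_subadditive_finite assms) (use tr in auto)
  also have "\<dots> = ennreal (card Y) * emeasure lborel T"
    using assms by (simp add: emeasure_lborel_translate ennreal_of_nat_eq_real_of_nat)
  also have "\<dots> \<le> ennreal c * emeasure lborel T"
    using assms by (intro mult_right_mono ennreal_leI) auto
  finally show ?thesis .
qed

text \<open>Translations by an \<open>r\<close>-net of the ball of radius \<open>a\<close> in
  \<open>V\<close> leave the residual \<open>z - orth_proj V z\<close> unchanged, so the translates
  of the thinner plate cover the larger one.\<close>

lemma plate_shrink_first:
  fixes V :: "'a::euclidean_space set"
  assumes "subspace V" "0 < r" "r \<le> a"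
  shows "emeasure lborel (plate V a b)
    \<le> ennreal ((5 * (real DIM('a) + 1) * a / r) ^ dim V) * emeasure lborel (plate V r b)"
proof -
  obtain Y where Y: "finite Y" "Y \<subseteq> V" "real (card Y) \<le> (5 * (real DIM('a) + 1) * a / r) ^ dim V"
    "\<And>z. z \<in> V \<Longrightarrow> norm z \<le> a \<Longrightarrow> \<exists>y\<in>Y. norm (z - y) \<le> r"
    using subspace_net[OF assms] by blast
  show ?thesis
  proof (rule emeasure_le_translates[OF plate_borel[OF assms(1)] Y(1) _ Y(3)], rule subsetI)
    fix z assume z: "z \<in> plate V a b"
    then obtain y where y: "y \<in> Y" "norm (orth_proj V z - y) \<le> r"
      using Y(4)[of "orth_proj V z"] orth_proj_in[OF assms(1)] by (auto simp: plate_def)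
    have "orth_proj V y = y" using y Y assms orth_proj_id by blast
    then have "z - y \<in> plate V r b" using z y assms by (simp add: plate_def orth_proj_diff)
    then show "z \<in> (\<Union>y\<in>Y. (+) y ` plate V r b)" using y by (intro UN_I[of y]) (auto intro!: image_eqI[of _ _ "z - y"])
  qed
qed

lemma orth_proj_orthogonal_comp:
  assumes "subspace V"
  shows "orth_proj (orthogonal_comp V) x = x - orth_proj V x"
proof (rule orth_proj_eqI)
  show "subspace (orthogonal_comp V)" by (simp add: subspace_orthogonal_comp)
  show "x - orth_proj V x \<in> orthogonal_comp V"
    using orth_proj_orthogonal[OF assms] by (simp add: orthogonal_comp_def orthogonal_commute)
  fix w assume "w \<in> orthogonal_comp V"
  then show "orthogonal (x - (x - orth_proj V x)) w"
    using orth_proj_in[OF assms, of x] by (simp add: orthogonal_comp_def)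
qed

lemma dim_orthogonal_comp:
  fixes V :: "'a::euclidean_space set"
  assumes "subspace V"
  shows "dim (orthogonal_comp V) = DIM('a) - dim V"
proof -
  have "dim {y \<in> UNIV. \<forall>x\<in>V. orthogonal x y} + dim V = dim (UNIV :: 'a set)"
    using assms by (intro dim_subspace_orthogonal_to_vectors) auto
  moreover have "{y \<in> UNIV. \<forall>x\<in>V. orthogonal x y} = orthogonal_comp V"
    by (auto simp: orthogonal_comp_def)
  ultimately show ?thesis by simp
qed

text \<open>Passing to the complement swaps the two radii; shrinking in the normal directions
  thereby becomes an instance of \<open>plate_shrink_first\<close>.\<close>

lemma plate_orthogonal_comp:
  "subspace V \<Longrightarrow> plate (orthogonal_comp V) a b = plate V b a"
  by (auto simp: plate_def orth_proj_orthogonal_comp)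

lemma plate_shrink_second:
  fixes V :: "'a::euclidean_space set"
  assumes "subspace V" "0 < r" "r \<le> b"
  shows "emeasure lborel (plate V a b)
    \<le> ennreal ((5 * (real DIM('a) + 1) * b / r) ^ (DIM('a) - dim V)) * emeasure lborel (plate V a r)"
  using plate_shrink_first[OF subspace_orthogonal_comp assms(2,3), of V a] assms
  by (simp add: plate_orthogonal_comp dim_orthogonal_comp)

text \<open>Shrinking along \<open>V\<close> from \<open>a\<close> to \<open>b\<close> leads to
  \<open>plate V b b\<close>, which lies in a ball of radius \<open>2 * b\<close>. The constant
  depends only on the ambient dimension and hence not on \<open>V\<close>.\<close>

lemma plate_volume_upper:
  obtains C where "C > 0" "\<And>(V::'a::euclidean_space set) a b. subspace V \<Longrightarrow> 0 < b \<Longrightarrow> b \<le> a \<Longrightarrow>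
    emeasure lborel (plate V a b) \<le> ennreal (C * a ^ dim V * b ^ (DIM('a) - dim V))"
proof
  define K where "K = 5 * (real DIM('a) + 1)"
  define v where "v = unit_ball_vol (real DIM('a)) * 2 ^ DIM('a)"
  have K: "K \<ge> 1" and v: "v > 0" by (auto simp: K_def v_def)
  then show "K ^ DIM('a) * v > 0" by simp
  fix V :: "'a set" and a b :: real
  assume *: "subspace V" "0 < b" "b \<le> a"
  have dv: "dim V \<le> DIM('a)" by (simp add: dim_subset_UNIV)
  have "emeasure lborel (plate V b b) \<le> emeasure lborel (cball 0 (b + b) :: 'a set)"
    by (intro emeasure_mono[OF plate_subset_cball]) simp
  also have "\<dots> = ennreal (v * b ^ DIM('a))"
    using * by (simp add: emeasure_cball v_def mult_2[symmetric] power_mult_distrib mult.assoc del: mult_2)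
  finally have ball: "emeasure lborel (plate V b b) \<le> ennreal (v * b ^ DIM('a))" .
  have "emeasure lborel (plate V a b) \<le> ennreal ((K * a / b) ^ dim V) * emeasure lborel (plate V b b)"
    unfolding K_def by (rule plate_shrink_first) fact+
  also have "\<dots> \<le> ennreal ((K * a / b) ^ dim V) * ennreal (v * b ^ DIM('a))"
    by (rule mult_left_mono[OF ball]) simp
  also have "\<dots> = ennreal ((K * a / b) ^ dim V * (v * b ^ DIM('a)))"
    using * v K by (intro ennreal_mult[symmetric]) auto
  also have "\<dots> = ennreal (K ^ dim V * (v * a ^ dim V * b ^ (DIM('a) - dim V)))"
  proof -
    have "b ^ DIM('a) = b ^ dim V * b ^ (DIM('a) - dim V)" using dv by (simp flip: power_add)
    then show ?thesis using * by (simp add: power_divide power_mult_distrib mult_ac)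
  qed
  also have "\<dots> \<le> ennreal (K ^ DIM('a) * v * a ^ dim V * b ^ (DIM('a) - dim V))"
    unfolding mult.assoc
    using * K v dv by (intro ennreal_leI mult_right_mono power_increasing) auto
  finally show "emeasure lborel (plate V a b) \<le> ennreal (K ^ DIM('a) * v * a ^ dim V * b ^ (DIM('a) - dim V))" .
qed

text \<open>Here one starts from \<open>plate V a a\<close>, which contains the ball of radius
  \<open>a\<close>; shrinking its normal radius to \<open>b\<close> costs a factor of order
  \<open>(a / b) ^ (DIM('a) - dim V)\<close>.\<close>

lemma plate_volume_lower:
  obtains c where "c > 0" "\<And>(V::'a::euclidean_space set) a b. subspace V \<Longrightarrow> 0 < b \<Longrightarrow> b \<le> a \<Longrightarrow>
    ennreal (c * a ^ dim V * b ^ (DIM('a) - dim V)) \<le> emeasure lborel (plate V a b)"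
proof
  define K where "K = 5 * (real DIM('a) + 1)"
  define v where "v = unit_ball_vol (real DIM('a))"
  have K: "K \<ge> 1" and v: "v > 0" by (auto simp: K_def v_def)
  then show "v / K ^ DIM('a) > 0" by simp
  fix V :: "'a set" and a b :: real
  assume *: "subspace V" "0 < b" "b \<le> a"
  have dv: "dim V \<le> DIM('a)" by (simp add: dim_subset_UNIV)
  let ?m = "DIM('a) - dim V"
  have fin: "emeasure lborel (plate V a b) < \<infinity>"
    using plate_subset_cball emeasure_lborel_cball_finite 
    by (intro order_le_less_trans[OF emeasure_mono[OF plate_subset_cball]]) auto
  define w where "w = enn2real (emeasure lborel (plate V a b))"
  have w: "emeasure lborel (plate V a b) = ennreal w" "w \<ge> 0"
    using fin by (simp_all add: w_def)
  have "ennreal (v * a ^ DIM('a)) = emeasure lborel (cball 0 a :: 'a set)"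
    using * by (simp add: emeasure_cball v_def)
  also have "\<dots> \<le> emeasure lborel (plate V a a)"
  proof (intro emeasure_mono subsetI)
    fix x :: 'a assume "x \<in> cball 0 a"
    then show "x \<in> plate V a a" unfolding plate_def
      using norm_orth_proj_le[OF *(1), of x] norm_orth_proj_residual_le[OF *(1), of x] by auto
  qed (simp add: plate_borel *)
  also have "\<dots> \<le> ennreal ((K * a / b) ^ ?m) * emeasure lborel (plate V a b)"
    unfolding K_def by (rule plate_shrink_second) fact+
  also have "\<dots> = ennreal ((K * a / b) ^ ?m * w)"
    using * K w by (simp add: ennreal_mult)
  finally have "v * a ^ DIM('a) \<le> (K * a / b) ^ ?m * w"
    using * K w v by (subst (asm) ennreal_le_iff) auto
  moreover have "a ^ DIM('a) = a ^ dim V * a ^ ?m" using dv by (simp flip: power_add)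
  ultimately have "v * a ^ dim V * b ^ ?m \<le> K ^ ?m * w"
    using * by (simp add: power_divide power_mult_distrib field_simps)
  also have "\<dots> \<le> K ^ DIM('a) * w" using K w by (intro mult_right_mono power_increasing) auto
  finally show "ennreal (v / K ^ DIM('a) * a ^ dim V * b ^ ?m) \<le> emeasure lborel (plate V a b)"
    using K unfolding w(1) by (intro ennreal_leI) (simp add: field_simps)
qed

section \<open>Hausdorff measure of limsup sets and of images\<close>

lemma mdiameter_bounds:
  assumes "U \<subseteq> mspace m" "0 \<le> r" "\<And>x y. x \<in> U \<Longrightarrow> y \<in> U \<Longrightarrow> mdist m x y \<le> r"
  shows "0 \<le> mdiameter m U" "mdiameter m U \<le> r"
    and "x \<in> U \<Longrightarrow> y \<in> U \<Longrightarrow> mdist m x y \<le> mdiameter m U"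
proof -
  have bdd: "bdd_above ((\<lambda>(x, y). mdist m x y) ` (U \<times> U))"
    using assms(3) by (intro bdd_aboveI[of _ r]) auto
  show le: "mdist m x y \<le> mdiameter m U" if "x \<in> U" "y \<in> U" for x y
    using cSUP_upper[OF _ bdd, of "(x, y)"] that by (auto simp: mdiameter_def)
  show "0 \<le> mdiameter m U"
  proof (cases "U = {}")
    case False
    then obtain x where "x \<in> U" by blast
    then show ?thesis using le[of x x] mdist_nonneg[of m x x] by linarith
  qed (simp add: mdiameter_def)
  show "mdiameter m U \<le> r"
    using assms by (auto simp: mdiameter_def intro!: cSUP_least)
qed

lemma hausdorff_gauge_empty [simp]: "hausdorff_gauge m s {} = 0"
  by (simp add: hausdorff_gauge_def)

lemma hausdorff_gauge_le:
  assumes "U \<subseteq> mspace m" "0 \<le> r" "0 < s" "\<And>x y. x \<in> U \<Longrightarrow> y \<in> U \<Longrightarrow> mdist m x y \<le> r"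
  shows "hausdorff_gauge m s U \<le> ennreal (r powr s)"
  using mdiameter_bounds[OF assms(1,2,4)] assms(2,3)
  by (auto simp: hausdorff_gauge_def intro!: ennreal_leI powr_mono2)

lemma hausdorff_outer_measure_eq_0I:
  assumes "\<And>\<delta> \<epsilon>. 0 < \<delta> \<Longrightarrow> 0 < \<epsilon> \<Longrightarrow>
    \<exists>U\<in>delta_covers m \<delta> S. (\<Sum>i. hausdorff_gauge m s (U i)) \<le> ennreal \<epsilon>"
  shows "hausdorff_outer_measure m s S = 0"
proof -
  have "(INF U\<in>delta_covers m \<delta> S. \<Sum>i. hausdorff_gauge m s (U i)) = 0" if "0 < \<delta>" for \<delta>
  proof -
    have "(INF U\<in>delta_covers m \<delta> S. \<Sum>i. hausdorff_gauge m s (U i)) \<le> 0"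
    proof (rule ennreal_le_epsilon)
      fix e :: real assume "0 < e"
      then show "(INF U\<in>delta_covers m \<delta> S. \<Sum>i. hausdorff_gauge m s (U i)) \<le> 0 + ennreal e"
        using assms[OF that \<open>0 < e\<close>] by (auto intro: INF_lower2)
    qed
    then show ?thesis by simp
  qed
  then show ?thesis by (auto simp: hausdorff_outer_measure_def intro!: SUP_eq_const)
qed

text \<open>A Borel-Cantelli argument: for every \<open>L\<close> the families of index at least
  \<open>L\<close> cover \<open>S\<close>, and since \<open>\<beta> < s\<close> their gauges sum to
  a geometric tail that vanishes as \<open>L\<close> grows.\<close>

lemma hausdorff_outer_measure_limsup_eq_0:
  fixes \<U> :: "nat \<Rightarrow> 'a set set" and s r \<beta> C :: real
  assumes "0 < s" "0 < r" "\<beta> < s"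
    and fin: "\<And>l. l \<ge> l0 \<Longrightarrow> finite (\<U> l)"
    and card: "\<And>l. l \<ge> l0 \<Longrightarrow> real (card (\<U> l)) \<le> C * 2 powr (\<beta> * l)"
    and sub: "\<And>l U. l \<ge> l0 \<Longrightarrow> U \<in> \<U> l \<Longrightarrow> U \<subseteq> mspace m"
    and diam: "\<And>l U x y. l \<ge> l0 \<Longrightarrow> U \<in> \<U> l \<Longrightarrow> x \<in> U \<Longrightarrow> y \<in> U \<Longrightarrow> mdist m x y \<le> r * 2 powr (- real l)"
    and cover: "\<And>x. x \<in> S \<Longrightarrow> \<exists>\<^sub>\<infinity>l. x \<in> \<Union>(\<U> l)"
  shows "hausdorff_outer_measure m s S = 0"
proof (rule hausdorff_outer_measure_eq_0I)
  fix \<delta> \<epsilon> :: real assume "0 < \<delta>" "0 < \<epsilon>"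
  define q where "q = 2 powr (\<beta> - s)"
  have q: "0 < q" "q < 1" using assms(3) by (auto simp: q_def powr_less_one)
  have "0 \<le> C * 2 powr (\<beta> * l0)" using card[of l0] by linarith
  then have "0 \<le> C" by (simp add: zero_le_mult_iff)
  define K where "K = C * r powr s"
  have K: "K \<ge> 0" using \<open>0 \<le> C\<close> by (simp add: K_def)
  have "(\<lambda>L. K / (1 - q) * q ^ L) \<longlonglongrightarrow> K / (1 - q) * 0"
    using q by (intro tendsto_mult tendsto_const LIMSEQ_realpow_zero) auto
  then have ev1: "\<forall>\<^sub>F L in sequentially. K / (1 - q) * q ^ L < \<epsilon>"
    using \<open>0 < \<epsilon>\<close> by (auto dest: order_tendstoD(2))
  have "(\<lambda>L. r * (1/2) ^ L) \<longlonglongrightarrow> r * 0"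
    by (intro tendsto_mult tendsto_const LIMSEQ_realpow_zero) auto
  then have ev2: "\<forall>\<^sub>F L in sequentially. r * (1/2) ^ L < \<delta>"
    using \<open>0 < \<delta>\<close> by (auto dest: order_tendstoD(2))
  obtain L where L: "L \<ge> l0" "K / (1 - q) * q ^ L < \<epsilon>" "r * (1/2) ^ L < \<delta>"
    using eventually_happens'[OF sequentially_bot eventually_conj[OF eventually_ge_at_top[of l0] eventually_conj[OF ev1 ev2]]]
    by auto
  have "\<forall>l. \<exists>g. l \<ge> l0 \<longrightarrow> bij_betw g {0..<card (\<U> l)} (\<U> l)"
    using ex_bij_betw_nat_finite[OF fin] by blast
  then obtain g where g: "\<And>l. l \<ge> l0 \<Longrightarrow> bij_betw (g l) {0..<card (\<U> l)} (\<U> l)" by metis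
  \<comment> \<open>The pair \<open>(l, i)\<close> stands for the \<open>i\<close>-th member of
    family \<open>l + L\<close>. Empty sets, of gauge 0, pad each finite family to a sequence, and
    \<open>prod_decode\<close> flattens the double sequence into one cover.\<close>
  define F where "F = (\<lambda>(l, i). if i < card (\<U> (l + L)) then g (l + L) i else {})"
  have F_in: "F (l, i) \<in> \<U> (l + L)" if "i < card (\<U> (l + L))" for l i
    using that g[of "l + L"] L(1) by (auto simp: F_def bij_betw_def)
  have F_cases: "F (l, i) = {} \<or> F (l, i) \<in> \<U> (l + L)" for l i
    using F_in[of i l] by (auto simp: F_def)
  have pw: "2 powr (- real (l + L)) \<le> (1/2) ^ L" for l
  proof -
    have "2 powr (- real (l + L)) = (1/2) ^ (l + L)"
      by (simp add: powr_minus powr_realpow power_one_over inverse_eq_divide flip: of_nat_add)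
    also have "\<dots> \<le> (1/2::real) ^ L" by (rule power_decreasing) auto
    finally show ?thesis .
  qed
  show "\<exists>U\<in>delta_covers m \<delta> S. (\<Sum>i. hausdorff_gauge m s (U i)) \<le> ennreal \<epsilon>"
  proof (rule bexI[of _ "F \<circ> prod_decode"])
    have "F p \<subseteq> mspace m \<and> (\<forall>x\<in>F p. \<forall>y\<in>F p. mdist m x y \<le> \<delta>)" for p
    proof (cases p)
      case (Pair l i)
      have "mdist m x y \<le> \<delta>" if "x \<in> F p" "y \<in> F p" for x y
      proof -
        have "mdist m x y \<le> r * 2 powr (- real (l + L))"
          using that F_cases[of l i] diam[of "l + L" "F p" x y] L(1) Pair by auto
        also have "\<dots> \<le> r * (1/2) ^ L" using pw[of l] assms(2) by (intro mult_left_mono) auto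
        finally show ?thesis using L by simp
      qed
      then show ?thesis using F_cases[of l i] sub[of "l + L"] L(1) Pair by auto
    qed
    moreover have "S \<subseteq> (\<Union>i. (F \<circ> prod_decode) i)"
    proof
      fix x assume "x \<in> S"
      then obtain l U where l: "l \<ge> L" "U \<in> \<U> l" "x \<in> U"
        using cover[of x] by (fastforce simp: INFM_nat_le)
      obtain i where "i < card (\<U> l)" "g l i = U"
        using g[of l] l L(1) by (auto simp: bij_betw_def) (metis (no_types, lifting) atLeastLessThan_iff imageE)
      then have "F (l - L, i) = U" using l by (simp add: F_def)
      then have "x \<in> (F \<circ> prod_decode) (prod_encode (l - L, i))" using l by simp
      then show "x \<in> (\<Union>i. (F \<circ> prod_decode) i)" by blast
    qed
    ultimately show "F \<circ> prod_decode \<in> delta_covers m \<delta> S" by (auto simp: delta_covers_def)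
    have inner: "(\<Sum>i. hausdorff_gauge m s (F (l, i))) \<le> ennreal (K * q ^ L * q ^ l)" for l
    proof -
      have "(\<Sum>i. hausdorff_gauge m s (F (l, i)))
          = (\<Sum>i<card (\<U> (l + L)). hausdorff_gauge m s (F (l, i)))"
        by (rule suminf_finite) (auto simp: F_def)
      also have "\<dots> \<le> (\<Sum>i<card (\<U> (l + L)). ennreal ((r * 2 powr (- real (l + L))) powr s))"
      proof (rule sum_mono)
        fix i assume "i \<in> {..<card (\<U> (l + L))}"
        then have *: "F (l, i) \<in> \<U> (l + L)" using F_in by auto
        have "l0 \<le> l + L" using L(1) by simp
        then show "hausdorff_gauge m s (F (l, i)) \<le> ennreal ((r * 2 powr (- real (l + L))) powr s)"
          using assms(1,2) sub[OF _ *] diam[OF _ *] by (intro hausdorff_gauge_le) auto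
      qed
      also have "\<dots> = ennreal (real (card (\<U> (l + L))) * (r * 2 powr (- real (l + L))) powr s)"
        by (simp add: ennreal_mult ennreal_of_nat_eq_real_of_nat)
      also have "\<dots> \<le> ennreal (C * 2 powr (\<beta> * real (l + L)) * (r * 2 powr (- real (l + L))) powr s)"
        using card[of "l + L"] L(1) by (intro ennreal_leI mult_right_mono) auto
      also have "C * 2 powr (\<beta> * real (l + L)) * (r * 2 powr (- real (l + L))) powr s
          = K * (2 powr (\<beta> * real (l + L)) * 2 powr (- (real (l + L) * s)))"
        using assms(2) by (simp only: K_def powr_mult powr_powr mult_minus_left mult_minus_right mult_ac)
      also have "\<dots> = K * 2 powr ((\<beta> - s) * real (l + L))"
        by (simp add: powr_add[symmetric] algebra_simps)
      also have "2 powr ((\<beta> - s) * real (l + L)) = q ^ (l + L)"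
        by (simp only: q_def powr_powr[symmetric] powr_realpow[OF powr_gt_zero[THEN iffD2]])
      also have "K * q ^ (l + L) = K * q ^ L * q ^ l" by (simp add: power_add)
      finally show ?thesis .
    qed
    have "(\<Sum>i. hausdorff_gauge m s ((F \<circ> prod_decode) i))
        = (\<Sum>l. \<Sum>i. hausdorff_gauge m s (F (l, i)))"
      using suminf_ennreal_2dimen[of "\<lambda>l. \<Sum>i. hausdorff_gauge m s (F (l, i))" "\<lambda>p. hausdorff_gauge m s (F p)"]
      by (simp add: comp_def)
    also have "\<dots> \<le> (\<Sum>l. ennreal (K * q ^ L * q ^ l))" by (intro suminf_le inner) auto
    also have "\<dots> = ennreal (K * q ^ L * (1 / (1 - q)))"
      using q K by (intro suminf_ennreal_eq sums_mult geometric_sums) auto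
    also have "\<dots> \<le> ennreal \<epsilon>" using L(2) by (intro ennreal_leI) (simp add: mult_ac)
    finally show "(\<Sum>i. hausdorff_gauge m s ((F \<circ> prod_decode) i)) \<le> ennreal \<epsilon>" .
  qed
qed

lemma hausdorff_dim_le:
  assumes "0 \<le> s" "hausdorff_outer_measure m s S = 0"
  shows "hausdorff_dim m S \<le> ereal s"
  using assms unfolding hausdorff_dim_def by (intro Inf_lower) auto

text \<open>Any finite bound will do; it makes the dimension of \<open>X\<close> a real number in
  the final comparison. The ball of radius \<open>2 ^ l\<close> is covered by
  \<open>C * 2 powr (2 * d * l)\<close> balls of radius \<open>2 powr (- l)\<close>, and each point
  lies in it for all large \<open>l\<close>; the exponent \<open>3 * d\<close> only has to exceed
  \<open>2 * d\<close>.\<close>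

lemma hausdorff_dim_finite:
  fixes X :: "'a::euclidean_space set"
  shows "hausdorff_dim euclidean_metric X < \<infinity>"
proof -
  define d where "d = DIM('a)"
  define s where "s = 3 * real d"
  define C where "C = (5 * (real d + 1)) ^ d"
  have "\<exists>Y::'a set. finite Y \<and> real (card Y) \<le> C * 2 powr (2 * real d * real l)
      \<and> (\<forall>z. norm z \<le> 2 ^ l \<longrightarrow> (\<exists>y\<in>Y. norm (z - y) \<le> 2 powr (- real l)))" for l :: nat
  proof -
    have "2 powr - real l \<le> (2::real) ^ l"
      using powr_mono[of "- real l" "real l" 2] by (simp add: powr_realpow)
    then obtain Y :: "'a set" where Y: "finite Y" "real (card Y) \<le> (5 * (real DIM('a) + 1) * 2 ^ l / 2 powr (- real l)) ^ dim (UNIV :: 'a set)"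
      "\<And>z. norm z \<le> 2 ^ l \<Longrightarrow> \<exists>y\<in>Y. norm (z - y) \<le> 2 powr (- real l)"
      using subspace_net[of "UNIV :: 'a set" "2 powr (- real l)" "2 ^ l"] by (metis UNIV_I powr_gt_zero subspace_UNIV zero_neq_numeral)
    have "2 ^ l / 2 powr (- real l) = 2 powr (2 * real l)"
      by (simp add: powr_realpow[symmetric] powr_diff[symmetric])
    then have "(5 * (real DIM('a) + 1) * 2 ^ l / 2 powr (- real l)) ^ dim (UNIV :: 'a set)
        = C * (2 powr (2 * real l)) ^ d"
      by (simp add: C_def d_def power_mult_distrib flip: times_divide_eq_right)
    also have "(2 powr (2 * real l)) ^ d = 2 powr (2 * real d * real l)"
      by (simp add: powr_realpow[symmetric] powr_powr mult_ac)
    finally show ?thesis using Y by auto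
  qed
  then obtain Y :: "nat \<Rightarrow> 'a set" where Y: "\<And>l. finite (Y l)"
    "\<And>l. real (card (Y l)) \<le> C * 2 powr (2 * real d * real l)"
    "\<And>l z. norm z \<le> 2 ^ l \<Longrightarrow> \<exists>y\<in>Y l. norm (z - y) \<le> 2 powr (- real l)"
    by metis
  have "hausdorff_outer_measure euclidean_metric s X = 0"
  proof (rule hausdorff_outer_measure_limsup_eq_0[where \<U> = "\<lambda>l. (\<lambda>y. cball y (2 powr (- real l))) ` Y l"
        and r = 2 and \<beta> = "2 * real d" and C = C and ?l0.0 = 0])
    show "0 < s" "2 * real d < s" by (simp_all add: s_def d_def)
    fix l :: nat
    have "card ((\<lambda>y. cball y (2 powr (- real l))) ` Y l) \<le> card (Y l)" by (rule card_image_le) (rule Y)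
    then show "real (card ((\<lambda>y. cball y (2 powr (- real l))) ` Y l)) \<le> C * 2 powr (2 * real d * real l)"
      using Y(2)[of l] by linarith
    fix U x y assume "U \<in> (\<lambda>y. cball y (2 powr (- real l))) ` Y l" "x \<in> U" "y \<in> U"
    then obtain c where "dist c x \<le> 2 powr (- real l)" "dist c y \<le> 2 powr (- real l)" by auto
    then show "mdist euclidean_metric x y \<le> 2 * 2 powr (- real l)"
      using dist_triangle3[of x y c] by simp
  next
    fix x :: 'a
    obtain l0 where "norm x \<le> real l0" using real_arch_simple by blast
    moreover have "real l \<le> 2 ^ l" for l using of_nat_less_two_power[of l, where ?'a = real] by linarith
    ultimately have "norm x \<le> 2 ^ l" if "l \<ge> l0" for l
      using that by (meson of_nat_le_iff order_trans)
    then have "x \<in> \<Union>((\<lambda>y. cball y (2 powr (- real l))) ` Y l)" if "l \<ge> l0" for l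
      using Y(3)[of x l] that by (auto simp: dist_norm norm_minus_commute)
    then show "\<exists>\<^sub>\<infinity>l. x \<in> \<Union>((\<lambda>y. cball y (2 powr (- real l))) ` Y l)"
      unfolding INFM_nat_le by (meson linear)
  qed (use Y in auto)
  then have "hausdorff_dim euclidean_metric X \<le> ereal s"
    by (intro hausdorff_dim_le) (auto simp: s_def)
  then show ?thesis by (rule order_le_less_trans) simp
qed

lemma dyadic_between:
  fixes \<rho> :: real
  assumes "0 < \<rho>" "\<rho> \<le> 1"
  obtains j :: nat where "\<rho> \<le> 2 powr (- real j)" "2 powr (- real j - 1) \<le> \<rho>"
proof
  define j where "j = nat \<lfloor>- log 2 \<rho>\<rfloor>"
  have "log 2 \<rho> \<le> 0" using assms by simp
  then have j: "real j \<le> - log 2 \<rho>" "- log 2 \<rho> \<le> real j + 1" by (auto simp: j_def)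
  have \<rho>: "\<rho> = 2 powr (log 2 \<rho>)" using assms by simp
  show "\<rho> \<le> 2 powr (- real j)" by (subst \<rho>, rule powr_mono) (use j in auto)
  show "2 powr (- real j - 1) \<le> \<rho>" by (subst \<rho>, rule powr_mono) (use j in auto)
qed

text \<open>A mass distribution argument: for almost every \<open>y\<close> the set \<open>{x. dist (f x) (f y) \<le> 2 powr - j}\<close>
  has measure \<open>O(2 powr (- u * j))\<close>, because \<open>u < w\<close>.\<close>

lemma hausdorff_dim_image_ge:
  fixes f :: "'a \<Rightarrow> 'b::euclidean_space" and M :: "'a measure" and u w C :: real
  assumes "finite_measure M" and f [measurable]: "f \<in> borel_measurable M"
    and A [measurable]: "A \<in> sets M" and "A \<subseteq> X" "0 < emeasure M A"
    and "0 \<le> u" "u < w"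
    and bound: "\<And>j::nat. (\<integral>\<^sup>+y. emeasure M {x \<in> space M. dist (f x) (f y) \<le> 2 powr (- real j)} \<partial>M)
      \<le> ennreal (C * 2 powr (- w * j))"
  shows "ereal u \<le> hausdorff_dim euclidean_metric (f ` X)"
proof (rule ccontr)
  interpret finite_measure M by fact
  define E where "E j y = emeasure M {x \<in> space M. dist (f x) (f y) \<le> 2 powr (- real j)}" for j y
  have E [measurable]: "E j \<in> borel_measurable M" for j unfolding E_def by measurable
  define F where "F y = (\<Sum>j. ennreal (2 powr (u * real j)) * E j y)" for y
  have F [measurable]: "F \<in> borel_measurable M" unfolding F_def by measurable
  define q where "q = 2 powr (u - w)"
  have q: "0 < q" "q < 1" using \<open>u < w\<close> by (auto simp: q_def powr_less_one)
  have Eint: "(\<integral>\<^sup>+y. E j y \<partial>M) \<le> ennreal (\<bar>C\<bar> * 2 powr (- w * j))" for j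
    unfolding E_def by (rule order_trans[OF bound]) (auto intro!: ennreal_leI mult_right_mono)
  have "integral\<^sup>N M F = (\<Sum>j. \<integral>\<^sup>+y. ennreal (2 powr (u * real j)) * E j y \<partial>M)"
    unfolding F_def by (intro nn_integral_suminf) measurable
  also have "\<dots> \<le> (\<Sum>j. ennreal (\<bar>C\<bar> * q ^ j))"
  proof (intro suminf_le)
    fix j
    have "(\<integral>\<^sup>+y. ennreal (2 powr (u * real j)) * E j y \<partial>M) = ennreal (2 powr (u * real j)) * (\<integral>\<^sup>+y. E j y \<partial>M)"
      by (intro nn_integral_cmult) measurable
    also have "\<dots> \<le> ennreal (2 powr (u * real j)) * ennreal (\<bar>C\<bar> * 2 powr (- w * j))"
      by (rule mult_left_mono[OF Eint]) simp
    also have "\<dots> = ennreal (\<bar>C\<bar> * (2 powr (u * real j) * 2 powr (- w * j)))"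
      by (simp add: ennreal_mult[symmetric] mult_ac)
    also have "2 powr (u * real j) * 2 powr (- w * j) = 2 powr ((u - w) * real j)"
      by (simp add: powr_add[symmetric] algebra_simps)
    also have "\<dots> = q ^ j"
      by (simp only: q_def powr_powr[symmetric] powr_realpow[OF powr_gt_zero[THEN iffD2]])
    finally show "(\<integral>\<^sup>+y. ennreal (2 powr (u * real j)) * E j y \<partial>M) \<le> ennreal (\<bar>C\<bar> * q ^ j)" .
  qed auto
  also have "\<dots> = ennreal (\<bar>C\<bar> * (1 / (1 - q)))"
    using q by (intro suminf_ennreal_eq sums_mult geometric_sums) auto
  finally have "integral\<^sup>N M F \<noteq> \<infinity>" by (auto simp: top_unique)
  then have ae: "AE y in M. F y \<noteq> \<infinity>" by (intro nn_integral_PInf_AE) auto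
  \<comment> \<open>On \<open>Y n\<close> the pointwise bounds hold with the single constant
    \<open>n\<close>. Since \<open>F\<close> is finite almost everywhere, these sets exhaust
    \<open>A\<close> up to a null set, so one of them has positive measure.\<close>
  define Y where "Y n = {y \<in> A. F y \<le> of_nat n}" for n
  have Y [measurable]: "Y n \<in> sets M" for n
  proof -
    have "Y n = A \<inter> {y \<in> space M. F y \<le> of_nat n}"
      using sets.sets_into_space[OF A] by (auto simp: Y_def)
    also have "\<dots> \<in> sets M" by measurable
    finally show ?thesis .
  qed
  have "\<exists>n. emeasure M (Y n) \<noteq> 0"
  proof (rule ccontr)
    assume "\<not> ?thesis"
    then have "AE y in M. y \<notin> Y n" for n using Y by (auto intro!: AE_I[of _ _ "Y n"])
    then have "AE y in M. \<forall>n. y \<notin> Y n" by (simp add: AE_all_countable)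
    with ae have "AE y in M. y \<notin> A"
    proof eventually_elim
      fix y assume y: "F y \<noteq> \<infinity>" "\<forall>n. y \<notin> Y n"
      then obtain n where "F y \<le> of_nat n"
        by (metis ennreal_Ex_less_of_nat infinity_ennreal_def less_imp_le top.not_eq_extremum)
      with y show "y \<notin> A" by (auto simp: Y_def)
    qed
    then have "emeasure M {x \<in> space M. x \<in> A} = 0" by (rule emeasure_eq_0_AE)
    moreover have "{x \<in> space M. x \<in> A} = A" using sets.sets_into_space[OF A] by auto
    ultimately show False using \<open>0 < emeasure M A\<close> by simp
  qed
  then obtain n where n: "0 < emeasure M (Y n)" by (auto simp: zero_less_iff_neq_zero)
  have Ebound: "E j y \<le> ennreal (real n * 2 powr (- u * real j))" if "y \<in> Y n" for j y
  proof -
    have "ennreal (2 powr (u * real j)) * E j y \<le> F y"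
      unfolding F_def using sum_le_suminf[of "\<lambda>j. ennreal (2 powr (u * real j)) * E j y" "{j}"] by simp
    also have "\<dots> \<le> ennreal (real n)" using that by (simp add: Y_def ennreal_of_nat_eq_real_of_nat)
    finally have *: "ennreal (2 powr (u * real j)) * E j y \<le> ennreal (real n)" .
    have "E j y = ennreal (2 powr (- u * real j)) * (ennreal (2 powr (u * real j)) * E j y)"
      by (simp add: mult.assoc[symmetric] ennreal_mult[symmetric] powr_add[symmetric])
    also have "\<dots> \<le> ennreal (2 powr (- u * real j)) * ennreal (real n)"
      by (rule mult_left_mono[OF *]) simp
    finally show ?thesis by (simp add: ennreal_mult[symmetric] mult.commute)
  qed
  assume "\<not> ereal u \<le> hausdorff_dim euclidean_metric (f ` X)"
  then obtain s where s: "0 \<le> s" "s < u" "hausdorff_outer_measure euclidean_metric s (f ` X) = 0"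
    unfolding hausdorff_dim_def not_le Inf_less_iff by auto
  let ?G = "hausdorff_gauge (euclidean_metric :: 'b metric) s"
  have "(INF U\<in>delta_covers euclidean_metric 1 (f ` X). \<Sum>i. ?G (U i)) \<le> 0"
    using SUP_upper[of 1 "{0<..}" "\<lambda>\<delta>. INF U\<in>delta_covers euclidean_metric \<delta> (f ` X). \<Sum>i. ?G (U i)"] s(3)
    by (simp add: hausdorff_outer_measure_def)
  then have inf0: "(INF U\<in>delta_covers euclidean_metric 1 (f ` X). \<Sum>i. ?G (U i)) = 0" by simp
  define c where "c = real n * 2 powr u"
  have "emeasure M (Y n) \<le> 0 + ennreal \<epsilon>" if "0 < \<epsilon>" for \<epsilon>
  proof -
    \<comment> \<open>The divisor \<open>c + 1\<close> stays positive even if \<open>n = 0\<close>,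
      where \<open>c\<close> vanishes.\<close>
    have "(INF U\<in>delta_covers euclidean_metric 1 (f ` X). \<Sum>i. ?G (U i)) < ennreal (\<epsilon> / (c + 1))"
      using that by (simp add: inf0 c_def add_nonneg_pos)
    then obtain U where U: "U \<in> delta_covers euclidean_metric 1 (f ` X)" "(\<Sum>i. ?G (U i)) < ennreal (\<epsilon> / (c + 1))"
      by (auto simp: INF_less_iff)
    have Udist: "dist x y \<le> 1" if "x \<in> U i" "y \<in> U i" for i x y
      using U(1) that by (auto simp: delta_covers_def)
    \<comment> \<open>The members of a cover are arbitrary sets. The part of \<open>Y n\<close>
      mapped into \<open>U i\<close> is therefore enclosed in a measurable \<open>T\<close>, the
      preimage of a closed ball around one image point.\<close>
    have "\<exists>T\<in>sets M. Y n \<inter> f -` U i \<subseteq> T \<and> emeasure M T \<le> ennreal c * ?G (U i)" for i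
    proof (cases "Y n \<inter> f -` U i = {}")
      case False
      then obtain y where y: "y \<in> Y n" "f y \<in> U i" by blast
      define \<rho> where "\<rho> = mdiameter euclidean_metric (U i)"
      have \<rho>: "0 \<le> \<rho>" "\<rho> \<le> 1" "\<And>x. x \<in> U i \<Longrightarrow> dist x (f y) \<le> \<rho>"
        using mdiameter_bounds[of "U i" euclidean_metric 1] Udist y(2) by (auto simp: \<rho>_def)
      define T where "T = {x \<in> space M. dist (f x) (f y) \<le> \<rho>}"
      have T: "T \<in> sets M" unfolding T_def by measurable
      have TE: "emeasure M T \<le> E j y" if "\<rho> \<le> 2 powr (- real j)" for j
        unfolding E_def T_def using that by (intro emeasure_mono) (auto intro: order_trans)
      have "emeasure M T \<le> ennreal c * ?G (U i)"
      \<comment> \<open>Diameter 0 has no comparable dyadic scale, and its gauge is 0 unless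
        \<open>s = 0\<close>. The bounds for all scales \<open>j\<close> apply simultaneously and
        show that the fibre is null, because \<open>u > s \<ge> 0\<close>.\<close>
      proof (cases "\<rho> = 0")
        case True
        have "emeasure M T \<le> ennreal (real n * (2 powr (- u)) ^ j)" for j
        proof -
          have "(2 powr (- u)) ^ j = 2 powr (- u * real j)"
            by (simp only: powr_powr[symmetric] powr_realpow[OF powr_gt_zero[THEN iffD2]])
          then show ?thesis using TE[of j] Ebound[OF y(1), of j] True by auto
        qed
        moreover have "(\<lambda>j. ennreal (real n * (2 powr (- u)) ^ j)) \<longlonglongrightarrow> ennreal (real n * 0)"
          using s by (intro tendsto_ennrealI tendsto_mult tendsto_const LIMSEQ_realpow_zero) (auto simp: powr_less_one)
        ultimately have "emeasure M T \<le> ennreal (real n * 0)"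
          by (intro LIMSEQ_le_const) auto
        then show ?thesis by simp
      next
        case False
        then have "0 < \<rho>" using \<rho> by simp
        then obtain j where j: "\<rho> \<le> 2 powr (- real j)" "2 powr (- real j - 1) \<le> \<rho>"
          using dyadic_between \<rho>(2) by blast
        have "2 powr (- u * real j) = 2 powr u * (2 powr (- real j - 1)) powr u"
          by (simp add: powr_powr powr_add[symmetric] algebra_simps)
        also have "\<dots> \<le> 2 powr u * \<rho> powr u"
          using j s by (intro mult_left_mono powr_mono2) auto
        also have "\<dots> \<le> 2 powr u * \<rho> powr s"
          using \<rho> s by (intro mult_left_mono powr_mono') auto
        finally have "real n * 2 powr (- u * real j) \<le> c * \<rho> powr s"
          unfolding c_def mult.assoc by (intro mult_left_mono) auto
        then have "emeasure M T \<le> ennreal (c * \<rho> powr s)"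
          using TE[OF j(1)] Ebound[OF y(1), of j] by (meson ennreal_leI order_trans)
        also have "\<dots> \<le> ennreal c * ?G (U i)"
          using y(2) \<open>0 < \<rho>\<close> by (auto simp: hausdorff_gauge_def \<rho>_def c_def ennreal_mult)
        finally show ?thesis .
      qed
      moreover have "Y n \<inter> f -` U i \<subseteq> T"
        using \<rho>(3) sets.sets_into_space[OF Y] by (auto simp: T_def)
      ultimately show ?thesis using T by blast
    qed (auto intro!: bexI[of _ "{}"])
    then obtain T where T: "\<And>i. T i \<in> sets M" "\<And>i. Y n \<inter> f -` U i \<subseteq> T i"
      "\<And>i. emeasure M (T i) \<le> ennreal c * ?G (U i)" by metis
    have "Y n \<subseteq> (\<Union>i. T i)"
    proof
      fix y assume "y \<in> Y n"
      moreover from this have "f y \<in> f ` X" using \<open>A \<subseteq> X\<close> by (auto simp: Y_def)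
      then obtain i where "f y \<in> U i" using U(1) by (auto simp: delta_covers_def)
      ultimately show "y \<in> (\<Union>i. T i)" using T(2)[of i] by auto
    qed
    then have "emeasure M (Y n) \<le> emeasure M (\<Union>i. T i)" using T by (intro emeasure_mono) auto
    also have "\<dots> \<le> (\<Sum>i. emeasure M (T i))" using T by (intro emeasure_subadditive_countably) auto
    also have "\<dots> \<le> (\<Sum>i. ennreal c * ?G (U i))" by (intro suminf_le T) auto
    also have "\<dots> = ennreal c * (\<Sum>i. ?G (U i))" by simp
    also have "\<dots> \<le> ennreal c * ennreal (\<epsilon> / (c + 1))" using U(2) by (intro mult_left_mono) auto
    also have "\<dots> \<le> ennreal \<epsilon>"
      using that by (auto simp: ennreal_mult[symmetric] c_def add_nonneg_pos divide_simps intro!: ennreal_leI)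
    finally show ?thesis by simp
  qed
  then have "emeasure M (Y n) \<le> 0" by (rule ennreal_le_epsilon)
  with n show False by simp
qed

section \<open>Fourier transforms and projected measures\<close>

lemma fourier_transform_cis:
  "fourier_transform \<mu> z = (LINT x|\<mu>. cis (- (2 * pi * (z \<bullet> x))))"
  unfolding fourier_transform_def
  by (intro Bochner_Integration.integral_cong) (simp_all add: cis_conv_exp mult_ac)

lemma integrable_bounded_borel:
  fixes f :: "'a \<Rightarrow> 'b::{banach, second_countable_topology}"
  assumes "finite_measure M" "f \<in> borel_measurable M" "\<And>x. norm (f x) \<le> B"
  shows "integrable M f"
  using assms by (intro finite_measure.integrable_const_bound[of M f B]) auto

lemma cis_measurable [measurable]: "cis \<in> borel_measurable borel"
  by (intro borel_measurable_continuous_onI continuous_intros)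

lemma cnj_measurable [measurable]: "cnj \<in> borel_measurable borel"
  by (intro borel_measurable_continuous_onI continuous_intros)

lemma norm_fourier_transform_le:
  assumes "finite_measure \<mu>" "sets \<mu> = sets borel"
  shows "cmod (fourier_transform \<mu> z) \<le> measure \<mu> UNIV"
proof -
  have [measurable_cong]: "sets \<mu> = sets borel" by fact
  have sp: "space \<mu> = UNIV" using assms(2) sets_eq_imp_space_eq by fastforce
  interpret finite_measure \<mu> by fact
  show ?thesis
    using integral_norm_bound[of \<mu> "\<lambda>x. cis (- (2 * pi * (z \<bullet> x)))"]
    by (simp add: fourier_transform_cis sp)
qed

lemma fourier_transform_measurable [measurable]:
  fixes \<mu> :: "'a::euclidean_space measure"
  assumes "finite_measure \<mu>" "sets \<mu> = sets borel"
  shows "fourier_transform \<mu> \<in> borel_measurable borel"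
proof -
  interpret finite_measure \<mu> by fact
  have [measurable_cong]: "sets \<mu> = sets borel" by fact
  have "(\<lambda>z. LINT x|\<mu>. cis (- (2 * pi * (z \<bullet> x)))) \<in> borel_measurable borel"
    by (rule borel_measurable_lebesgue_integral) measurable
  then show ?thesis by (simp add: fourier_transform_cis[abs_def])
qed

text \<open>The transform times its conjugate is one integral over pairs of points. In this form the
  duality below is a mere exchange of integrals.\<close>

lemma cmod_fourier_transform_squared:
  fixes \<mu> :: "'a::euclidean_space measure"
  assumes "finite_measure \<mu>" "sets \<mu> = sets borel"
  shows "(LINT p|(\<mu> \<Otimes>\<^sub>M \<mu>). cis (- (2 * pi * (z \<bullet> (fst p - snd p)))))
    = of_real ((cmod (fourier_transform \<mu> z))\<^sup>2)"
proof -
  have [measurable_cong]: "sets \<mu> = sets borel" by fact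
  interpret finite_measure \<mu> by fact
  interpret P: pair_sigma_finite \<mu> \<mu> ..
  have fin: "finite_measure (\<mu> \<Otimes>\<^sub>M \<mu>)" by (intro finite_measure_pair_measure assms)
  let ?e = "\<lambda>x. cis (- (2 * pi * (z \<bullet> x)))"
  have split: "cis (- (2 * pi * (z \<bullet> (x - y)))) = ?e x * cnj (?e y)" for x y
    by (simp add: cis_cnj cis_mult inner_diff_right algebra_simps)
  have "(LINT p|(\<mu> \<Otimes>\<^sub>M \<mu>). cis (- (2 * pi * (z \<bullet> (fst p - snd p)))))
      = (LINT x|\<mu>. LINT y|\<mu>. ?e x * cnj (?e y))"
    by (subst P.integral_fst'[symmetric])
      (auto simp: split intro!: integrable_bounded_borel[where B = 1] fin simp: norm_mult)
  also have "\<dots> = (LINT x|\<mu>. ?e x) * cnj (LINT y|\<mu>. ?e y)"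
    by (simp add: Bochner_Integration.integral_cnj)
  also have "\<dots> = of_real ((cmod (fourier_transform \<mu> z))\<^sup>2)"
    by (simp only: fourier_transform_cis[symmetric] complex_norm_square)
  finally show ?thesis .
qed

text \<open>Both sides integrate, over two pairs of points, a character of the inner product of
  their differences; this kernel is symmetric in the two pairs and bounded, so Fubini applies to the
  finite product measure.\<close>

lemma fourier_transform_duality:
  fixes \<mu> \<nu> :: "'a::euclidean_space measure"
  assumes \<mu>: "finite_measure \<mu>" "sets \<mu> = sets borel" and \<nu>: "finite_measure \<nu>" "sets \<nu> = sets borel"
  shows "(LINT p|(\<mu> \<Otimes>\<^sub>M \<mu>). (cmod (fourier_transform \<nu> (fst p - snd p)))\<^sup>2)
    = (LINT q|(\<nu> \<Otimes>\<^sub>M \<nu>). (cmod (fourier_transform \<mu> (fst q - snd q)))\<^sup>2)"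
proof -
  have [measurable_cong]: "sets \<mu> = sets borel" "sets \<nu> = sets borel" by fact+
  have fin: "finite_measure (\<mu> \<Otimes>\<^sub>M \<mu>)" "finite_measure (\<nu> \<Otimes>\<^sub>M \<nu>)"
    by (intro finite_measure_pair_measure assms)+
  interpret M: finite_measure "\<mu> \<Otimes>\<^sub>M \<mu>" by fact
  interpret N: finite_measure "\<nu> \<Otimes>\<^sub>M \<nu>" by fact
  interpret P: pair_sigma_finite "\<mu> \<Otimes>\<^sub>M \<mu>" "\<nu> \<Otimes>\<^sub>M \<nu>" ..
  have fin2: "finite_measure ((\<mu> \<Otimes>\<^sub>M \<mu>) \<Otimes>\<^sub>M (\<nu> \<Otimes>\<^sub>M \<nu>))"
    by (intro finite_measure_pair_measure fin)
  let ?h = "\<lambda>p q. cis (- (2 * pi * ((fst p - snd p) \<bullet> (fst q - snd q))))"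
  have "complex_of_real (LINT p|(\<mu> \<Otimes>\<^sub>M \<mu>). (cmod (fourier_transform \<nu> (fst p - snd p)))\<^sup>2)
      = (LINT p|(\<mu> \<Otimes>\<^sub>M \<mu>). LINT q|(\<nu> \<Otimes>\<^sub>M \<nu>). ?h p q)"
    by (simp add: cmod_fourier_transform_squared[OF \<nu>] integral_complex_of_real[symmetric] del: integral_complex_of_real of_real_power)
  also have "\<dots> = (LINT q|(\<nu> \<Otimes>\<^sub>M \<nu>). LINT p|(\<mu> \<Otimes>\<^sub>M \<mu>). ?h p q)"
    by (rule P.Fubini_integral[symmetric])
      (auto simp: split_beta' intro!: integrable_bounded_borel[where B = 1] fin2)
  also have "\<dots> = (LINT q|(\<nu> \<Otimes>\<^sub>M \<nu>). LINT p|(\<mu> \<Otimes>\<^sub>M \<mu>). ?h q p)"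
    by (simp add: inner_commute)
  also have "\<dots> = complex_of_real (LINT q|(\<nu> \<Otimes>\<^sub>M \<nu>). (cmod (fourier_transform \<mu> (fst q - snd q)))\<^sup>2)"
    by (simp add: cmod_fourier_transform_squared[OF \<mu>] integral_complex_of_real[symmetric] del: integral_complex_of_real of_real_power)
  finally show ?thesis by (simp only: of_real_eq_iff)
qed

lemma nn_fourier_transform_duality:
  fixes \<mu> \<nu> :: "'a::euclidean_space measure"
  assumes \<mu>: "finite_measure \<mu>" "sets \<mu> = sets borel" and \<nu>: "finite_measure \<nu>" "sets \<nu> = sets borel"
  shows "(\<integral>\<^sup>+y. \<integral>\<^sup>+x. ennreal ((cmod (fourier_transform \<nu> (x - y)))\<^sup>2) \<partial>\<mu> \<partial>\<mu>)
    = (\<integral>\<^sup>+y. \<integral>\<^sup>+x. ennreal ((cmod (fourier_transform \<mu> (x - y)))\<^sup>2) \<partial>\<nu> \<partial>\<nu>)"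
proof -
  have *: "(\<integral>\<^sup>+y. \<integral>\<^sup>+x. ennreal ((cmod (fourier_transform \<beta> (x - y)))\<^sup>2) \<partial>\<alpha> \<partial>\<alpha>)
      = ennreal (LINT p|(\<alpha> \<Otimes>\<^sub>M \<alpha>). (cmod (fourier_transform \<beta> (fst p - snd p)))\<^sup>2)"
    if a: "finite_measure \<alpha>" "sets \<alpha> = sets borel" and b: "finite_measure \<beta>" "sets \<beta> = sets borel"
    for \<alpha> \<beta> :: "'a measure"
  proof -
    have [measurable_cong]: "sets \<alpha> = sets borel" by fact
    have [measurable]: "fourier_transform \<beta> \<in> borel_measurable borel"
      by (rule fourier_transform_measurable) fact+
    interpret A: finite_measure \<alpha> by fact
    interpret P: pair_sigma_finite \<alpha> \<alpha> ..
    have "(\<integral>\<^sup>+y. \<integral>\<^sup>+x. ennreal ((cmod (fourier_transform \<beta> (x - y)))\<^sup>2) \<partial>\<alpha> \<partial>\<alpha>)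
        = (\<integral>\<^sup>+p. ennreal ((cmod (fourier_transform \<beta> (fst p - snd p)))\<^sup>2) \<partial>(\<alpha> \<Otimes>\<^sub>M \<alpha>))"
      by (subst P.nn_integral_snd[symmetric]) (auto simp: split_beta')
    also have "\<dots> = ennreal (LINT p|(\<alpha> \<Otimes>\<^sub>M \<alpha>). (cmod (fourier_transform \<beta> (fst p - snd p)))\<^sup>2)"
    proof (rule nn_integral_eq_integral)
      show "integrable (\<alpha> \<Otimes>\<^sub>M \<alpha>) (\<lambda>p. (cmod (fourier_transform \<beta> (fst p - snd p)))\<^sup>2)"
        using norm_fourier_transform_le[OF b]
        by (intro integrable_bounded_borel[where B = "(measure \<beta> UNIV)\<^sup>2"] finite_measure_pair_measure a)
          (auto intro!: power_mono)
    qed simp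
    finally show ?thesis .
  qed
  show ?thesis by (simp add: * \<mu> \<nu> fourier_transform_duality)
qed

lemma nn_integral_lborel_shift:
  fixes f :: "'a::euclidean_space \<Rightarrow> ennreal"
  assumes [measurable]: "f \<in> borel_measurable borel"
  shows "(\<integral>\<^sup>+x. f (x - y) \<partial>lborel) = integral\<^sup>N lborel f"
proof -
  have "integral\<^sup>N lborel f = (\<integral>\<^sup>+x. f x \<partial>distr lborel borel ((+) (- y)))"
    by (simp add: lborel_distr_plus)
  also have "\<dots> = (\<integral>\<^sup>+x. f (x - y) \<partial>lborel)"
    by (subst nn_integral_distr) (auto simp: algebra_simps)
  finally show ?thesis ..
qed

text \<open>The phases are at most \<open>2 * pi / 8\<close>, hence below \<open>pi / 3\<close>, so
  the integrand has real part at least \<open>1 / 2\<close> and no cancellation occurs.\<close>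

lemma norm_fourier_transform_indicator_ge:
  fixes Q :: "'a::euclidean_space set"
  assumes fin: "emeasure lborel Q < \<infinity>" and Q: "Q \<in> sets borel"
    and small: "\<And>z. z \<in> Q \<Longrightarrow> \<bar>z \<bullet> v\<bar> \<le> 1 / 8"
  shows "measure lborel Q / 2 \<le> cmod (fourier_transform (density lborel (indicator Q)) v)"
proof -
  let ?N = "density lborel (indicator Q)"
  interpret N: finite_measure ?N
    by standard (use fin Q in \<open>simp add: emeasure_density\<close>)
  have [measurable]: "Q \<in> sets borel" by fact
  have mN: "measure ?N UNIV = measure lborel Q"
    using Q by (simp add: measure_def emeasure_density)
  have int: "integrable ?N (\<lambda>z. cis (- (2 * pi * (v \<bullet> z))))"
    by (intro integrable_bounded_borel[where B = 1] N.finite_measure_axioms) auto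
  have "measure lborel Q / 2 = (LINT z|?N. 1 / 2)"
    using mN by simp
  also have "\<dots> \<le> (LINT z|?N. Re (cis (- (2 * pi * (v \<bullet> z)))))"
  proof (rule integral_mono_AE)
    show "integrable ?N (\<lambda>z. Re (cis (- (2 * pi * (v \<bullet> z)))))"
      by (intro integrable_bounded_borel[where B = 1] N.finite_measure_axioms) auto
    show "AE z in ?N. 1 / 2 \<le> Re (cis (- (2 * pi * (v \<bullet> z))))"
    proof (subst AE_density, simp, rule AE_I2, rule impI)
      fix z assume "0 < (indicator Q z :: ennreal)"
      then have "z \<in> Q" by (cases "z \<in> Q") auto
      then have "\<bar>v \<bullet> z\<bar> \<le> 1 / 8" using small inner_commute by metis
      then have "\<bar>2 * pi * (v \<bullet> z)\<bar> \<le> 2 * pi * (1 / 8)"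
        unfolding abs_mult by (intro mult_mono) auto
      then have le: "\<bar>2 * pi * (v \<bullet> z)\<bar> \<le> pi / 3" using pi_gt_zero by linarith
      have "cos (pi / 3) \<le> cos \<bar>2 * pi * (v \<bullet> z)\<bar>"
        by (rule cos_monotone_0_pi_le) (use le pi_gt_zero in auto)
      then show "1 / 2 \<le> Re (cis (- (2 * pi * (v \<bullet> z))))" by (simp add: cos_60)
    qed
  qed simp
  also have "\<dots> = Re (fourier_transform ?N v)"
    unfolding fourier_transform_cis by (rule integral_Re[OF int])
  also have "\<dots> \<le> cmod (fourier_transform ?N v)" by (rule complex_Re_le_cmod)
  finally show ?thesis .
qed

lemma inner_orth_proj_split:
  assumes "subspace V"
  shows "\<bar>z \<bullet> v\<bar> \<le> norm (orth_proj V z) * norm (orth_proj V v) + norm (z - orth_proj V z) * norm v"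
proof -
  have "z \<bullet> v = orth_proj V z \<bullet> orth_proj V v + (z - orth_proj V z) \<bullet> v"
    using inner_orth_proj(2)[OF assms, of z v] by (simp add: inner_diff_left)
  then show ?thesis
    using Cauchy_Schwarz_ineq2[of "orth_proj V z" "orth_proj V v"]
      Cauchy_Schwarz_ineq2[of "z - orth_proj V z" v] by linarith
qed

text \<open>The correlation of \<open>\<mu>\<close> at scale \<open>\<delta>\<close> after projection to \<open>V\<close> is controlled by the frequencies in
  a plate around \<open>V\<close>: test against \<open>\<bar>fourier_transform \<nu> (x - y)\<bar>\<^sup>2\<close> where \<open>\<nu>\<close> is
  Lebesgue measure on the dual plate \<open>Q\<close>, and move the transform to \<open>\<mu>\<close> by duality.\<close>

lemma projected_correlation_le:
  fixes \<mu> :: "'a::euclidean_space measure"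
  assumes \<mu>: "finite_measure \<mu>" "sets \<mu> = sets borel" and R: "AE x in \<mu>. norm x \<le> R" "0 \<le> R"
  obtains C where "0 < C" "\<And>V \<delta>. subspace V \<Longrightarrow> 0 < \<delta> \<Longrightarrow> \<delta> \<le> 1 \<Longrightarrow>
    (\<integral>\<^sup>+y. emeasure \<mu> {x \<in> space \<mu>. dist (orth_proj V x) (orth_proj V y) \<le> \<delta>} \<partial>\<mu>)
      \<le> ennreal (C * \<delta> ^ dim V)
        * (\<integral>\<^sup>+z. ennreal ((cmod (fourier_transform \<mu> z))\<^sup>2) * indicator (plate V (1 / \<delta>) 1) z \<partial>lborel)"
proof -
  have [measurable_cong]: "sets \<mu> = sets borel" by fact
  have sp: "space \<mu> = UNIV" using \<mu>(2) sets_eq_imp_space_eq by fastforce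
  have FT [measurable]: "fourier_transform \<mu> \<in> borel_measurable borel"
    by (rule fourier_transform_measurable) fact+
  interpret finite_measure \<mu> by fact
  obtain c0 where c0: "c0 > 0" "\<And>(V::'a set) a b. subspace V \<Longrightarrow> 0 < b \<Longrightarrow> b \<le> a \<Longrightarrow>
    ennreal (c0 * a ^ dim V * b ^ (DIM('a) - dim V)) \<le> emeasure lborel (plate V a b)"
    using plate_volume_lower by blast
  \<comment> \<open>For \<open>z\<close> in the dual plate and a difference of norm at most
    \<open>2 * R\<close> whose projection has norm at most \<delta>, the inner product is at most
    \<open>c1 + c2 * (2 * R) \<le> 1 / 8\<close>. The bounds \<open>c2 \<le> c1 \<le> 1 / 2\<close>
    keep differences of points of \<open>Q\<close> inside
    \<open>plate V (1 / \<delta>) 1\<close>.\<close>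
  define c1 :: real where "c1 = 1 / 16"
  define c2 where "c2 = 1 / (16 * (2 * R + 1))"
  have c: "0 < c2" "c2 \<le> c1" "c2 * (2 * R) \<le> 1 / 16" "c1 \<le> 1 / 2"
    using R(2) by (auto simp: c1_def c2_def divide_simps)
  define C where "C = 4 / (c0 * c2 ^ DIM('a))"
  have "0 < C" using c c0 by (simp add: C_def)
  moreover have "(\<integral>\<^sup>+y. emeasure \<mu> {x \<in> space \<mu>. dist (orth_proj V x) (orth_proj V y) \<le> \<delta>} \<partial>\<mu>)
      \<le> ennreal (C * \<delta> ^ dim V)
        * (\<integral>\<^sup>+z. ennreal ((cmod (fourier_transform \<mu> z))\<^sup>2) * indicator (plate V (1 / \<delta>) 1) z \<partial>lborel)"
    (is "?L \<le> _ * ?I")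
    if V: "subspace V" and \<delta>: "0 < \<delta>" "\<delta> \<le> 1" for V \<delta>
  proof -
    define Q where "Q = plate V (c1 / \<delta>) c2"
    have Q [measurable]: "Q \<in> sets borel" using V by (simp add: Q_def plate_borel)
    have P [measurable]: "plate V a b \<in> sets borel" for a b using V by (simp add: plate_borel)
    have [measurable]: "orth_proj V \<in> borel_measurable borel" using V by simp
    have fin: "emeasure lborel Q < \<infinity>"
      unfolding Q_def
      by (rule order_le_less_trans[OF emeasure_mono[OF plate_subset_cball] emeasure_lborel_cball_finite]) simp
    define q where "q = measure lborel Q"
    have emQ: "emeasure lborel Q = ennreal q" unfolding q_def using fin by (intro emeasure_eq_ennreal_measure) auto
    have "c1 \<le> c1 / \<delta>" using \<delta> by (simp add: c1_def le_divide_eq)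
    then have "c2 \<le> c1 / \<delta>" using c by linarith
    then have "ennreal (c0 * (c1 / \<delta>) ^ dim V * c2 ^ (DIM('a) - dim V)) \<le> ennreal q"
      using c0(2)[OF V c(1)] by (simp add: emQ[symmetric] Q_def)
    then have "c0 * (c1 / \<delta>) ^ dim V * c2 ^ (DIM('a) - dim V) \<le> q"
      using c0 c \<delta> by (subst (asm) ennreal_le_iff) (auto simp: q_def)
    moreover have "c0 * (c2 / \<delta>) ^ dim V * c2 ^ (DIM('a) - dim V) \<le> c0 * (c1 / \<delta>) ^ dim V * c2 ^ (DIM('a) - dim V)"
      using c c0 \<delta> by (intro mult_right_mono mult_left_mono power_mono divide_right_mono) auto
    moreover have "c2 ^ dim V * c2 ^ (DIM('a) - dim V) = c2 ^ DIM('a)"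
      by (simp add: dim_subset_UNIV flip: power_add)
    ultimately have q: "c0 * c2 ^ DIM('a) / \<delta> ^ dim V \<le> q"
      by (simp add: power_divide mult.assoc)
    have "0 < c0 * c2 ^ DIM('a) / \<delta> ^ dim V" using c0 c \<delta> by simp
    then have "0 < q" using q by linarith
    have qC: "4 / q \<le> C * \<delta> ^ dim V"
    proof -
      have "4 / q \<le> 4 / (c0 * c2 ^ DIM('a) / \<delta> ^ dim V)"
        using q \<open>0 < c0 * c2 ^ DIM('a) / \<delta> ^ dim V\<close> \<open>0 < q\<close>
        by (intro divide_left_mono mult_pos_pos) auto
      then show ?thesis by (simp add: C_def)
    qed
    define \<nu> where "\<nu> = density lborel (indicator Q :: 'a \<Rightarrow> ennreal)"
    have \<nu>: "finite_measure \<nu>" "sets \<nu> = sets borel"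
      using fin by (auto simp: \<nu>_def emeasure_density intro!: finite_measureI)
    \<comment> \<open>For pairs with close projections the transform of \<nu> has modulus at least
      \<open>q / 2\<close>, half its total mass; the normalised square thus dominates the
      indicator.\<close>
    have test: "indicator {x. dist (orth_proj V x) (orth_proj V y) \<le> \<delta>} x
        \<le> ennreal (4 / q\<^sup>2) * ennreal ((cmod (fourier_transform \<nu> (x - y)))\<^sup>2)"
      if "norm x \<le> R" "norm y \<le> R" for x y
    proof (cases "dist (orth_proj V x) (orth_proj V y) \<le> \<delta>")
      case True
      have "q / 2 \<le> cmod (fourier_transform \<nu> (x - y))"
        unfolding \<nu>_def q_def
      proof (rule norm_fourier_transform_indicator_ge[OF fin Q])
        fix z assume z: "z \<in> Q"
        have "norm (x - y) \<le> 2 * R" using that norm_triangle_ineq4[of x y] by linarith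
        then have 2: "norm (z - orth_proj V z) * norm (x - y) \<le> c2 * (2 * R)"
          using z c by (intro mult_mono) (auto simp: Q_def plate_def)
        have "norm (orth_proj V z) * norm (orth_proj V (x - y)) \<le> (c1 / \<delta>) * \<delta>"
          using z True V \<delta> c by (intro mult_mono) (auto simp: Q_def plate_def orth_proj_diff dist_norm)
        also have "\<dots> = 1 / 16" using \<delta> by (simp add: c1_def)
        finally show "\<bar>z \<bullet> (x - y)\<bar> \<le> 1 / 8"
          using inner_orth_proj_split[OF V, of z "x - y"] 2 c(3) by linarith
      qed
      then have "(q / 2)\<^sup>2 \<le> (cmod (fourier_transform \<nu> (x - y)))\<^sup>2"
        using \<open>0 < q\<close> by (intro power_mono) auto
      then have "1 \<le> 4 / q\<^sup>2 * (cmod (fourier_transform \<nu> (x - y)))\<^sup>2"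
        using \<open>0 < q\<close> by (simp add: field_simps)
      then show ?thesis using True \<open>0 < q\<close> by (simp add: ennreal_mult[symmetric])
    qed simp
    have [measurable]: "fourier_transform \<nu> \<in> borel_measurable borel"
      by (rule fourier_transform_measurable) fact+
    have "?L = (\<integral>\<^sup>+y. \<integral>\<^sup>+x. indicator {x. dist (orth_proj V x) (orth_proj V y) \<le> \<delta>} x \<partial>\<mu> \<partial>\<mu>)"
      by (simp add: sp)
    also have "\<dots> \<le> (\<integral>\<^sup>+y. \<integral>\<^sup>+x. ennreal (4 / q\<^sup>2) * ennreal ((cmod (fourier_transform \<nu> (x - y)))\<^sup>2) \<partial>\<mu> \<partial>\<mu>)"
    proof (rule nn_integral_mono_AE)
      show "AE y in \<mu>. (\<integral>\<^sup>+x. indicator {x. dist (orth_proj V x) (orth_proj V y) \<le> \<delta>} x \<partial>\<mu>)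
        \<le> (\<integral>\<^sup>+x. ennreal (4 / q\<^sup>2) * ennreal ((cmod (fourier_transform \<nu> (x - y)))\<^sup>2) \<partial>\<mu>)"
        using R(1)
      proof eventually_elim
        fix y :: 'a assume y: "norm y \<le> R"
        show "(\<integral>\<^sup>+x. indicator {x. dist (orth_proj V x) (orth_proj V y) \<le> \<delta>} x \<partial>\<mu>)
          \<le> (\<integral>\<^sup>+x. ennreal (4 / q\<^sup>2) * ennreal ((cmod (fourier_transform \<nu> (x - y)))\<^sup>2) \<partial>\<mu>)"
          by (rule nn_integral_mono_AE) (use R(1) test y in \<open>auto elim!: eventually_mono\<close>)
      qed
    qed
    also have "\<dots> = ennreal (4 / q\<^sup>2) * (\<integral>\<^sup>+y. \<integral>\<^sup>+x. ennreal ((cmod (fourier_transform \<nu> (x - y)))\<^sup>2) \<partial>\<mu> \<partial>\<mu>)"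
      by (simp add: nn_integral_cmult)
    also have "(\<integral>\<^sup>+y. \<integral>\<^sup>+x. ennreal ((cmod (fourier_transform \<nu> (x - y)))\<^sup>2) \<partial>\<mu> \<partial>\<mu>)
        = (\<integral>\<^sup>+y. \<integral>\<^sup>+x. ennreal ((cmod (fourier_transform \<mu> (x - y)))\<^sup>2) \<partial>\<nu> \<partial>\<nu>)"
      by (rule nn_fourier_transform_duality[OF \<mu> \<nu>])
    also have "\<dots> = (\<integral>\<^sup>+y. indicator Q y * (\<integral>\<^sup>+x. indicator Q x * ennreal ((cmod (fourier_transform \<mu> (x - y)))\<^sup>2) \<partial>lborel) \<partial>lborel)"
      by (simp add: \<nu>_def nn_integral_density)
    \<comment> \<open>For fixed \<open>y\<close> in \<open>Q\<close> only differences in the plate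
      occur, and translation invariance bounds the inner integral by \<open>?I\<close>. The outer
      integral then contributes just the volume \<open>q\<close>, which cancels one factor of
      \<open>4 / q\<^sup>2\<close>.\<close>
    also have "\<dots> \<le> (\<integral>\<^sup>+y. indicator Q y * ?I \<partial>lborel)"
    proof (rule nn_integral_mono)
      fix y :: 'a
      show "indicator Q y * (\<integral>\<^sup>+x. indicator Q x * ennreal ((cmod (fourier_transform \<mu> (x - y)))\<^sup>2) \<partial>lborel)
        \<le> indicator Q y * ?I"
      proof (cases "y \<in> Q")
        case True
        have sub: "x - y \<in> plate V (1 / \<delta>) 1" if "x \<in> Q" for x
        proof -
          have "norm (orth_proj V (x - y)) \<le> norm (orth_proj V x) + norm (orth_proj V y)"
            using V by (simp add: orth_proj_diff norm_triangle_ineq4)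
          also have "\<dots> \<le> c1 / \<delta> + c1 / \<delta>"
            using that True by (intro add_mono) (auto simp: Q_def plate_def)
          also have "\<dots> \<le> 1 / \<delta>" using \<delta> c(4) by (simp add: field_simps)
          finally have 1: "norm (orth_proj V (x - y)) \<le> 1 / \<delta>" .
          have "x - y - orth_proj V (x - y) = (x - orth_proj V x) - (y - orth_proj V y)"
            using V by (simp add: orth_proj_diff)
          then have "norm (x - y - orth_proj V (x - y)) \<le> norm (x - orth_proj V x) + norm (y - orth_proj V y)"
            using norm_triangle_ineq4 by metis
          also have "\<dots> \<le> c2 + c2"
            using that True by (intro add_mono) (auto simp: Q_def plate_def)
          finally show ?thesis using 1 c by (simp add: plate_def)
        qed
        have "(\<integral>\<^sup>+x. indicator Q x * ennreal ((cmod (fourier_transform \<mu> (x - y)))\<^sup>2) \<partial>lborel)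
            \<le> (\<integral>\<^sup>+x. ennreal ((cmod (fourier_transform \<mu> (x - y)))\<^sup>2) * indicator (plate V (1 / \<delta>) 1) (x - y) \<partial>lborel)"
          by (rule nn_integral_mono) (auto simp: indicator_def sub)
        also have "\<dots> = ?I"
          by (rule nn_integral_lborel_shift[where f = "\<lambda>z. ennreal ((cmod (fourier_transform \<mu> z))\<^sup>2) * indicator (plate V (1 / \<delta>) 1) z"]) measurable
        finally show ?thesis using True by simp
      qed simp
    qed
    also have "\<dots> = ennreal q * ?I" by (simp add: nn_integral_multc emQ)
    finally have "?L \<le> ennreal (4 / q\<^sup>2) * (ennreal q * ?I)"
      by (simp add: mult_left_mono)
    also have "\<dots> = ennreal (4 / q) * ?I"
      using \<open>0 < q\<close> by (simp add: mult.assoc[symmetric] ennreal_mult[symmetric] power2_eq_square)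
    also have "\<dots> \<le> ennreal (C * \<delta> ^ dim V) * ?I"
      using qC by (intro mult_right_mono ennreal_leI) auto
    finally show ?thesis .
  qed
  ultimately show thesis using that by blast
qed

section \<open>Counting subspaces near a vector\<close>

text \<open>With P and Q the projections to \<open>V\<close> and \<open>W\<close>, one has P - Q =
  (I - Q) P - Q (I - P). The first term is controlled by the assumption on \<open>V\<close>; the
  second is the adjoint of (I - P) Q and is controlled by the assumption on
  \<open>W\<close>.\<close>

lemma orth_proj_distance_le:
  fixes V W :: "'a::euclidean_space set"
  assumes V: "subspace V" and W: "subspace W" and "0 \<le> \<epsilon>"
    and VW: "\<And>v. v \<in> V \<Longrightarrow> norm (v - orth_proj W v) \<le> \<epsilon> * norm v"
    and WV: "\<And>w. w \<in> W \<Longrightarrow> norm (w - orth_proj V w) \<le> \<epsilon> * norm w"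
  shows "norm (Blinfun (orth_proj V) - Blinfun (orth_proj W)) \<le> 2 * \<epsilon>"
proof (rule norm_blinfun_bound)
  fix x :: 'a
  define r where "r = x - orth_proj V x"
  define y where "y = orth_proj W r"
  have "y \<in> W" using orth_proj_in[OF W] by (simp add: y_def)
  have "norm (orth_proj V x - orth_proj W (orth_proj V x)) \<le> \<epsilon> * norm (orth_proj V x)"
    using VW orth_proj_in[OF V] by blast
  also have "\<dots> \<le> \<epsilon> * norm x" using norm_orth_proj_le[OF V] \<open>0 \<le> \<epsilon>\<close> by (intro mult_left_mono) auto
  finally have 1: "norm (orth_proj V x - orth_proj W (orth_proj V x)) \<le> \<epsilon> * norm x" .
  have "norm y * norm y = y \<bullet> r"
    using inner_orth_proj(2)[OF W, of r r] by (simp add: y_def flip: power2_norm_eq_inner power2_eq_square)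
  also have "\<dots> = (y - orth_proj V y) \<bullet> x"
    using inner_orth_proj(1)[OF V, of y x] by (simp add: r_def inner_diff_left inner_diff_right)
  also have "\<dots> \<le> norm (y - orth_proj V y) * norm x" by (rule norm_cauchy_schwarz)
  also have "\<dots> \<le> (\<epsilon> * norm y) * norm x" using WV[OF \<open>y \<in> W\<close>] by (intro mult_right_mono) auto
  finally have "norm y * norm y \<le> (\<epsilon> * norm x) * norm y" by (simp add: mult_ac)
  then have 2: "norm y \<le> \<epsilon> * norm x"
    using \<open>0 \<le> \<epsilon>\<close> by (cases "norm y = 0") auto
  have "orth_proj V x - orth_proj W x = (orth_proj V x - orth_proj W (orth_proj V x)) - y"
    using W by (simp add: y_def r_def orth_proj_diff)
  then have "norm (orth_proj V x - orth_proj W x) \<le> norm (orth_proj V x - orth_proj W (orth_proj V x)) + norm y"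
    by (metis norm_triangle_ineq4)
  also have "\<dots> \<le> \<epsilon> * norm x + \<epsilon> * norm x" by (rule add_mono[OF 1 2])
  finally have "norm (orth_proj V x - orth_proj W x) \<le> 2 * \<epsilon> * norm x" by simp
  then show "norm (blinfun_apply (Blinfun (orth_proj V) - Blinfun (orth_proj W)) x) \<le> 2 * \<epsilon> * norm x"
    using V W by (simp add: blinfun.diff_left bounded_linear_Blinfun_apply bounded_linear_orth_proj)
qed (use assms in simp)

text \<open>The points \<open>x j\<close> are close to \<open>W\<close> and project to an approximate orthonormal basis of \<open>V\<close>.  The
  error made by replacing \<open>u j\<close> by the projection of \<open>x j\<close> is absorbed into the left-hand side.\<close>

lemma subspace_close_of_near_basis:
  fixes V W :: "'a::euclidean_space set" and u x :: "'i \<Rightarrow> 'a" and a c :: real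
  assumes V: "subspace V" and W: "subspace W" and "finite J" "0 \<le> a"
    and u: "\<And>j. j \<in> J \<Longrightarrow> u j \<in> V" "\<And>j. j \<in> J \<Longrightarrow> norm (u j) = 1"
    and basis: "\<And>v. v \<in> V \<Longrightarrow> v = (\<Sum>j\<in>J. (v \<bullet> u j) *\<^sub>R u j)"
    and x: "\<And>j. j \<in> J \<Longrightarrow> norm (orth_proj V (x j) - u j) \<le> c"
      "\<And>j. j \<in> J \<Longrightarrow> norm (x j - orth_proj V (x j)) \<le> a"
      "\<And>j. j \<in> J \<Longrightarrow> norm (x j - orth_proj W (x j)) \<le> a"
    and c: "real (card J) * c \<le> 1 / 2"
    and "v \<in> V"
  shows "norm (v - orth_proj W v) \<le> 4 * real (card J) * a * norm v"
proof -
  \<comment> \<open>Composing with the projection to \<open>V\<close> extends the residual map to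
    the whole space, so that its operator norm \<eta> is available and finite.\<close>
  define T where "T = (\<lambda>v. orth_proj V v - orth_proj W (orth_proj V v))"
  have T: "bounded_linear T"
    unfolding T_def
    by (intro bounded_linear_sub bounded_linear_compose[OF bounded_linear_orth_proj[OF W]]
        bounded_linear_orth_proj V)
  then interpret T: bounded_linear T .
  define \<eta> where "\<eta> = onorm T"
  have \<eta>: "norm (T v) \<le> \<eta> * norm v" for v using onorm[OF T] by (simp add: \<eta>_def)
  have "0 \<le> \<eta>" using onorm_pos_le[OF T] by (simp add: \<eta>_def)
  have Tu: "norm (T (u j)) \<le> 2 * a + \<eta> * c" if j: "j \<in> J" for j
  proof -
    have "T (orth_proj V (x j)) = (x j - orth_proj W (x j))
        - ((x j - orth_proj V (x j)) - orth_proj W (x j - orth_proj V (x j)))"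
      using V W by (simp add: T_def orth_proj_id orth_proj_in orth_proj_diff)
    also have "norm \<dots> \<le> norm (x j - orth_proj W (x j))
        + norm ((x j - orth_proj V (x j)) - orth_proj W (x j - orth_proj V (x j)))"
      by (rule norm_triangle_ineq4)
    also have "\<dots> \<le> a + a"
      using order_trans[OF norm_orth_proj_residual_le[OF W] x(2)[OF j]] x(3)[OF j] by (intro add_mono)
    finally have 1: "norm (T (orth_proj V (x j))) \<le> 2 * a" by simp
    have "norm (T (orth_proj V (x j) - u j)) \<le> \<eta> * c"
      using \<eta>[of "orth_proj V (x j) - u j"] mult_left_mono[OF x(1)[OF j] \<open>0 \<le> \<eta>\<close>] by linarith
    moreover have "T (u j) = T (orth_proj V (x j)) - T (orth_proj V (x j) - u j)"
      by (simp add: T.diff)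
    ultimately show ?thesis
      using 1 norm_triangle_ineq4[of "T (orth_proj V (x j))" "T (orth_proj V (x j) - u j)"] by simp
  qed
  have "\<eta> \<le> card J * (2 * a + \<eta> * c)"
    unfolding \<eta>_def
  proof (rule onorm_le)
    fix v
    define p where "p = orth_proj V v"
    have p: "p \<in> V" "norm p \<le> norm v" using V orth_proj_in norm_orth_proj_le by (auto simp: p_def)
    have "T v = T p" using V by (simp add: T_def p_def orth_proj_id orth_proj_in)
    also have "T p = T (\<Sum>j\<in>J. (p \<bullet> u j) *\<^sub>R u j)" using basis[OF p(1)] by simp
    also have "\<dots> = (\<Sum>j\<in>J. (p \<bullet> u j) *\<^sub>R T (u j))" by (simp add: T.sum T.scaleR)
    also have "norm \<dots> \<le> (\<Sum>j\<in>J. norm v * (2 * a + \<eta> * c))"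
    proof (rule sum_norm_le)
      fix j assume j: "j \<in> J"
      have "\<bar>p \<bullet> u j\<bar> \<le> norm v" using Cauchy_Schwarz_ineq2[of p "u j"] u(2)[OF j] p(2) by simp
      then show "norm ((p \<bullet> u j) *\<^sub>R T (u j)) \<le> norm v * (2 * a + \<eta> * c)"
        using Tu[OF j] by (simp add: mult_mono)
    qed
    finally show "norm (T v) \<le> card J * (2 * a + onorm T * c) * norm v" by (simp add: mult_ac \<eta>_def)
  qed
  moreover have "\<eta> * (card J * c) \<le> \<eta> * (1 / 2)" using c \<open>0 \<le> \<eta>\<close> by (rule mult_left_mono)
  ultimately have "\<eta> \<le> 4 * real (card J) * a" by (simp add: algebra_simps)
  then have "\<eta> * norm v \<le> 4 * real (card J) * a * norm v" by (intro mult_right_mono) auto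
  moreover have "T v = v - orth_proj W v" using \<open>v \<in> V\<close> V by (simp add: T_def orth_proj_id)
  ultimately show ?thesis using \<eta>[of v] by simp
qed

text \<open>The first vector is the normalised projection of \<open>e\<close>; normalising moves it
  by at most \<rho>, because its norm lies between \<open>1 - \<rho>\<close> and 1. The other
  vectors form a basis of its complement in \<open>V\<close>. Thus \<open>e\<close> itself can
  replace the first basis vector.\<close>

lemma adapted_orthonormal_basis:
  fixes V :: "'a::euclidean_space set"
  assumes V: "subspace V" "dim V = k" and e: "norm e = 1" "norm (e - orth_proj V e) \<le> \<rho>" "\<rho> < 1"
  obtains u :: "nat \<Rightarrow> 'a" where "\<And>j. j < k \<Longrightarrow> u j \<in> V" "\<And>j. j < k \<Longrightarrow> norm (u j) = 1"
    "norm (orth_proj V e - u 0) \<le> \<rho>" "\<And>v. v \<in> V \<Longrightarrow> v = (\<Sum>j<k. (v \<bullet> u j) *\<^sub>R u j)"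
proof -
  define p where "p = orth_proj V e"
  have "1 \<le> norm p + \<rho>" using norm_le_orth_proj_add[of e V] e by (simp add: p_def)
  then have "0 < norm p" using e by linarith
  define u0 where "u0 = p /\<^sub>R norm p"
  have u0: "u0 \<in> V" "norm u0 = 1"
    using V \<open>0 < norm p\<close> by (auto simp: u0_def p_def intro!: subspace_scale orth_proj_in)
  have "norm p \<le> 1" using norm_orth_proj_le[OF V(1), of e] e by (simp add: p_def)
  have "p - u0 = (norm p - 1) *\<^sub>R u0" using \<open>0 < norm p\<close> by (simp add: u0_def algebra_simps)
  then have "norm (p - u0) = \<bar>norm p - 1\<bar>" using u0 by simp
  then have pu0: "norm (p - u0) \<le> \<rho>" using \<open>norm p \<le> 1\<close> \<open>1 \<le> norm p + \<rho>\<close> by simp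
  define W where "W = {v \<in> V. v \<bullet> u0 = 0}"
  have W: "subspace W"
    using V by (auto simp: W_def subspace_def inner_add_left)
  obtain B where B: "finite B" "B \<subseteq> W" "card B = dim W" "span B = W"
    and on: "\<And>b c. b \<in> B \<Longrightarrow> c \<in> B \<Longrightarrow> b \<bullet> c = (if b = c then 1 else 0)"
    using orthonormal_basis_inner[OF W] by blast
  have u0u0: "u0 \<bullet> u0 = 1" using u0 by (simp add: norm_eq_1)
  then have "u0 \<notin> B" using B(2) by (auto simp: W_def)
  define C where "C = insert u0 B"
  have onC: "b \<bullet> c = (if b = c then 1 else 0)" if "b \<in> C" "c \<in> C" for b c
    using that on u0u0 B(2) \<open>u0 \<notin> B\<close> by (auto simp: C_def W_def inner_commute)
  have "C \<subseteq> V" using B(2) u0 by (auto simp: C_def W_def)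
  have spanC: "span C = V"
  proof
    show "span C \<subseteq> V" using \<open>C \<subseteq> V\<close> V by (simp add: span_minimal)
    show "V \<subseteq> span C"
    proof
      fix v assume "v \<in> V"
      have "v - (v \<bullet> u0) *\<^sub>R u0 \<in> W"
        using \<open>v \<in> V\<close> u0 V u0u0 by (simp add: W_def inner_diff_left subspace_diff subspace_scale)
      then have "v - (v \<bullet> u0) *\<^sub>R u0 \<in> span C" using B(4) span_mono[of B C] by (auto simp: C_def)
      moreover have "(v \<bullet> u0) *\<^sub>R u0 \<in> span C" by (simp add: C_def span_base span_scale)
      ultimately show "v \<in> span C" using span_add by fastforce
    qed
  qed
  have "independent C"
  proof (rule pairwise_orthogonal_independent)
    show "pairwise orthogonal C" using onC by (auto simp: pairwise_def orthogonal_def)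
    show "0 \<notin> C" using onC[of 0 0] by auto
  qed
  then have "card C = k" using dim_span_eq_card_independent[of C] spanC V(2) by simp
  then have cardB: "Suc (card B) = k" using \<open>u0 \<notin> B\<close> B(1) by (simp add: C_def)
  obtain h where h: "bij_betw h {0..<card B} B" using ex_bij_betw_nat_finite[OF B(1)] by blast
  define u where "u j = (case j of 0 \<Rightarrow> u0 | Suc i \<Rightarrow> h i)" for j
  have uS: "u 0 = u0" "\<And>i. u (Suc i) = h i" by (simp_all add: u_def)
  have uC: "u j \<in> C" if "j < k" for j
    using that h cardB by (cases j) (auto simp: uS C_def bij_betw_def)
  have sum: "v = (\<Sum>j<k. (v \<bullet> u j) *\<^sub>R u j)" if "v \<in> V" for v
  proof -
    have "v = (\<Sum>c\<in>C. (v \<bullet> c) *\<^sub>R c)"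
      using orth_proj_eq_sum[OF V(1) _ \<open>C \<subseteq> V\<close> spanC onC, of v] orth_proj_id[OF V(1) that] B(1)
      by (simp add: C_def)
    also have "\<dots> = (v \<bullet> u0) *\<^sub>R u0 + (\<Sum>b\<in>B. (v \<bullet> b) *\<^sub>R b)"
      using B(1) \<open>u0 \<notin> B\<close> by (simp add: C_def)
    also have "(\<Sum>b\<in>B. (v \<bullet> b) *\<^sub>R b) = (\<Sum>i<card B. (v \<bullet> h i) *\<^sub>R h i)"
      using sum.reindex_bij_betw[OF h, of "\<lambda>b. (v \<bullet> b) *\<^sub>R b"] by (simp add: lessThan_atLeast0)
    also have "(v \<bullet> u0) *\<^sub>R u0 + \<dots> = (\<Sum>j<Suc (card B). (v \<bullet> u j) *\<^sub>R u j)"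
      by (subst sum.lessThan_Suc_shift) (simp add: uS)
    finally show ?thesis using cardB by simp
  qed
  show thesis
  proof
    show "norm (orth_proj V e - u 0) \<le> \<rho>" using pu0 by (simp add: uS p_def)
    show "norm (u j) = 1" if "j < k" for j using onC[OF uC uC, OF that that] by (simp add: norm_eq_1)
  qed (use uC \<open>C \<subseteq> V\<close> sum in auto)
qed

text \<open>To each \<open>V\<close> we associate the \<open>(k - 1)\<close>-tuples which together with \<open>e\<close> almost form an orthonormal
  basis of \<open>V\<close>.  These sets have volume \<open>\<rho> ^ ((k - 1) * (d - k))\<close> up to a constant, and they are
  disjoint for separated \<open>V\<close> because such a tuple determines \<open>V\<close> up to \<open>O(\<rho>)\<close>.\<close>

lemma card_separated_subspaces_near_vector:
  assumes "1 \<le> k"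
  obtains C where "0 < C" "\<And>\<rho> e (\<V> :: 'a::euclidean_space set set). 0 < \<rho> \<Longrightarrow> \<rho> \<le> 1 / (2 * real k) \<Longrightarrow> norm e = 1 \<Longrightarrow>
    finite \<V> \<Longrightarrow> \<V> \<subseteq> grassmannian k \<Longrightarrow> (\<And>V. V \<in> \<V> \<Longrightarrow> norm (e - orth_proj V e) \<le> \<rho>) \<Longrightarrow>
    (\<And>V W. V \<in> \<V> \<Longrightarrow> W \<in> \<V> \<Longrightarrow> V \<noteq> W \<Longrightarrow> 8 * real k * \<rho> < mdist (grassmannian_metric k) V W) \<Longrightarrow>
    real (card \<V>) * \<rho> ^ ((k - 1) * (DIM('a) - k)) \<le> C"
proof -
  obtain c where c: "c > 0" "\<And>(V::'a set) a b. subspace V \<Longrightarrow> 0 < b \<Longrightarrow> b \<le> a \<Longrightarrow>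
    ennreal (c * a ^ dim V * b ^ (DIM('a) - dim V)) \<le> emeasure lborel (plate V a b)"
    using plate_volume_lower by blast
  \<comment> \<open>The largest tolerance with \<open>k * c0 \<le> 1 / 2\<close>, as
    \<open>subspace_close_of_near_basis\<close> requires.\<close>
  define c0 where "c0 = 1 / (2 * real k)"
  have c0: "0 < c0" "c0 \<le> 1 / 2" using assms by (auto simp: c0_def divide_simps)
  define vol where "vol = unit_ball_vol (real DIM('a)) * 3 ^ DIM('a)"
  have "0 < vol" by (simp add: vol_def)
  define C where "C = (vol / (c * c0 ^ k)) ^ (k - 1)"
  have "0 < C" using c c0 \<open>0 < vol\<close> by (simp add: C_def)
  moreover have "real (card \<V>) * \<rho> ^ ((k - 1) * (DIM('a) - k)) \<le> C"
    if \<rho>: "0 < \<rho>" "\<rho> \<le> 1 / (2 * real k)" and e: "norm e = 1" and \<V>: "finite \<V>" "\<V> \<subseteq> grassmannian k"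
      and near: "\<And>V. V \<in> \<V> \<Longrightarrow> norm (e - orth_proj V e) \<le> \<rho>"
      and sep: "\<And>V W. V \<in> \<V> \<Longrightarrow> W \<in> \<V> \<Longrightarrow> V \<noteq> W \<Longrightarrow> 8 * real k * \<rho> < mdist (grassmannian_metric k) V W"
    for \<rho> e and \<V> :: "'a set set"
  proof -
    have "\<rho> \<le> c0" using \<rho> by (simp add: c0_def)
    then have "\<rho> < 1" using c0 by linarith
    have sub: "subspace V" "dim V = k" if "V \<in> \<V>" for V
      using that \<V> grassmannianD by blast+
    define P where "P V u \<longleftrightarrow> (\<forall>j<k. u j \<in> V \<and> norm (u j) = 1) \<and> norm (orth_proj V e - u 0) \<le> \<rho>
        \<and> (\<forall>v\<in>V. v = (\<Sum>j<k. (v \<bullet> u j) *\<^sub>R u j))" for V and u :: "nat \<Rightarrow> 'a"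
    have "\<exists>u. P V u" if "V \<in> \<V>" for V
    proof (rule adapted_orthonormal_basis[OF sub[OF that] e near[OF that] \<open>\<rho> < 1\<close>])
      fix u :: "nat \<Rightarrow> 'a"
      assume a: "\<And>j. j < k \<Longrightarrow> u j \<in> V" "\<And>j. j < k \<Longrightarrow> norm (u j) = 1"
        "norm (orth_proj V e - u 0) \<le> \<rho>" "\<And>v. v \<in> V \<Longrightarrow> v = (\<Sum>j<k. (v \<bullet> u j) *\<^sub>R u j)"
      show "\<exists>u. P V u"
        unfolding P_def by (rule exI[of _ u], intro conjI allI impI ballI a; assumption)
    qed
    then obtain u where P: "\<And>V. V \<in> \<V> \<Longrightarrow> P V (u V)" by metis
    have u: "\<And>V j. V \<in> \<V> \<Longrightarrow> j < k \<Longrightarrow> u V j \<in> V"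
      "\<And>V j. V \<in> \<V> \<Longrightarrow> j < k \<Longrightarrow> norm (u V j) = 1"
      "\<And>V. V \<in> \<V> \<Longrightarrow> norm (orth_proj V e - u V 0) \<le> \<rho>"
      "\<And>V v. V \<in> \<V> \<Longrightarrow> v \<in> V \<Longrightarrow> v = (\<Sum>j<k. (v \<bullet> u V j) *\<^sub>R u V j)"
      using P unfolding P_def by blast+
    define S where "S V j = {x. norm (orth_proj V x - u V j) \<le> c0 \<and> norm (x - orth_proj V x) \<le> \<rho>}" for V j
    define T where "T V = Pi\<^sub>E {1..<k} (S V)" for V
    interpret product_sigma_finite "\<lambda>_::nat. lborel :: 'a measure" ..
    let ?M = "Pi\<^sub>M {1..<k} (\<lambda>_. lborel :: 'a measure)"
    have Splate: "S V j = (+) (u V j) ` plate V c0 \<rho>" if "V \<in> \<V>" "j < k" for V j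
    proof -
      have "x \<in> S V j \<longleftrightarrow> x - u V j \<in> plate V c0 \<rho>" for x
        using u(1)[OF that] sub[OF that(1)] by (simp add: S_def plate_def orth_proj_diff orth_proj_id)
      then show ?thesis by (force simp: image_iff)
    qed
    have Smeas: "S V j \<in> sets borel" if "V \<in> \<V>" for V j
    proof -
      have [measurable]: "orth_proj V \<in> borel_measurable borel" using sub[OF that] by simp
      show ?thesis unfolding S_def by measurable
    qed
    define m where "m = c * c0 ^ k * \<rho> ^ (DIM('a) - k)"
    have "0 < m" using c c0 \<rho> by (simp add: m_def)
    have Svol: "ennreal m \<le> emeasure lborel (S V j)" if "V \<in> \<V>" "j < k" for V j
      using c(2)[OF sub(1)[OF that(1)] \<rho>(1) \<open>\<rho> \<le> c0\<close>] sub[OF that(1)] Splate[OF that]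
      by (simp add: emeasure_lborel_translate plate_borel m_def)
    have Tmeas: "T V \<in> sets ?M" if "V \<in> \<V>" for V
      unfolding T_def using Smeas[OF that] by (intro sets_PiM_I_finite) auto
    have Tvol: "ennreal (m ^ (k - 1)) \<le> emeasure ?M (T V)" if "V \<in> \<V>" for V
    proof -
      have "ennreal (m ^ (k - 1)) = (\<Prod>j\<in>{1..<k}. ennreal m)"
        using \<open>0 < m\<close> by (simp add: ennreal_power)
      also have "\<dots> \<le> (\<Prod>j\<in>{1..<k}. emeasure lborel (S V j))"
        using Svol[OF that] by (intro prod_mono_ennreal) auto
      also have "\<dots> = emeasure ?M (T V)"
        unfolding T_def using Smeas[OF that] by (intro emeasure_PiM[symmetric]) auto
      finally show ?thesis .
    qed
    have disj: "disjoint_family_on T \<V>"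
      unfolding disjoint_family_on_def
    proof (intro ballI impI)
      fix V W assume VW: "V \<in> \<V>" "W \<in> \<V>" "V \<noteq> W"
      show "T V \<inter> T W = {}"
      proof (rule ccontr)
        assume "T V \<inter> T W \<noteq> {}"
        then obtain x where x: "x \<in> T V" "x \<in> T W" by blast
        \<comment> \<open>The common vector \<open>e\<close> fills slot 0 for both subspaces. Only
          \<open>k - 1\<close> slots remain free, which is why the exponent is
          \<open>(k - 1) * (DIM('a) - k)\<close>.\<close>
        define y where "y j = (if j = 0 then e else x j)" for j
        have yP: "norm (orth_proj U (y j) - u U j) \<le> c0 \<and> norm (y j - orth_proj U (y j)) \<le> \<rho>"
          if "U \<in> {V, W}" "j < k" for U j
        proof (cases "j = 0")
          case True
          have "U \<in> \<V>" using that VW by auto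
          then show ?thesis
            using True near[of U] u(3)[of U] \<open>\<rho> \<le> c0\<close> by (auto simp: y_def)
        next
          case False
          then have "x j \<in> S U j" using that x by (auto simp: T_def)
          then show ?thesis using False by (simp add: y_def S_def)
        qed
        have close: "norm (v - orth_proj U' v) \<le> 4 * real k * \<rho> * norm v"
          if "U \<in> {V, W}" "U' \<in> {V, W}" "v \<in> U" for U U' v
        proof -
          have U: "U \<in> \<V>" "U' \<in> \<V>" using that VW by auto
          have "norm (v - orth_proj U' v) \<le> 4 * real (card {..<k}) * \<rho> * norm v"
          proof (rule subspace_close_of_near_basis[where u = "u U" and x = y and c = c0])
            show "\<And>v. v \<in> U \<Longrightarrow> v = (\<Sum>j<k. (v \<bullet> u U j) *\<^sub>R u U j)" by (rule u(4)[OF U(1)])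
            show "real (card {..<k}) * c0 \<le> 1 / 2" using assms by (simp add: c0_def)
          qed (use U sub u that yP \<rho> in auto)
          then show ?thesis by simp
        qed
        \<comment> \<open>The assumed separation \<open>8 * real k * \<rho>\<close> is exactly this
          bound: 4 from the near-basis estimate, doubled by the comparison of the two
          projections.\<close>
        have "norm (Blinfun (orth_proj V) - Blinfun (orth_proj W)) \<le> 2 * (4 * real k * \<rho>)"
          using close[of V W] close[of W V] sub VW \<rho> by (intro orth_proj_distance_le) auto
        then show False using sep[OF VW] by simp
      qed
    qed
    have "ennreal (real (card \<V>) * m ^ (k - 1)) = (\<Sum>V\<in>\<V>. ennreal (m ^ (k - 1)))"
      using \<open>0 < m\<close> by (simp add: ennreal_mult ennreal_of_nat_eq_real_of_nat)
    also have "\<dots> \<le> (\<Sum>V\<in>\<V>. emeasure ?M (T V))" by (intro sum_mono Tvol)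
    also have "\<dots> = emeasure ?M (\<Union>V\<in>\<V>. T V)"
      using Tmeas by (intro sum_emeasure disj \<V>) auto
    \<comment> \<open>Each entry projects to within \<open>c0 \<le> 1 / 2\<close> of a unit vector
      and has residual below 1, so all the disjoint sets lie in one fixed product of balls.\<close>
    also have "\<dots> \<le> emeasure ?M (Pi\<^sub>E {1..<k} (\<lambda>_. cball 0 3))"
    proof (rule emeasure_mono)
      have "S V j \<subseteq> cball 0 3" if "V \<in> \<V>" "j < k" for V j
      proof
        fix x assume "x \<in> S V j"
        then have "norm (orth_proj V x) \<le> c0 + 1" "norm (x - orth_proj V x) \<le> \<rho>"
          using u(2)[OF that] norm_triangle_ineq2[of "orth_proj V x" "u V j"] by (auto simp: S_def)
        then show "x \<in> cball 0 3"
          using norm_le_orth_proj_add[of x V] c0 \<open>\<rho> < 1\<close> by simp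
      qed
      then show "(\<Union>V\<in>\<V>. T V) \<subseteq> Pi\<^sub>E {1..<k} (\<lambda>_. cball 0 3)" unfolding T_def
        by (intro UN_least PiE_mono) auto
      show "Pi\<^sub>E {1..<k} (\<lambda>_. cball 0 3) \<in> sets ?M" by (intro sets_PiM_I_finite) auto
    qed
    also have "\<dots> = (\<Prod>j\<in>{1..<k}. emeasure lborel (cball 0 3 :: 'a set))"
      by (intro emeasure_PiM) auto
    also have "\<dots> = ennreal (vol ^ (k - 1))"
      using \<open>0 < vol\<close> by (simp add: emeasure_cball vol_def ennreal_power)
    finally have "real (card \<V>) * m ^ (k - 1) \<le> vol ^ (k - 1)"
      using \<open>0 < vol\<close> by (subst (asm) ennreal_le_iff) auto
    moreover have "m ^ (k - 1) = (c * c0 ^ k) ^ (k - 1) * \<rho> ^ ((k - 1) * (DIM('a) - k))"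
      by (simp add: m_def power_mult_distrib mult.commute[of "DIM('a) - k"] flip: power_mult)
    ultimately show ?thesis
      using c c0 by (simp add: C_def power_divide field_simps)
  qed
  ultimately show thesis using that by blast
qed

section \<open>Energies on shells around a subspace\<close>

lemma compact_measures_onE:
  assumes "\<mu> \<in> compact_measures_on X"
  obtains K R where "finite_measure \<mu>" "sets \<mu> = sets borel" "K \<in> sets \<mu>" "K \<subseteq> X" "0 < emeasure \<mu> K"
    "AE x in \<mu>. norm x \<le> R" "0 \<le> R"
proof -
  from assms obtain K where K: "compact K" "K \<subseteq> X" "emeasure \<mu> (- K) = 0"
    and \<mu>: "sets \<mu> = sets borel" "0 < emeasure \<mu> X" "emeasure \<mu> X < \<infinity>"
    unfolding compact_measures_on_def by blast
  have sp: "space \<mu> = UNIV" using \<mu>(1) sets_eq_imp_space_eq by fastforce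
  have Km: "K \<in> sets \<mu>" using K(1) \<mu>(1) by (simp add: borel_compact)
  then have Kc: "- K \<in> sets \<mu>" using \<mu>(1) borel_comp[of K] by simp
  \<comment> \<open>Nonmeasurable sets have \<open>emeasure\<close> 0, so positivity forces
    measurability.\<close>
  have X: "X \<in> sets \<mu>" using \<mu>(2) emeasure_notin_sets by fastforce
  have "emeasure \<mu> X \<le> emeasure \<mu> (K \<union> - K)" using sets.Un[OF Km Kc] by (intro emeasure_mono) auto
  also have "\<dots> \<le> emeasure \<mu> K + emeasure \<mu> (- K)" using Km Kc by (rule emeasure_subadditive)
  finally have K0: "0 < emeasure \<mu> K" using \<mu>(2) K(3) by simp
  have "emeasure \<mu> UNIV \<le> emeasure \<mu> K + emeasure \<mu> (- K)"
    using emeasure_subadditive[OF Km Kc] by (simp add: Compl_partition)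
  also have "\<dots> \<le> emeasure \<mu> X" using K X by (simp add: emeasure_mono)
  finally have fin: "finite_measure \<mu>" using \<mu>(3) by (intro finite_measureI) (auto simp: sp top_unique)
  obtain R where R: "\<And>x. x \<in> K \<Longrightarrow> norm x \<le> R"
    using compact_imp_bounded[OF K(1)] unfolding bounded_iff by blast
  have "AE x in \<mu>. x \<in> K" using K(3) Kc by (intro AE_I[of _ _ "- K"]) (auto simp: sp)
  then have "AE x in \<mu>. norm x \<le> max R 0" by eventually_elim (use R in fastforce)
  then show thesis using that[OF fin \<mu>(1) Km K(2) K0] by simp
qed

text \<open>Divided by their norm, these frequencies are unit vectors within
  \<open>2 powr (- l)\<close> of \<open>V\<close>, a distance comparable with the separation used
  when subspaces are counted. The unit thickness is that of the plate in
  \<open>projected_correlation_le\<close>.\<close>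

definition shell :: "'a::euclidean_space set \<Rightarrow> nat \<Rightarrow> 'a set" where
  "shell V l = {z. 2 ^ l \<le> norm z \<and> norm z \<le> 2 ^ Suc l \<and> norm (z - orth_proj V z) \<le> 1}"

lemma shell_borel:
  assumes "subspace V"
  shows "shell V l \<in> sets borel"
proof -
  have [measurable]: "orth_proj V \<in> borel_measurable borel" using assms by simp
  show ?thesis unfolding shell_def by measurable
qed

lemma shell_subset_plate: "subspace V \<Longrightarrow> shell V l \<subseteq> plate V (2 ^ Suc l) 1"
  using norm_orth_proj_le by (fastforce simp: shell_def plate_def intro: order_trans)

lemma two_powr_mult_nat: "2 powr (c * real n) = (2 powr c) ^ n"
  by (simp only: powr_powr[symmetric] powr_realpow[OF powr_gt_zero[THEN iffD2]])

text \<open>As \<open>w < k\<close>, the shell bounds grow geometrically and add up to a plate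
  integral of order \<open>2 powr ((k - w) * j)\<close>. Multiplied by \<open>\<delta> ^ k\<close>
  with \<open>\<delta> = 2 powr (- j)\<close>, this is a correlation of order
  \<open>2 powr (- w * j)\<close>, to which \<open>hausdorff_dim_image_ge\<close> applies.\<close>

lemma hausdorff_dim_projection_ge:
  fixes X :: "'a::euclidean_space set" and u w :: real
  assumes \<mu>: "\<mu> \<in> compact_measures_on X" and V: "subspace V" "dim V = k"
    and "0 \<le> u" "u < w" "w < real k"
    and shells: "\<And>l. L \<le> l \<Longrightarrow>
      (\<integral>\<^sup>+z. ennreal ((cmod (fourier_transform \<mu> z))\<^sup>2) * indicator (shell V l) z \<partial>lborel)
        \<le> ennreal (2 powr ((real k - w) * l))"
  shows "ereal u \<le> hausdorff_dim euclidean_metric (orth_proj V ` X)"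
proof -
  obtain K R where fin: "finite_measure \<mu>" and sets [measurable_cong]: "sets \<mu> = sets borel"
    and K: "K \<in> sets \<mu>" "K \<subseteq> X" "0 < emeasure \<mu> K" and R: "AE x in \<mu>. norm x \<le> R" "0 \<le> R"
    using compact_measures_onE[OF \<mu>] .
  have [measurable]: "orth_proj V \<in> borel_measurable borel" using V by simp
  have [measurable]: "shell V l \<in> sets borel" for l using V by (simp add: shell_borel)
  have FT [measurable]: "fourier_transform \<mu> \<in> borel_measurable borel"
    by (rule fourier_transform_measurable) fact+
  obtain C where C: "0 < C" "\<And>V \<delta>. subspace V \<Longrightarrow> 0 < \<delta> \<Longrightarrow> \<delta> \<le> 1 \<Longrightarrow>
    (\<integral>\<^sup>+y. emeasure \<mu> {x \<in> space \<mu>. dist (orth_proj V x) (orth_proj V y) \<le> \<delta>} \<partial>\<mu>)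
      \<le> ennreal (C * \<delta> ^ dim V)
        * (\<integral>\<^sup>+z. ennreal ((cmod (fourier_transform \<mu> z))\<^sup>2) * indicator (plate V (1 / \<delta>) 1) z \<partial>lborel)"
    using projected_correlation_le[OF fin sets R] by blast
  let ?H = "\<lambda>z. ennreal ((cmod (fourier_transform \<mu> z))\<^sup>2)"
  define B where "B j = {z. norm z \<le> 2 ^ j \<and> norm (z - orth_proj V z) \<le> 1}" for j :: nat
  have [measurable]: "B j \<in> sets borel" for j unfolding B_def by measurable
  define g where "g j = (\<integral>\<^sup>+z. ?H z * indicator (B j) z \<partial>lborel)" for j
  define x where "x = 2 powr (real k - w)"
  have x: "1 < x" using assms by (simp add: x_def)
  have shells': "(\<integral>\<^sup>+z. ?H z * indicator (shell V l) z \<partial>lborel) \<le> ennreal (x ^ l)" if "L \<le> l" for l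
    using shells[OF that] by (simp add: two_powr_mult_nat x_def)
  have "g L \<le> (\<integral>\<^sup>+z. ennreal ((measure \<mu> UNIV)\<^sup>2) * indicator (cball 0 (2 ^ L)) (z :: 'a) \<partial>lborel)"
    unfolding g_def
    using norm_fourier_transform_le[OF fin sets]
    by (intro nn_integral_mono mult_mono ennreal_leI power_mono) (auto simp: B_def indicator_def)
  also have "\<dots> = ennreal ((measure \<mu> UNIV)\<^sup>2) * emeasure lborel (cball 0 (2 ^ L) :: 'a set)"
    by (simp add: nn_integral_cmult_indicator)
  also have "\<dots> < \<infinity>" using emeasure_lborel_cball_finite[of "0::'a" "2 ^ L"] by (simp add: ennreal_mult_less_top)
  finally have gL: "g L < \<infinity>" .
  \<comment> \<open>The first entry covers the ball in which no shell bound is assumed. The second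
    closes the induction: \<open>(C' + 1) * x ^ j \<le> C' * x ^ Suc j\<close> amounts to
    \<open>1 \<le> C' * (x - 1)\<close>.\<close>
  define C' where "C' = max (enn2real (g L)) (1 / (x - 1))"
  have "0 < C'" using x by (simp add: C'_def less_max_iff_disj)
  have "g L = ennreal (enn2real (g L))" using gL by simp
  also have "\<dots> \<le> ennreal C'" unfolding C'_def by (intro ennreal_leI max.cobounded1)
  finally have gC: "g L \<le> ennreal C'" .
  have Cx: "1 \<le> C' * (x - 1)"
  proof -
    have "1 / (x - 1) \<le> C'" by (simp add: C'_def)
    then show ?thesis using x by (simp add: pos_divide_le_eq)
  qed
  have gbound: "g j \<le> ennreal (C' * x ^ j)" for j
  proof (cases "L \<le> j")
    case True
    then show ?thesis
    proof (induction j rule: dec_induct)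
      case base
      have "C' \<le> C' * x ^ L" using \<open>0 < C'\<close> x by simp
      then show ?case using gC by (meson ennreal_leI order_trans)
    next
      case (step j)
      have "g (Suc j) \<le> (\<integral>\<^sup>+z. ?H z * indicator (B j) z + ?H z * indicator (shell V j) z \<partial>lborel)"
        unfolding g_def by (intro nn_integral_mono) (auto simp: B_def shell_def indicator_def)
      also have "\<dots> = g j + (\<integral>\<^sup>+z. ?H z * indicator (shell V j) z \<partial>lborel)"
        unfolding g_def by (intro nn_integral_add) auto
      also have "\<dots> \<le> ennreal (C' * x ^ j) + ennreal (x ^ j)"
        using step shells' by (intro add_mono) auto
      also have "\<dots> = ennreal ((C' + 1) * x ^ j)"
        using \<open>0 < C'\<close> x by (simp add: ennreal_plus[symmetric] algebra_simps del: ennreal_plus)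
      also have "\<dots> \<le> ennreal (C' * x ^ Suc j)"
      proof (rule ennreal_leI)
        have "(C' + 1) * x ^ j \<le> (C' * x) * x ^ j"
          using Cx x by (intro mult_right_mono) (auto simp: algebra_simps)
        then show "(C' + 1) * x ^ j \<le> C' * x ^ Suc j" by (simp add: mult_ac)
      qed
      finally show ?case .
    qed
  next
    case False
    have "(2::real) ^ j \<le> 2 ^ L" using False by (intro power_increasing) auto
    then have "B j \<subseteq> B L" unfolding B_def by (blast intro: order_trans)
    then have "g j \<le> g L"
      unfolding g_def by (intro nn_integral_mono mult_left_mono) (auto simp: indicator_def)
    also have "\<dots> \<le> ennreal (C' * x ^ j)"
    proof -
      have "C' \<le> C' * x ^ j" using \<open>0 < C'\<close> x by simp
      then show ?thesis using gC by (meson ennreal_leI order_trans)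
    qed
    finally show ?thesis .
  qed
  show ?thesis
  proof (rule hausdorff_dim_image_ge[OF fin _ K(1,2,3) \<open>0 \<le> u\<close> \<open>u < w\<close>])
    show "orth_proj V \<in> borel_measurable \<mu>" by measurable
    fix j :: nat
    define \<delta> where "\<delta> = 2 powr (- real j)"
    have \<delta>: "0 < \<delta>" "\<delta> \<le> 1" "1 / \<delta> = 2 ^ j"
      by (auto simp: \<delta>_def powr_minus powr_realpow field_simps)
    have "(\<integral>\<^sup>+z. ?H z * indicator (plate V (1 / \<delta>) 1) z \<partial>lborel) \<le> g (Suc j)"
      unfolding g_def
    proof (intro nn_integral_mono mult_left_mono)
      fix z
      have "(1::real) \<le> 2 ^ j" by simp
      then have "norm z \<le> 2 * 2 ^ j" if "z \<in> plate V (2 ^ j) 1"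
        using that norm_le_orth_proj_add[of z V] unfolding plate_def mem_Collect_eq by linarith
      then show "(indicator (plate V (1 / \<delta>) 1) z :: ennreal) \<le> indicator (B (Suc j)) z"
        unfolding \<delta>(3) by (auto simp: indicator_def B_def plate_def)
    qed simp
    also have "\<dots> \<le> ennreal (C' * x ^ Suc j)" by (rule gbound)
    finally have *: "(\<integral>\<^sup>+z. ?H z * indicator (plate V (1 / \<delta>) 1) z \<partial>lborel) \<le> ennreal (C' * x ^ Suc j)" .
    have "(\<integral>\<^sup>+y. emeasure \<mu> {x \<in> space \<mu>. dist (orth_proj V x) (orth_proj V y) \<le> \<delta>} \<partial>\<mu>)
      \<le> ennreal (C * \<delta> ^ k) * (\<integral>\<^sup>+z. ?H z * indicator (plate V (1 / \<delta>) 1) z \<partial>lborel)"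
      using C(2)[OF V(1) \<delta>(1,2)] V(2) by simp
    also have "\<dots> \<le> ennreal (C * \<delta> ^ k) * ennreal (C' * x ^ Suc j)" by (rule mult_left_mono[OF *]) simp
    also have "\<dots> = ennreal (C * C' * x * (\<delta> ^ k * x ^ j))"
      using C(1) \<open>0 < C'\<close> x \<delta> by (simp add: ennreal_mult[symmetric] mult_ac)
    also have "\<delta> ^ k * x ^ j = 2 powr (- w * j)"
    proof -
      have "\<delta> ^ k = 2 powr (- real j * real k)" by (simp only: \<delta>_def two_powr_mult_nat)
      moreover have "x ^ j = 2 powr ((real k - w) * real j)" by (simp only: x_def two_powr_mult_nat)
      ultimately show ?thesis by (simp add: powr_add[symmetric] algebra_simps)
    qed
    finally show "(\<integral>\<^sup>+y. emeasure \<mu> {x \<in> space \<mu>. dist (orth_proj V x) (orth_proj V y) \<le> 2 powr (- real j)} \<partial>\<mu>)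
      \<le> ennreal (C * C' * x * 2 powr (- w * j))" unfolding \<delta>_def .
  qed
qed

lemma powr_le_on_dyadic_interval:
  fixes e r t :: real
  assumes "0 < r" "r \<le> t" "t \<le> 2 * r"
  shows "t powr e \<le> 2 powr \<bar>e\<bar> * r powr e"
proof -
  have "t powr e = (t / r) powr e * r powr e" using assms by (simp add: powr_divide)
  also have "(t / r) powr e \<le> 2 powr \<bar>e\<bar>"
  proof -
    have "1 \<le> t / r" "t / r \<le> 2" using assms by (auto simp: field_simps)
    then have "(t / r) powr e \<le> (t / r) powr \<bar>e\<bar>" by (intro powr_mono) auto
    also have "\<dots> \<le> 2 powr \<bar>e\<bar>" using \<open>1 \<le> t / r\<close> \<open>t / r \<le> 2\<close> by (intro powr_mono2) auto
    finally show ?thesis .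
  qed
  finally show ?thesis by (simp add: mult_right_mono)
qed

text \<open>Truncation at height \<open>t\<close>, chosen so that the part of \<open>F\<^sup>2\<close> below \<open>t\<close> contributes at most half.\<close>

lemma shell_energy_ge:
  fixes p s w :: real
  assumes "1 \<le> p" "d = DIM('a::euclidean_space)"
  obtains c where "0 < c" "\<And>(F :: 'a \<Rightarrow> real) V l.
      F \<in> borel_measurable borel \<Longrightarrow> (\<And>z. 0 \<le> F z) \<Longrightarrow> V \<in> grassmannian k \<Longrightarrow>
      ennreal (2 powr ((real k - w) * real l)) < (\<integral>\<^sup>+z. ennreal ((F z)\<^sup>2) * indicator (shell V l) z \<partial>lborel) \<Longrightarrow>
      ennreal (c * 2 powr ((real k - real d + (s - w) * p) * real l))
        \<le> (\<integral>\<^sup>+z. ennreal (F z powr (2 * p) * norm z powr (s * p - d)) * indicator (shell V l) z \<partial>lborel)"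
proof -
  obtain c1 where c1: "c1 > 0" "\<And>(V::'a set) a b. subspace V \<Longrightarrow> 0 < b \<Longrightarrow> b \<le> a \<Longrightarrow>
    emeasure lborel (plate V a b) \<le> ennreal (c1 * a ^ dim V * b ^ (DIM('a) - dim V))"
    using plate_volume_upper by blast
  define e where "e = s * p - d"
  \<comment> \<open>A shell has volume at most \<open>a / 2 * 2 powr (k * l)\<close>, so below the
    threshold \<open>2 powr (- w * l) / a\<close> at most half of
    \<open>2 powr ((k - w) * l)\<close> can come from it.\<close>
  define a where "a = 2 * (c1 * 2 ^ k)"
  have "0 < a" using c1 by (simp add: a_def)
  define c where "c = a powr (1 - p) * 2 powr (- \<bar>e\<bar>) / 2"
  have "0 < c" using \<open>0 < a\<close> by (simp add: c_def)
  moreover have "ennreal (c * 2 powr ((real k - real d + (s - w) * p) * real l))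
        \<le> (\<integral>\<^sup>+z. ennreal (F z powr (2 * p) * norm z powr (s * p - d)) * indicator (shell V l) z \<partial>lborel)"
    (is "_ \<le> ?m")
    if F [measurable]: "F \<in> borel_measurable borel" and F0: "\<And>z. 0 \<le> F z" and V: "V \<in> grassmannian k"
      and large: "ennreal (2 powr ((real k - w) * real l)) < (\<integral>\<^sup>+z. ennreal ((F z)\<^sup>2) * indicator (shell V l) z \<partial>lborel)"
    for F :: "'a \<Rightarrow> real" and V l
  proof (rule ccontr)
    note V = grassmannianD[OF V]
    have [measurable]: "shell V l \<in> sets borel" using V by (simp add: shell_borel)
    define t where "t = 2 powr (- w * real l) / a"
    have "0 < t" using \<open>0 < a\<close> by (simp add: t_def)
    \<comment> \<open>Above the threshold
      \<open>F\<^sup>2 \<le> t powr (1 - p) * F powr (2 * p)\<close>, because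
      \<open>p \<ge> 1\<close>. The other factor of \<open>b\<close> removes the weight, which on
      the shell is \<open>2 powr (e * l)\<close> up to \<open>2 powr \<bar>e\<bar>\<close>.\<close>
    define b where "b = t powr (1 - p) * (2 powr \<bar>e\<bar> * 2 powr (- e * l))"
    have "0 < b" using \<open>0 < t\<close> by (simp add: b_def)
    define y where "y = c * 2 powr ((real k - real d + (s - w) * p) * real l)"
    \<comment> \<open>The constant \<open>c\<close> is fixed so that \<open>b * y\<close> is
      precisely the other half.\<close>
    have y: "b * y = 2 powr ((real k - w) * real l) / 2"
    proof -
      have "t powr (1 - p) = 2 powr (- w * real l * (1 - p)) * a powr (p - 1)"
        using \<open>0 < a\<close> powr_minus_divide[of a "1 - p"] by (simp add: t_def powr_divide powr_powr)
      then have "b * y = (a powr (p - 1) * a powr (1 - p)) * (2 powr \<bar>e\<bar> * 2 powr (- \<bar>e\<bar>)) *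
          (2 powr (- w * real l * (1 - p)) * 2 powr (- e * l) * 2 powr ((real k - real d + (s - w) * p) * real l)) / 2"
        by (simp add: b_def y_def c_def mult_ac)
      also have "\<dots> = 2 powr (- w * real l * (1 - p) + - e * l + (real k - real d + (s - w) * p) * real l) / 2"
        using \<open>0 < a\<close> by (simp add: powr_add[symmetric])
      also have "- w * real l * (1 - p) + - e * l + (real k - real d + (s - w) * p) * real l = (real k - w) * real l"
        by (simp add: e_def algebra_simps)
      finally show ?thesis .
    qed
    have pointwise: "ennreal ((F z)\<^sup>2) * indicator (shell V l) z
        \<le> ennreal t * indicator (shell V l) z
          + ennreal b * (ennreal (F z powr (2 * p) * norm z powr e) * indicator (shell V l) z)" for z
    proof (cases "z \<in> shell V l")
      case True
      have "(F z)\<^sup>2 \<le> t + b * (F z powr (2 * p) * norm z powr e)"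
      proof (cases "(F z)\<^sup>2 \<le> t")
        case False
        then have F: "0 < F z" using F0[of z] \<open>0 < t\<close> by (cases "F z = 0") auto
        have z: "2 ^ l \<le> norm z" "norm z \<le> 2 * 2 ^ l" using True by (auto simp: shell_def)
        have z0: "0 < norm z" by (rule less_le_trans[OF _ z(1)]) simp
        have "norm z powr (- e) \<le> 2 powr \<bar>- e\<bar> * (2 ^ l) powr (- e)"
          using z by (intro powr_le_on_dyadic_interval) auto
        then have ze: "1 \<le> (2 powr \<bar>e\<bar> * 2 powr (- e * l)) * norm z powr e"
          using z0 by (simp add: powr_minus powr_realpow[symmetric] powr_powr mult.commute field_simps)
        have "(F z)\<^sup>2 = ((F z)\<^sup>2) powr (1 - p) * ((F z)\<^sup>2) powr p"
          using F by (simp add: powr_add[symmetric])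
        also have "\<dots> \<le> t powr (1 - p) * ((F z)\<^sup>2) powr p"
          using False \<open>0 < t\<close> \<open>1 \<le> p\<close> by (intro mult_right_mono powr_mono2') auto
        also have "((F z)\<^sup>2) powr p = F z powr (2 * p)"
          using F by (simp add: powr_powr flip: powr_numeral)
        also have "t powr (1 - p) * F z powr (2 * p) \<le> t powr (1 - p) * F z powr (2 * p) * ((2 powr \<bar>e\<bar> * 2 powr (- e * l)) * norm z powr e)"
          using mult_left_mono[OF ze, of "t powr (1 - p) * F z powr (2 * p)"] by simp
        also have "\<dots> = b * (F z powr (2 * p) * norm z powr e)" by (simp add: b_def mult_ac)
        finally show ?thesis using \<open>0 < t\<close> by linarith
      qed (use \<open>0 < b\<close> in \<open>simp add: add_increasing2\<close>)
      then show ?thesis using True \<open>0 < t\<close> \<open>0 < b\<close>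
        by (simp add: ennreal_mult[symmetric] ennreal_plus[symmetric] ennreal_leI del: ennreal_plus)
    qed simp
    have vol: "emeasure lborel (shell V l) \<le> ennreal (a / 2 * 2 powr (real k * l))"
    proof -
      have "emeasure lborel (shell V l) \<le> emeasure lborel (plate V (2 ^ Suc l) 1)"
        using shell_subset_plate[OF V(1)] V by (intro emeasure_mono) (auto simp: plate_borel)
      also have "\<dots> \<le> ennreal (c1 * (2 ^ Suc l) ^ dim V * 1 ^ (DIM('a) - dim V))"
        using V by (intro c1(2)) (auto intro: one_le_power simp del: power_Suc)
      also have "c1 * (2 ^ Suc l) ^ dim V * 1 ^ (DIM('a) - dim V) = a / 2 * 2 powr (real k * l)"
        using V by (simp add: a_def two_powr_mult_nat powr_realpow power_mult_distrib flip: power_mult)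
      finally show ?thesis .
    qed
    assume "\<not> ennreal (c * 2 powr ((real k - real d + (s - w) * p) * real l)) \<le> ?m"
    then have m: "?m < ennreal y" by (simp add: y_def)
    have "ennreal (2 powr ((real k - w) * real l)) < (\<integral>\<^sup>+z. ennreal ((F z)\<^sup>2) * indicator (shell V l) z \<partial>lborel)"
      by (rule large)
    also have "\<dots> \<le> (\<integral>\<^sup>+z. ennreal t * indicator (shell V l) z
          + ennreal b * (ennreal (F z powr (2 * p) * norm z powr e) * indicator (shell V l) z) \<partial>lborel)"
      by (intro nn_integral_mono pointwise)
    also have "\<dots> = ennreal t * emeasure lborel (shell V l) + ennreal b * ?m"
      by (simp add: nn_integral_add nn_integral_cmult nn_integral_cmult_indicator e_def)
    also have "\<dots> \<le> ennreal t * ennreal (a / 2 * 2 powr (real k * l)) + ennreal b * ennreal y"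
      using m by (intro add_mono mult_left_mono vol) auto
    also have "ennreal t * ennreal (a / 2 * 2 powr (real k * l)) = ennreal (2 powr ((real k - w) * real l) / 2)"
    proof -
      have "t * (a / 2 * 2 powr (real k * l)) = (2 powr (- w * real l) * 2 powr (real k * l)) / 2"
        using \<open>0 < a\<close> by (simp add: t_def)
      also have "\<dots> = 2 powr ((real k - w) * real l) / 2"
        by (simp add: powr_add[symmetric] algebra_simps)
      finally show ?thesis using \<open>0 < a\<close> \<open>0 < t\<close> by (simp add: ennreal_mult[symmetric])
    qed
    also have "ennreal b * ennreal y = ennreal (2 powr ((real k - w) * real l) / 2)"
      using \<open>0 < b\<close> \<open>0 < c\<close> y by (simp add: ennreal_mult[symmetric] y_def)
    also have "ennreal (2 powr ((real k - w) * real l) / 2) + \<dots> = ennreal (2 powr ((real k - w) * real l))"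
      by (simp add: ennreal_plus[symmetric] del: ennreal_plus)
    finally show False by simp
  qed
  ultimately show thesis using that by blast
qed

text \<open>After exchanging sum and integral, only the number of shells containing a given
  \<open>z\<close> matters. Normalising \<open>z\<close> reduces this to
  \<open>card_separated_subspaces_near_vector\<close> with \<open>\<rho> = 2 powr (- l)\<close>; the
  condition \<open>2 * k \<le> 2 ^ l\<close> says \<open>\<rho> \<le> 1 / (2 * k)\<close>.\<close>

lemma sum_shell_integrals_le:
  assumes "1 \<le> k"
  obtains C where "0 < C" "\<And>(h :: 'a::euclidean_space \<Rightarrow> ennreal) l \<V>.
      h \<in> borel_measurable borel \<Longrightarrow> 2 * k \<le> 2 ^ l \<Longrightarrow> finite \<V> \<Longrightarrow> \<V> \<subseteq> grassmannian k \<Longrightarrow>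
      (\<And>V W. V \<in> \<V> \<Longrightarrow> W \<in> \<V> \<Longrightarrow> V \<noteq> W \<Longrightarrow> 8 * real k * 2 powr (- real l) < mdist (grassmannian_metric k) V W) \<Longrightarrow>
      (\<Sum>V\<in>\<V>. \<integral>\<^sup>+z. h z * indicator (shell V l) z \<partial>lborel)
        \<le> ennreal (C * 2 powr (real (k - 1) * real (DIM('a) - k) * real l)) * integral\<^sup>N lborel h"
proof (rule card_separated_subspaces_near_vector[where 'a = 'a, OF assms])
  fix C assume C: "0 < C" "\<And>\<rho> e (\<V> :: 'a::euclidean_space set set). 0 < \<rho> \<Longrightarrow> \<rho> \<le> 1 / (2 * real k) \<Longrightarrow> norm e = 1 \<Longrightarrow>
    finite \<V> \<Longrightarrow> \<V> \<subseteq> grassmannian k \<Longrightarrow> (\<And>V. V \<in> \<V> \<Longrightarrow> norm (e - orth_proj V e) \<le> \<rho>) \<Longrightarrow>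
    (\<And>V W. V \<in> \<V> \<Longrightarrow> W \<in> \<V> \<Longrightarrow> V \<noteq> W \<Longrightarrow> 8 * real k * \<rho> < mdist (grassmannian_metric k) V W) \<Longrightarrow>
    real (card \<V>) * \<rho> ^ ((k - 1) * (DIM('a) - k)) \<le> C"
  have "(\<Sum>V\<in>\<V>. \<integral>\<^sup>+z. h z * indicator (shell V l) z \<partial>lborel)
        \<le> ennreal (C * 2 powr (real (k - 1) * real (DIM('a) - k) * real l)) * integral\<^sup>N lborel h"
    if h [measurable]: "h \<in> borel_measurable borel" and l: "2 * k \<le> 2 ^ l" and \<V>: "finite \<V>" "\<V> \<subseteq> grassmannian k"
      and sep: "\<And>V W. V \<in> \<V> \<Longrightarrow> W \<in> \<V> \<Longrightarrow> V \<noteq> W \<Longrightarrow> 8 * real k * 2 powr (- real l) < mdist (grassmannian_metric k) V W"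
    for h :: "'a \<Rightarrow> ennreal" and l \<V>
  proof -
    define D where "D = C * 2 powr (real (k - 1) * real (DIM('a) - k) * real l)"
    define \<rho> where "\<rho> = 2 powr (- real l)"
    have \<rho>: "\<rho> = 1 / 2 ^ l" by (simp add: \<rho>_def powr_minus powr_realpow divide_inverse)
    have "real (2 * k) \<le> real (2 ^ l)" using l by (simp only: of_nat_le_iff)
    then have \<rho>k: "0 < \<rho>" "\<rho> \<le> 1 / (2 * real k)" using assms by (auto simp: \<rho> field_simps)
    have [measurable]: "shell V l \<in> sets borel" if "V \<in> \<V>" for V
      using that \<V> by (intro shell_borel) (auto dest: grassmannianD)
    have count: "(\<Sum>V\<in>\<V>. indicator (shell V l) z) \<le> ennreal D" for z
    proof -
      define \<W> where "\<W> = {V \<in> \<V>. z \<in> shell V l}"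
      have "(\<Sum>V\<in>\<V>. indicator (shell V l) z :: ennreal) = of_nat (card \<W>)"
        using \<V>(1) by (simp add: \<W>_def indicator_def sum.If_cases Int_def)
      also have "of_nat (card \<W>) \<le> ennreal D"
      proof (cases "\<W> = {}")
        case False
        then have z: "2 ^ l \<le> norm z" by (auto simp: \<W>_def shell_def)
        then have z0: "0 < norm z" by (rule less_le_trans[rotated]) simp
        define e where "e = z /\<^sub>R norm z"
        have "real (card \<W>) * \<rho> ^ ((k - 1) * (DIM('a) - k)) \<le> C"
        proof (rule C(2)[OF \<rho>k, of e])
          show "norm e = 1" using z0 by (simp add: e_def)
          fix V assume V: "V \<in> \<W>"
          then have "subspace V" using \<V> grassmannianD(1) by (auto simp: \<W>_def)
          then have "e - orth_proj V e = (z - orth_proj V z) /\<^sub>R norm z"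
            by (simp add: e_def orth_proj_scaleR scaleR_diff_right)
          then have "norm (e - orth_proj V e) = norm (z - orth_proj V z) / norm z"
            using z0 by (simp add: divide_inverse mult.commute)
          also have "\<dots> \<le> 1 / 2 ^ l"
            using V z by (intro frac_le) (auto simp: \<W>_def shell_def)
          finally show "norm (e - orth_proj V e) \<le> \<rho>" by (simp add: \<rho>)
        qed (use \<V> sep in \<open>auto simp: \<W>_def \<rho>_def\<close>)
        moreover have "\<rho> ^ ((k - 1) * (DIM('a) - k)) * 2 powr (real (k - 1) * real (DIM('a) - k) * real l) = 1"
        proof -
          have "2 powr (real (k - 1) * real (DIM('a) - k) * real l) = 2 powr (real (l * ((k - 1) * (DIM('a) - k))))"
            by (simp add: mult_ac)
          also have "\<dots> = (2 ^ l) ^ ((k - 1) * (DIM('a) - k))"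
            by (simp only: powr_realpow[of 2, simplified] power_mult)
          finally show ?thesis by (simp add: \<rho> power_one_over)
        qed
        ultimately have "real (card \<W>) \<le> D"
          using mult_right_mono[of "real (card \<W>) * \<rho> ^ ((k - 1) * (DIM('a) - k))" C "2 powr (real (k - 1) * real (DIM('a) - k) * real l)"]
          by (simp add: D_def mult.assoc)
        then show ?thesis by (simp add: ennreal_of_nat_eq_real_of_nat ennreal_leI)
      qed simp
      finally show ?thesis .
    qed
    have "(\<Sum>V\<in>\<V>. \<integral>\<^sup>+z. h z * indicator (shell V l) z \<partial>lborel) = (\<integral>\<^sup>+z. (\<Sum>V\<in>\<V>. h z * indicator (shell V l) z) \<partial>lborel)"
      by (rule nn_integral_sum[symmetric]) measurable
    also have "\<dots> \<le> (\<integral>\<^sup>+z. ennreal D * h z \<partial>lborel)"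
    proof (rule nn_integral_mono)
      fix z
      have "(\<Sum>V\<in>\<V>. h z * indicator (shell V l) z) = h z * (\<Sum>V\<in>\<V>. indicator (shell V l) z)"
        by (simp add: sum_distrib_left)
      also have "\<dots> \<le> h z * ennreal D" by (rule mult_left_mono[OF count]) simp
      finally show "(\<Sum>V\<in>\<V>. h z * indicator (shell V l) z) \<le> ennreal D * h z" by (simp add: mult.commute)
    qed
    also have "\<dots> = ennreal D * integral\<^sup>N lborel h" by (simp add: nn_integral_cmult)
    finally show ?thesis by (simp add: D_def)
  qed
  then show thesis by (rule that[OF C(1)])
qed

text \<open>The bound \<open>N\<close> provides a separated subset of greatest cardinality; a point
  farther than \<open>r\<close> from all its members could be added to it.\<close>

lemma maximal_separated_subset:
  fixes r N :: real
  assumes "S \<subseteq> mspace m" "0 \<le> r"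
    and bound: "\<And>\<V>. finite \<V> \<Longrightarrow> \<V> \<subseteq> S \<Longrightarrow> (\<And>V W. V \<in> \<V> \<Longrightarrow> W \<in> \<V> \<Longrightarrow> V \<noteq> W \<Longrightarrow> r < mdist m V W) \<Longrightarrow>
      real (card \<V>) \<le> N"
  obtains \<V> where "finite \<V>" "\<V> \<subseteq> S" "real (card \<V>) \<le> N" "\<And>W. W \<in> S \<Longrightarrow> \<exists>V\<in>\<V>. mdist m V W \<le> r"
proof -
  define P where "P \<V> \<longleftrightarrow> finite \<V> \<and> \<V> \<subseteq> S \<and> (\<forall>V\<in>\<V>. \<forall>W\<in>\<V>. V \<noteq> W \<longrightarrow> r < mdist m V W)" for \<V>
  have bP: "real (card \<V>) \<le> N" if "P \<V>" for \<V> using that bound[of \<V>] by (auto simp: P_def)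
  have "card \<V> < Suc (nat \<lceil>N\<rceil>)" if "P \<V>" for \<V> using bP[OF that] by linarith
  moreover have "P {}" by (simp add: P_def)
  ultimately have "\<exists>\<V>. P \<V> \<and> (\<forall>\<W>. P \<W> \<longrightarrow> card \<W> \<le> card \<V>)"
    by (intro ex_has_greatest_nat[of P "{}"]) blast+
  then obtain \<V> where \<V>: "P \<V>" "\<And>\<W>. P \<W> \<Longrightarrow> card \<W> \<le> card \<V>" by blast
  show thesis
  proof
    show "\<exists>V\<in>\<V>. mdist m V W \<le> r" if W: "W \<in> S" for W
    proof (rule ccontr)
      assume "\<not> ?thesis"
      then have far: "\<And>V. V \<in> \<V> \<Longrightarrow> r < mdist m V W" by (auto simp: not_le)
      have "mdist m W W = 0" using W assms(1) by auto
      then have "W \<notin> \<V>" using far[of W] \<open>0 \<le> r\<close> by auto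
      have "P (insert W \<V>)"
        using \<V>(1) W far by (auto simp: P_def mdist_commute)
      then show False using \<V>(2)[of "insert W \<V>"] \<V>(1) \<open>W \<notin> \<V>\<close> by (auto simp: P_def)
    qed
  qed (use \<V> bP in \<open>auto simp: P_def\<close>)
qed

section \<open>The exceptional set\<close>

lemma hausdorff_measure_exceptional_set_eq_0:
  fixes X :: "'a::euclidean_space set" and u w s \<theta> \<tau> :: real
  assumes \<mu>: "\<mu> \<in> compact_measures_on X" and energy: "fourier_energy s \<theta> \<mu> < \<infinity>"
    and \<theta>: "0 < \<theta>" "\<theta> \<le> 1" and k: "1 \<le> k" "k \<le> DIM('a)" and u: "0 \<le> u" "u < w" "w < real k"
    and \<tau>: "0 < \<tau>" "real k * (real DIM('a) - real k) + (w - s) / \<theta> < \<tau>"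
  shows "hausdorff_outer_measure (grassmannian_metric k) \<tau>
    {V \<in> grassmannian k. hausdorff_dim euclidean_metric (orth_proj V ` X) < ereal u} = 0"
proof -
  define d where "d = DIM('a)"
  define p where "p = 1 / \<theta>"
  have p: "1 \<le> p" using \<theta> by (simp add: p_def)
  obtain K R where fin: "finite_measure \<mu>" and sets: "sets \<mu> = sets borel"
    using compact_measures_onE[OF \<mu>] by metis
  define F where "F z = cmod (fourier_transform \<mu> z)" for z
  have FT [measurable]: "fourier_transform \<mu> \<in> borel_measurable borel"
    by (rule fourier_transform_measurable) fact+
  have F [measurable]: "F \<in> borel_measurable borel" unfolding F_def by measurable
  have F0: "0 \<le> F z" for z by (simp add: F_def)
  define h where "h z = ennreal (F z powr (2 * p) * norm z powr (s * p - real d))" for z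
  have h [measurable]: "h \<in> borel_measurable borel" unfolding h_def by measurable
  have "integral\<^sup>N lborel h \<noteq> \<infinity>"
  proof
    assume "integral\<^sup>N lborel h = \<infinity>"
    then have "fourier_energy s \<theta> \<mu> = \<infinity>"
      using \<theta> by (simp add: fourier_energy_def ennreal_powr_def h_def[abs_def] F_def p_def d_def)
    with energy show False by simp
  qed
  define J where "J = enn2real (integral\<^sup>N lborel h)"
  have J: "integral\<^sup>N lborel h = ennreal J" "0 \<le> J"
    using \<open>integral\<^sup>N lborel h \<noteq> \<infinity>\<close> by (simp_all add: J_def less_top)
  define I where "I l V = (\<integral>\<^sup>+z. ennreal ((F z)\<^sup>2) * indicator (shell V l) z \<partial>lborel)" for l V
  define E where "E l = {V \<in> grassmannian k. ennreal (2 powr ((real k - w) * real l)) < I l V}" for l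
  define \<beta> where "\<beta> = real k * (real d - real k) + (w - s) * p"
  obtain c where c: "0 < c" "\<And>l V. V \<in> E l \<Longrightarrow>
      ennreal (c * 2 powr ((real k - real d + (s - w) * p) * real l)) \<le> (\<integral>\<^sup>+z. h z * indicator (shell V l) z \<partial>lborel)"
  proof (rule shell_energy_ge[OF p d_def, of k w s])
    fix c :: real
    assume c: "0 < c" "\<And>(F :: 'a \<Rightarrow> real) V l.
      F \<in> borel_measurable borel \<Longrightarrow> (\<And>z. 0 \<le> F z) \<Longrightarrow> V \<in> grassmannian k \<Longrightarrow>
      ennreal (2 powr ((real k - w) * real l)) < (\<integral>\<^sup>+z. ennreal ((F z)\<^sup>2) * indicator (shell V l) z \<partial>lborel) \<Longrightarrow>
      ennreal (c * 2 powr ((real k - real d + (s - w) * p) * real l))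
        \<le> (\<integral>\<^sup>+z. ennreal (F z powr (2 * p) * norm z powr (s * p - real d)) * indicator (shell V l) z \<partial>lborel)"
    show thesis
      by (rule that[OF c(1)]) (use c(2)[OF F F0] in \<open>simp add: E_def I_def h_def\<close>)
  qed
  obtain C where C: "0 < C" "\<And>l \<V>. 2 * k \<le> 2 ^ l \<Longrightarrow> finite \<V> \<Longrightarrow> \<V> \<subseteq> grassmannian k \<Longrightarrow>
      (\<And>V W. V \<in> \<V> \<Longrightarrow> W \<in> \<V> \<Longrightarrow> V \<noteq> W \<Longrightarrow> 8 * real k * 2 powr (- real l) < mdist (grassmannian_metric k) V W) \<Longrightarrow>
      (\<Sum>V\<in>\<V>. \<integral>\<^sup>+z. h z * indicator (shell V l) z \<partial>lborel)
        \<le> ennreal (C * 2 powr (real (k - 1) * real (d - k) * real l)) * ennreal J"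
  proof (rule sum_shell_integrals_le[where 'a = 'a, OF k(1)])
    fix C :: real
    assume C: "0 < C" "\<And>(h :: 'a::euclidean_space \<Rightarrow> ennreal) l \<V>.
      h \<in> borel_measurable borel \<Longrightarrow> 2 * k \<le> 2 ^ l \<Longrightarrow> finite \<V> \<Longrightarrow> \<V> \<subseteq> grassmannian k \<Longrightarrow>
      (\<And>V W. V \<in> \<V> \<Longrightarrow> W \<in> \<V> \<Longrightarrow> V \<noteq> W \<Longrightarrow> 8 * real k * 2 powr (- real l) < mdist (grassmannian_metric k) V W) \<Longrightarrow>
      (\<Sum>V\<in>\<V>. \<integral>\<^sup>+z. h z * indicator (shell V l) z \<partial>lborel)
        \<le> ennreal (C * 2 powr (real (k - 1) * real (DIM('a) - k) * real l)) * integral\<^sup>N lborel h"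
    show thesis
      by (rule that[OF C(1)]) (use C(2)[OF h] in \<open>simp add: J d_def\<close>)
  qed
  have card: "real (card \<V>) \<le> C * J / c * 2 powr (\<beta> * real l)"
    if l: "2 * k \<le> 2 ^ l" and \<V>: "finite \<V>" "\<V> \<subseteq> E l"
      and sep: "\<And>V W. V \<in> \<V> \<Longrightarrow> W \<in> \<V> \<Longrightarrow> V \<noteq> W \<Longrightarrow> 8 * real k * 2 powr (- real l) < mdist (grassmannian_metric k) V W"
    for l \<V>
  proof -
    let ?x = "2 powr ((real k - real d + (s - w) * p) * real l)"
    let ?y = "2 powr (real (k - 1) * real (d - k) * real l)"
    have "ennreal (real (card \<V>) * (c * ?x)) = (\<Sum>V\<in>\<V>. ennreal (c * ?x))"
      using c by (simp add: ennreal_mult ennreal_of_nat_eq_real_of_nat)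
    also have "\<dots> \<le> (\<Sum>V\<in>\<V>. \<integral>\<^sup>+z. h z * indicator (shell V l) z \<partial>lborel)"
      using \<V>(2) by (intro sum_mono c(2)) auto
    also have "\<dots> \<le> ennreal (C * ?y) * ennreal J"
      using \<V> sep by (intro C(2) l) (auto simp: E_def)
    also have "\<dots> = ennreal (C * ?y * J)" using C(1) J by (simp add: ennreal_mult[symmetric])
    finally have "real (card \<V>) * (c * ?x) \<le> C * ?y * J"
      using C(1) J by (subst (asm) ennreal_le_iff) auto
    then have "real (card \<V>) \<le> C * J / c * (?y / ?x)" using c(1) by (simp add: field_simps)
    \<comment> \<open>The exponents combine as
      \<open>(k - 1) * (d - k) + (d - k) + (w - s) * p = \<beta>\<close>.\<close>
    also have "?y / ?x = 2 powr (\<beta> * real l)"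
      using k by (simp add: powr_diff[symmetric] \<beta>_def d_def of_nat_diff algebra_simps)
    finally show ?thesis .
  qed
  have "\<exists>\<V>. finite \<V> \<and> \<V> \<subseteq> E l \<and> real (card \<V>) \<le> C * J / c * 2 powr (\<beta> * real l)
      \<and> (\<forall>W\<in>E l. \<exists>V\<in>\<V>. mdist (grassmannian_metric k) V W \<le> 8 * real k * 2 powr (- real l))"
    if "2 * k \<le> l" for l
  proof -
    have "2 * k \<le> 2 ^ l" using that less_exp[of l] by linarith
    have "E l \<subseteq> mspace (grassmannian_metric k)" by (auto simp: E_def)
    then show ?thesis
    proof (rule maximal_separated_subset)
      show "0 \<le> 8 * real k * 2 powr (- real l)" by simp
      show "real (card \<V>) \<le> C * J / c * 2 powr (\<beta> * real l)"
        if "finite \<V>" "\<V> \<subseteq> E l" "\<And>V W. V \<in> \<V> \<Longrightarrow> W \<in> \<V> \<Longrightarrow> V \<noteq> W \<Longrightarrow> 8 * real k * 2 powr (- real l) < mdist (grassmannian_metric k) V W"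
        for \<V> by (rule card[OF \<open>2 * k \<le> 2 ^ l\<close> that])
    qed blast
  qed
  then obtain \<V> where \<V>: "\<And>l. 2 * k \<le> l \<Longrightarrow> finite (\<V> l)" "\<And>l. 2 * k \<le> l \<Longrightarrow> \<V> l \<subseteq> E l"
    "\<And>l. 2 * k \<le> l \<Longrightarrow> real (card (\<V> l)) \<le> C * J / c * 2 powr (\<beta> * real l)"
    "\<And>l W. 2 * k \<le> l \<Longrightarrow> W \<in> E l \<Longrightarrow> \<exists>V\<in>\<V> l. mdist (grassmannian_metric k) V W \<le> 8 * real k * 2 powr (- real l)"
    by metis
  let ?m = "grassmannian_metric k :: 'a set metric"
  define b where "b l V = {W \<in> grassmannian k. mdist ?m V W \<le> 8 * real k * 2 powr (- real l)}" for l V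
  show ?thesis
  proof (rule hausdorff_outer_measure_limsup_eq_0[where \<U> = "\<lambda>l. b l ` \<V> l" and r = "16 * real k"
        and \<beta> = \<beta> and C = "C * J / c" and ?l0.0 = "2 * k"])
    show "0 < \<tau>" "0 < 16 * real k" using \<tau> k by auto
    show "\<beta> < \<tau>" using \<tau>(2) by (simp add: \<beta>_def d_def p_def)
    fix l assume l: "2 * k \<le> l"
    show "finite (b l ` \<V> l)" using \<V>(1)[OF l] by simp
    have "card (b l ` \<V> l) \<le> card (\<V> l)" by (rule card_image_le[OF \<V>(1)[OF l]])
    then show "real (card (b l ` \<V> l)) \<le> C * J / c * 2 powr (\<beta> * real l)"
      using \<V>(3)[OF l] by linarith
    fix U assume U: "U \<in> b l ` \<V> l"
    then show "U \<subseteq> mspace ?m" by (auto simp: b_def)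
    fix A B assume AB: "A \<in> U" "B \<in> U"
    obtain V where V: "V \<in> \<V> l" "U = b l V" using U by blast
    have "V \<in> mspace ?m" "A \<in> mspace ?m" "B \<in> mspace ?m"
      using V AB \<V>(2)[OF l] by (auto simp: E_def b_def)
    then have "mdist ?m A B \<le> mdist ?m V A + mdist ?m V B"
      using mdist_triangle[of A ?m V B] mdist_commute[of ?m A V] by simp
    also have "\<dots> \<le> 16 * real k * 2 powr (- real l)"
      using V AB unfolding b_def by auto
    finally show "mdist ?m A B \<le> 16 * real k * 2 powr (- real l)" .
  next
    fix V assume "V \<in> {V \<in> grassmannian k. hausdorff_dim euclidean_metric (orth_proj V ` X) < ereal u}"
    then have V: "V \<in> grassmannian k" "\<not> ereal u \<le> hausdorff_dim euclidean_metric (orth_proj V ` X)" by auto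
    show "\<exists>\<^sub>\<infinity>l. V \<in> \<Union>(b l ` \<V> l)"
      unfolding INFM_nat_le
    proof
      fix L
      \<comment> \<open>If \<open>V\<close> were bad at no scale from some point on, the shell
        bounds would hold there and force the projection to have dimension at least
        \<open>u\<close>.\<close>
      have "\<exists>l\<ge>max L (2 * k). V \<in> E l"
      proof (rule ccontr)
        assume "\<not> ?thesis"
        then have "I l V \<le> ennreal (2 powr ((real k - w) * real l))" if "max L (2 * k) \<le> l" for l
          using that V(1) by (auto simp: E_def not_less)
        then have "ereal u \<le> hausdorff_dim euclidean_metric (orth_proj V ` X)"
          using grassmannianD[OF V(1)]
          by (intro hausdorff_dim_projection_ge[OF \<mu> _ _ u, of V "max L (2 * k)"]) (auto simp: I_def F_def)
        with V(2) show False by blast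
      qed
      then obtain l where l: "L \<le> l" "2 * k \<le> l" "V \<in> E l" by auto
      obtain W where "W \<in> \<V> l" "mdist ?m W V \<le> 8 * real k * 2 powr (- real l)"
        using \<V>(4)[OF l(2,3)] by blast
      then have "V \<in> \<Union>(b l ` \<V> l)" using V(1) unfolding b_def by blast
      then show "\<exists>l\<ge>L. V \<in> \<Union>(b l ` \<V> l)" using l(1) by blast
    qed
  qed
qed

section \<open>Exceptional dimension bounded by energies and by the Fourier spectrum\<close>

definition exceptional_dim :: "nat \<Rightarrow> 'a::euclidean_space set \<Rightarrow> real \<Rightarrow> ereal" where
  "exceptional_dim k X u = hausdorff_dim (grassmannian_metric k)
    {V \<in> grassmannian k. hausdorff_dim euclidean_metric (orth_proj V ` X) < ereal u}"

text \<open>The exponent \<open>w\<close> decreases to \<open>u\<close>: an excess of at most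
  \<open>e * \<theta> / 2\<close> costs \<open>e / 2\<close> after division by \<theta>, and the
  midpoint of \<open>u\<close> and \<open>k\<close> keeps \<open>w < k\<close>. The maximum with 0
  enters because the measure bound is for positive \<tau>.\<close>

lemma exceptional_dim_le_of_energy:
  fixes X :: "'a::euclidean_space set"
  assumes "\<mu> \<in> compact_measures_on X" "fourier_energy s \<theta> \<mu> < \<infinity>"
    and \<theta>: "0 < \<theta>" "\<theta> \<le> 1" and "1 \<le> k" "k \<le> DIM('a)" and u: "0 \<le> u" "u < real k"
  shows "exceptional_dim k X u \<le> ereal (max 0 (real k * (real DIM('a) - real k) + (u - s) / \<theta>))"
proof (rule ereal_le_epsilon2)
  fix e :: real assume "0 < e"
  define w where "w = min (u + e * \<theta> / 2) ((u + real k) / 2)"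
  define b where "b = real k * (real DIM('a) - real k) + (u - s) / \<theta>"
  have w: "u < w" "w < real k" using \<open>0 < e\<close> \<theta> u by (auto simp: w_def min_less_iff_disj)
  have "(w - s) / \<theta> \<le> (u + e * \<theta> / 2 - s) / \<theta>" using \<theta> by (intro divide_right_mono) (auto simp: w_def)
  also have "\<dots> = (u - s) / \<theta> + e / 2" using \<theta> by (simp add: field_simps)
  finally have "real k * (real DIM('a) - real k) + (w - s) / \<theta> \<le> b + e / 2" by (simp add: b_def)
  then have "real k * (real DIM('a) - real k) + (w - s) / \<theta> < max 0 b + e"
    using \<open>0 < e\<close> by linarith
  moreover have "0 < max 0 b + e" using \<open>0 < e\<close> by linarith
  ultimately have "exceptional_dim k X u \<le> ereal (max 0 b + e)"
    unfolding exceptional_dim_def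
    using hausdorff_measure_exceptional_set_eq_0[OF assms(1-6) u(1) w] by (intro hausdorff_dim_le) auto
  then show "exceptional_dim k X u \<le> ereal (max 0 (real k * (real DIM('a) - real k) + (u - s) / \<theta>)) + ereal e"
    by (simp only: plus_ereal.simps b_def)
qed

text \<open>Empty families have supremum 0 by convention, so \<open>0 \<le> s\<close> is what
  guarantees actual witnesses in both nested suprema.\<close>

lemma fourier_spectrum_gtE:
  fixes X :: "'a::euclidean_space set"
  assumes "ereal s < fourier_spectrum \<theta> X" "0 \<le> s"
  obtains \<mu> t where "\<mu> \<in> compact_measures_on X" "s < t" "fourier_energy t \<theta> \<mu> < \<infinity>" "s < DIM('a)"
proof -
  from assms obtain \<mu> where \<mu>: "\<mu> \<in> compact_measures_on X"
    "ereal s < min (fourier_spectrum_measure \<theta> \<mu>) (ereal DIM('a))"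
    by (auto simp: fourier_spectrum_def Sup0_def less_Sup_iff split: if_splits)
  then have "ereal s < fourier_spectrum_measure \<theta> \<mu>" by simp
  then obtain t where "fourier_energy t \<theta> \<mu> < \<infinity>" "s < t"
    using assms(2) by (auto simp: fourier_spectrum_measure_def Sup0_def less_Sup_iff split: if_splits)
  with \<mu> show thesis using that by auto
qed

lemma fourier_spectrum_geI:
  fixes X :: "'a::euclidean_space set"
  assumes "\<mu> \<in> compact_measures_on X" "fourier_energy s \<theta> \<mu> < \<infinity>" "s \<le> DIM('a)"
  shows "ereal s \<le> fourier_spectrum \<theta> X"
proof -
  have "ereal s \<le> fourier_spectrum_measure \<theta> \<mu>"
    using assms(2) unfolding fourier_spectrum_measure_def Sup0_def by (auto intro!: Sup_upper)
  then have "ereal s \<le> min (fourier_spectrum_measure \<theta> \<mu>) (ereal DIM('a))"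
    using assms(3) by simp
  then show ?thesis
    using assms(1) unfolding fourier_spectrum_def Sup0_def by (auto intro!: Sup_upper2)
qed

lemma fourier_spectrum_le_dim:
  fixes X :: "'a::euclidean_space set"
  shows "fourier_spectrum \<theta> X \<le> ereal DIM('a)"
  by (auto simp: fourier_spectrum_def Sup0_def intro!: Sup_least)

lemma exceptional_dim_le_of_spectrum:
  fixes X :: "'a::euclidean_space set"
  assumes S: "fourier_spectrum \<theta> X = ereal S" "0 < S"
    and \<theta>: "0 < \<theta>" "\<theta> \<le> 1" and k: "1 \<le> k" "k \<le> DIM('a)" and u: "0 \<le> u" "u < real k"
  shows "exceptional_dim k X u \<le> ereal (max 0 (real k * (real DIM('a) - real k) + (u - S) / \<theta>))"
proof (rule ereal_le_epsilon2)
  fix e :: real assume "0 < e"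
  \<comment> \<open>Nonnegative so that \<open>fourier_spectrum_gtE\<close> applies, and still below
    \<open>S\<close> because \<open>S\<close> is positive.\<close>
  define s where "s = max 0 (S - e * \<theta>)"
  have "ereal s < fourier_spectrum \<theta> X" "0 \<le> s" using S \<open>0 < e\<close> \<theta> by (auto simp: s_def)
  then obtain \<mu> t where t: "\<mu> \<in> compact_measures_on X" "s < t" "fourier_energy t \<theta> \<mu> < \<infinity>"
    using fourier_spectrum_gtE by blast
  have "(u - t) / \<theta> \<le> (u - (S - e * \<theta>)) / \<theta>"
    using t(2) \<theta> by (intro divide_right_mono) (auto simp: s_def)
  also have "\<dots> = (u - S) / \<theta> + e" using \<theta> by (simp add: field_simps)
  finally have le: "(u - t) / \<theta> \<le> (u - S) / \<theta> + e" .
  have "exceptional_dim k X u \<le> ereal (max 0 (real k * (real DIM('a) - real k) + (u - t) / \<theta>))"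
    by (rule exceptional_dim_le_of_energy[OF t(1,3) \<theta> k u])
  also have "\<dots> \<le> ereal (max 0 (real k * (real DIM('a) - real k) + (u - S) / \<theta>) + e)"
    using le \<open>0 < e\<close> by (simp add: max_def)
  finally show "exceptional_dim k X u \<le> ereal (max 0 (real k * (real DIM('a) - real k) + (u - S) / \<theta>)) + ereal e"
    by (simp only: plus_ereal.simps)
qed

section \<open>From Fourier decay at \<theta> = 0 to a positive spectrum at all \<theta> > 0\<close>

lemma nn_integral_annulus_powr_le:
  fixes e :: real
  obtains C where "0 < C" "\<And>r. 0 < r \<Longrightarrow>
    (\<integral>\<^sup>+z. ennreal (norm z powr e) * indicator {z :: 'a::euclidean_space. r \<le> norm z \<and> norm z \<le> 2 * r} z \<partial>lborel)
      \<le> ennreal (C * r powr (e + DIM('a)))"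
proof -
  define v where "v = unit_ball_vol (real DIM('a)) * 2 ^ DIM('a)"
  have "0 < v" by (simp add: v_def)
  define C where "C = 2 powr \<bar>e\<bar> * v"
  have "0 < C" using \<open>0 < v\<close> by (simp add: C_def)
  moreover have "(\<integral>\<^sup>+z. ennreal (norm z powr e) * indicator {z :: 'a. r \<le> norm z \<and> norm z \<le> 2 * r} z \<partial>lborel)
      \<le> ennreal (C * r powr (e + DIM('a)))" if r: "0 < r" for r
  proof -
    have "(\<integral>\<^sup>+z. ennreal (norm z powr e) * indicator {z :: 'a. r \<le> norm z \<and> norm z \<le> 2 * r} z \<partial>lborel)
        \<le> (\<integral>\<^sup>+z. ennreal (2 powr \<bar>e\<bar> * r powr e) * indicator (cball 0 (2 * r)) (z :: 'a) \<partial>lborel)"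
    proof (rule nn_integral_mono)
      fix z :: 'a
      show "ennreal (norm z powr e) * indicator {z. r \<le> norm z \<and> norm z \<le> 2 * r} z
          \<le> ennreal (2 powr \<bar>e\<bar> * r powr e) * indicator (cball 0 (2 * r)) z"
        by (cases "r \<le> norm z \<and> norm z \<le> 2 * r") (auto intro!: ennreal_leI powr_le_on_dyadic_interval[OF r])
    qed
    also have "\<dots> = ennreal (2 powr \<bar>e\<bar> * r powr e) * emeasure lborel (cball 0 (2 * r) :: 'a set)"
      by (simp add: nn_integral_cmult_indicator)
    also have "\<dots> = ennreal (2 powr \<bar>e\<bar> * r powr e) * ennreal (v * r ^ DIM('a))"
      using r by (simp add: emeasure_cball v_def power_mult_distrib mult_ac)
    also have "\<dots> = ennreal (C * r powr (e + DIM('a)))"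
      using r \<open>0 < v\<close> by (simp add: ennreal_mult[symmetric] C_def powr_add powr_realpow mult_ac)
    finally show ?thesis .
  qed
  ultimately show thesis using that by blast
qed

lemma ennreal_le_suminf:
  fixes f :: "nat \<Rightarrow> ennreal"
  shows "f n \<le> suminf f"
  using sum_le_suminf[of f "{n}"] by simp

text \<open>One statement serves both the singularity at 0, with \<open>a > 0\<close> and shrinking
  radii, and the tail at infinity, with \<open>a < 0\<close> and growing radii: an annulus of radius
  \<open>r n\<close> contributes a multiple of \<open>r n powr a\<close>, and these terms form a
  convergent geometric series.\<close>

lemma nn_integral_dyadic_annuli_finite:
  fixes f :: "'a::euclidean_space \<Rightarrow> ennreal" and r :: "nat \<Rightarrow> real" and a c q :: real
  assumes a: "a \<noteq> 0" and r: "\<And>n. r n powr a = c * q ^ n" "\<And>n. 0 < r n" "0 < q" "q < 1" "0 < c"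
    and [measurable]: "S \<in> sets borel"
    and cover: "\<And>z. z \<in> S \<Longrightarrow> z \<noteq> 0 \<Longrightarrow> \<exists>n. r n \<le> norm z \<and> norm z \<le> 2 * r n"
  shows "(\<integral>\<^sup>+z. ennreal (norm z powr (a - DIM('a))) * indicator S (z :: 'a) \<partial>lborel) < \<infinity>"
proof -
  obtain C where C: "0 < C" "\<And>r. 0 < r \<Longrightarrow>
    (\<integral>\<^sup>+z. ennreal (norm z powr (a - DIM('a))) * indicator {z :: 'a. r \<le> norm z \<and> norm z \<le> 2 * r} z \<partial>lborel)
      \<le> ennreal (C * r powr (a - DIM('a) + DIM('a)))"
    using nn_integral_annulus_powr_le by blast
  let ?g = "\<lambda>n z. ennreal (norm z powr (a - DIM('a))) * indicator {z :: 'a. r n \<le> norm z \<and> norm z \<le> 2 * r n} z"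
  have "(\<integral>\<^sup>+z. ennreal (norm z powr (a - DIM('a))) * indicator S z \<partial>lborel) \<le> (\<integral>\<^sup>+z. (\<Sum>n. ?g n z) \<partial>lborel)"
  proof (rule nn_integral_mono)
    fix z :: 'a
    show "ennreal (norm z powr (a - DIM('a))) * indicator S z \<le> (\<Sum>n. ?g n z)"
    proof (cases "z \<in> S \<and> z \<noteq> 0")
      case True
      then obtain n where "r n \<le> norm z" "norm z \<le> 2 * r n" using cover by blast
      then have "ennreal (norm z powr (a - DIM('a))) * indicator S z = ?g n z" using True by simp
      also have "\<dots> \<le> (\<Sum>n. ?g n z)" by (rule ennreal_le_suminf)
      finally show ?thesis .
    qed auto
  qed
  also have "\<dots> = (\<Sum>n. integral\<^sup>N lborel (?g n))" by (intro nn_integral_suminf) measurable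
  also have "\<dots> \<le> (\<Sum>n. ennreal (C * c * q ^ n))"
    using C(2)[OF r(2)] by (intro suminf_le) (auto simp: r(1) mult.assoc)
  also have "\<dots> = ennreal (C * c * (1 / (1 - q)))"
    using r C(1) by (intro suminf_ennreal_eq sums_mult geometric_sums) auto
  finally show ?thesis by (rule order_le_less_trans) simp
qed

lemma nn_integral_powr_at_0_finite:
  fixes a :: real
  assumes "0 < a"
  shows "(\<integral>\<^sup>+z. ennreal (norm z powr (a - DIM('a))) * indicator (cball 0 1) (z :: 'a::euclidean_space) \<partial>lborel) < \<infinity>"
proof (rule nn_integral_dyadic_annuli_finite[where r = "\<lambda>n. 2 powr (- real n - 1)"
      and c = "2 powr (- a)" and q = "2 powr (- a)"])
  show "(2 powr (- real n - 1)) powr a = 2 powr (- a) * (2 powr (- a)) ^ n" for n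
  proof -
    have "(- real n - 1) * a = - a + - a * real n" by (simp add: algebra_simps)
    then show ?thesis unfolding two_powr_mult_nat[symmetric] powr_powr by (simp only: powr_add)
  qed
  fix z :: 'a assume "z \<in> cball 0 1" "z \<noteq> 0"
  then obtain n where "norm z \<le> 2 powr (- real n)" "2 powr (- real n - 1) \<le> norm z"
    using dyadic_between[of "norm z"] by auto
  then show "\<exists>n. 2 powr (- real n - 1) \<le> norm z \<and> norm z \<le> 2 * 2 powr (- real n - 1)"
    by (intro exI[of _ n]) (simp add: powr_diff)
qed (use assms in \<open>auto simp: powr_less_one\<close>)

lemma nn_integral_powr_at_infinity_finite:
  fixes a :: real
  assumes "0 < a"
  shows "(\<integral>\<^sup>+z. ennreal (norm z powr (- a - DIM('a))) * indicator (- ball 0 1) (z :: 'a::euclidean_space) \<partial>lborel) < \<infinity>"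
proof (rule nn_integral_dyadic_annuli_finite[where r = "\<lambda>n. 2 powr real n" and c = 1 and q = "2 powr (- a)"])
  show "(2 powr real n) powr (- a) = 1 * (2 powr (- a)) ^ n" for n
    unfolding two_powr_mult_nat[symmetric] powr_powr by (simp add: algebra_simps)
  fix z :: 'a assume "z \<in> - ball 0 1"
  then have "1 \<le> norm z" by (simp add: not_less)
  define y where "y = norm z"
  have y: "0 < y" "1 \<le> y" using \<open>1 \<le> norm z\<close> by (auto simp: y_def simp del: zero_less_norm_iff)
  then have "0 < 1 / y" "1 / y \<le> 1" by auto
  then obtain n where n: "1 / y \<le> 2 powr (- real n)" "2 powr (- real n - 1) \<le> 1 / y"
    by (rule dyadic_between)
  then have "2 powr real n \<le> y" "y \<le> 2 * 2 powr real n"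
    using y by (auto simp: powr_minus powr_diff field_simps)
  then show "\<exists>n. 2 powr real n \<le> norm z \<and> norm z \<le> 2 * 2 powr real n" unfolding y_def by blast
qed (use assms in \<open>auto simp: powr_less_one\<close>)

text \<open>In the unit ball the transform is bounded by the total mass and the weight is integrable
  because \<open>s > 0\<close>. Outside, decay of order \<open>t\<close> leaves the power
  \<open>- (t - s) / \<theta> - DIM('a)\<close> of the norm, integrable because
  \<open>s < t\<close>.\<close>

lemma fourier_energy_finite_of_decay:
  fixes \<mu> :: "'a::euclidean_space measure"
  assumes \<mu>: "finite_measure \<mu>" "sets \<mu> = sets borel" and energy: "fourier_energy t 0 \<mu> < \<infinity>"
    and s: "0 < s" "s < t" and \<theta>: "0 < \<theta>"
  shows "fourier_energy s \<theta> \<mu> < \<infinity>"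
proof -
  define F where "F z = cmod (fourier_transform \<mu> z)" for z
  have FT [measurable]: "fourier_transform \<mu> \<in> borel_measurable borel"
    by (rule fourier_transform_measurable) fact+
  define p where "p = 1 / \<theta>"
  have p: "0 < p" using \<theta> by (simp add: p_def)
  define A where "A = enn2real (fourier_energy t 0 \<mu>)"
  define M where "M = measure \<mu> UNIV"
  have "0 \<le> A" "0 \<le> M" by (auto simp: A_def M_def)
  have decay: "(F z)\<^sup>2 * norm z powr t \<le> A" for z
  proof -
    have "ennreal ((F z)\<^sup>2 * norm z powr t) \<le> fourier_energy t 0 \<mu>"
      unfolding fourier_energy_def F_def by (auto intro: SUP_upper)
    also have "\<dots> = ennreal A" using energy by (simp add: A_def)
    finally show ?thesis using \<open>0 \<le> A\<close> by simp
  qed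
  have Fp: "F z powr (2 / \<theta>) = ((F z)\<^sup>2) powr p" for z
    by (cases "F z = 0") (simp_all add: F_def p_def powr_powr flip: powr_numeral)
  have FM: "((F z)\<^sup>2) powr p \<le> (M\<^sup>2) powr p" for z
    using norm_fourier_transform_le[OF \<mu>, of z] p
    by (intro powr_mono2 power_mono) (auto simp: F_def M_def)
  have pointwise: "ennreal (F z powr (2 / \<theta>) * norm z powr (s / \<theta> - DIM('a)))
    \<le> ennreal ((M\<^sup>2) powr p) * (ennreal (norm z powr (s * p - DIM('a))) * indicator (cball 0 1) z)
      + ennreal (A powr p) * (ennreal (norm z powr (- ((t - s) * p) - DIM('a))) * indicator (- ball 0 1) z)" for z
  proof (cases "norm z < 1")
    case True
    have "F z powr (2 / \<theta>) * norm z powr (s / \<theta> - DIM('a)) \<le> (M\<^sup>2) powr p * norm z powr (s * p - DIM('a))"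
      using FM[of z] by (simp add: Fp p_def mult_right_mono)
    then show ?thesis using True by (simp add: ennreal_mult[symmetric] ennreal_leI)
  next
    case False
    then have z: "1 \<le> norm z" "z \<noteq> 0" by auto
    have "(F z)\<^sup>2 \<le> A * norm z powr (- t)"
      using decay[of z] z by (simp add: powr_minus field_simps)
    then have "((F z)\<^sup>2) powr p \<le> (A * norm z powr (- t)) powr p" using p by (intro powr_mono2) auto
    also have "\<dots> = A powr p * norm z powr (- t * p)" using \<open>0 \<le> A\<close> by (simp add: powr_mult powr_powr)
    finally have "F z powr (2 / \<theta>) * norm z powr (s / \<theta> - DIM('a))
        \<le> A powr p * norm z powr (- t * p) * norm z powr (s * p - DIM('a))"
      by (simp add: Fp p_def mult_right_mono)
    also have "\<dots> = A powr p * norm z powr (- ((t - s) * p) - DIM('a))"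
      by (simp add: mult.assoc powr_add[symmetric] algebra_simps)
    finally have le: "F z powr (2 / \<theta>) * norm z powr (s / \<theta> - DIM('a))
        \<le> A powr p * norm z powr (- ((t - s) * p) - DIM('a))" .
    have "ennreal (F z powr (2 / \<theta>) * norm z powr (s / \<theta> - DIM('a)))
        \<le> ennreal (A powr p) * (ennreal (norm z powr (- ((t - s) * p) - DIM('a))) * indicator (- ball 0 1) z)"
      using False le by (simp add: ennreal_mult[symmetric] ennreal_leI)
    then show ?thesis by (rule order_trans) simp
  qed
  define g1 where "g1 z = ennreal (norm z powr (s * p - DIM('a))) * indicator (cball 0 1) z" for z :: 'a
  define g2 where "g2 z = ennreal (norm z powr (- ((t - s) * p) - DIM('a))) * indicator (- ball 0 1) z" for z :: 'a
  have [measurable]: "g1 \<in> borel_measurable borel" "g2 \<in> borel_measurable borel"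
    unfolding g1_def g2_def by (intro borel_measurable_times_ennreal borel_measurable_indicator; simp)+
  have "(\<integral>\<^sup>+z. ennreal (F z powr (2 / \<theta>) * norm z powr (s / \<theta> - DIM('a))) \<partial>lborel)
    \<le> (\<integral>\<^sup>+z. ennreal ((M\<^sup>2) powr p) * g1 z + ennreal (A powr p) * g2 z \<partial>lborel)"
    unfolding g1_def g2_def by (intro nn_integral_mono pointwise)
  also have "\<dots> = ennreal ((M\<^sup>2) powr p) * integral\<^sup>N lborel g1 + ennreal (A powr p) * integral\<^sup>N lborel g2"
    by (simp add: nn_integral_add nn_integral_cmult)
  also have "\<dots> < \<infinity>"
    using nn_integral_powr_at_0_finite[where 'a = 'a, of "s * p"]
      nn_integral_powr_at_infinity_finite[where 'a = 'a, of "(t - s) * p"] s p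
    by (simp add: ennreal_mult_less_top g1_def[symmetric] g2_def[symmetric])
  finally show ?thesis
    using \<theta> by (simp add: fourier_energy_def ennreal_powr_def F_def top_unique less_top)
qed

lemma fourier_spectrum_pos_of_dimension_pos:
  fixes X :: "'a::euclidean_space set"
  assumes "0 < fourier_spectrum 0 X"
  obtains t where "0 < t" "\<And>\<theta>. 0 < \<theta> \<Longrightarrow> ereal t \<le> fourier_spectrum \<theta> X"
proof -
  have "ereal 0 < fourier_spectrum 0 X" using assms unfolding zero_ereal_def .
  then obtain \<mu> t where t: "\<mu> \<in> compact_measures_on X" "0 < t" "fourier_energy t 0 \<mu> < \<infinity>"
    using fourier_spectrum_gtE by blast
  obtain K R where \<mu>: "finite_measure \<mu>" "sets \<mu> = sets borel" using compact_measures_onE[OF t(1)] by metis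
  \<comment> \<open>Halving gives the strict inequality \<open>s < t\<close>; the cap 1 respects the
    minimum with the ambient dimension in the spectrum. Neither choice depends on \<theta>.\<close>
  define s where "s = min (t / 2) 1"
  have "1 \<le> real DIM('a)" by (simp add: Suc_leI)
  then have "min (t / 2) 1 \<le> real DIM('a)" by linarith
  then have s: "0 < s" "s < t" "s \<le> DIM('a)" using t(2) by (simp_all add: s_def min_less_iff_disj)
  have "ereal s \<le> fourier_spectrum \<theta> X" if "0 < \<theta>" for \<theta>
    by (rule fourier_spectrum_geI[OF t(1) fourier_energy_finite_of_decay[OF \<mu> t(3) s(1,2) that] s(3)])
  with s(1) show thesis using that by blast
qed

section \<open>The bound B(u) and the final comparison\<close>

lemma hausdorff_dim_nonneg: "0 \<le> hausdorff_dim m S"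
  unfolding hausdorff_dim_def by (auto intro!: Inf_greatest)

lemma fourier_bound_le:
  fixes X :: "'a::euclidean_space set"
  assumes "0 < \<theta>" "\<theta> \<le> 1" "fourier_spectrum \<theta> X = ereal s"
  shows "fourier_bound k X u \<le> ereal (real k * (real DIM('a) - real k) + (u - s) / \<theta>)"
proof -
  have "(INF \<theta>\<in>{0<..1}. (ereal u - fourier_spectrum \<theta> X) / ereal \<theta>) \<le> (ereal u - fourier_spectrum \<theta> X) / ereal \<theta>"
    using assms by (intro INF_lower) auto
  also have "\<dots> = ereal ((u - s) / \<theta>)" using assms by simp
  finally have le: "(INF \<theta>\<in>{0<..1}. (ereal u - fourier_spectrum \<theta> X) / ereal \<theta>) \<le> ereal ((u - s) / \<theta>)" .
  show ?thesis unfolding fourier_bound_def plus_ereal.simps(1)[symmetric] by (rule add_left_mono[OF le])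
qed

text \<open>Where the spectrum vanishes, the bound is at least \<open>k (d - k)\<close>, so that nothing needs to be proved.\<close>

lemma exceptional_dim_le_fourier_bound:
  fixes X :: "'a::euclidean_space set"
  assumes k: "1 \<le> k" "k \<le> DIM('a)" and u: "0 \<le> u" "u < real k"
    and le: "exceptional_dim k X u \<le> ereal (real k * (real DIM('a) - real k))"
  shows "exceptional_dim k X u \<le> max 0 (fourier_bound k X u)"
proof (cases "exceptional_dim k X u \<le> 0")
  case False
  define c where "c = real k * (real DIM('a) - real k)"
  \<comment> \<open>Positivity of \<open>b\<close> settles each maximum with 0 in favour of its
    second argument, so that \<open>b - c\<close> can be compared with the infimum term by
    term.\<close>
  obtain b where b: "exceptional_dim k X u = ereal b" "0 < b"
    using False le by (cases "exceptional_dim k X u") auto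
  have "ereal (b - c) \<le> (ereal u - fourier_spectrum \<theta> X) / ereal \<theta>" if \<theta>: "0 < \<theta>" "\<theta> \<le> 1" for \<theta>
  proof (cases "fourier_spectrum \<theta> X")
    case (real S)
    have "b - c \<le> (u - S) / \<theta>"
    proof (cases "0 < S")
      case True
      have "ereal b \<le> ereal (max 0 (c + (u - S) / \<theta>))"
        using exceptional_dim_le_of_spectrum[OF real True \<theta> k u] by (simp only: b c_def)
      then have "b \<le> max 0 (c + (u - S) / \<theta>)" by (simp only: ereal_less_eq)
      then show ?thesis using b(2) by linarith
    next
      case False
      then have "0 \<le> (u - S) / \<theta>" using \<theta> u by simp
      moreover have "b \<le> c" using le b by (simp add: c_def)
      ultimately show ?thesis by linarith
    qed
    then show ?thesis using real \<theta> by simp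
  next
    case PInf
    then show ?thesis using fourier_spectrum_le_dim[of \<theta> X] by simp
  next
    case MInf
    then show ?thesis using \<theta> by simp
  qed
  then have INF: "ereal (b - c) \<le> (INF \<theta>\<in>{0<..1}. (ereal u - fourier_spectrum \<theta> X) / ereal \<theta>)"
    by (intro INF_greatest) auto
  have "ereal b = ereal c + ereal (b - c)" by simp
  also have "\<dots> \<le> fourier_bound k X u"
    unfolding fourier_bound_def c_def[symmetric] by (rule add_left_mono[OF INF])
  finally show ?thesis using b by (simp add: le_max_iff_disj)
qed (simp add: le_max_iff_disj)

theorem corollary6p4:
  fixes X :: "(real ^ 'n) set" and d k :: nat
  assumes "d = CARD('n)" and "3 \<le> d" and "1 \<le> k" and "k < d"
    and "X \<in> sets borel"
    and "\<exists>\<theta>\<in>{0..<1}. ereal \<theta> * max (ereal k) (hausdorff_dim euclidean_metric X)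
            < fourier_spectrum \<theta> X"
  shows "\<forall>\<^sub>F u in at_right (0::real).
      hausdorff_dim (grassmannian_metric k)
          {V \<in> grassmannian k. hausdorff_dim euclidean_metric (orth_proj V ` X) < ereal u}
        \<le> max 0 (fourier_bound k X u)
      \<and> fourier_bound k X u
          < ereal (real k * (real d - real k) + u) - hausdorff_dim euclidean_metric X
      \<and> fourier_bound k X u < ereal (real k * (real d - real k - 1) + u)"
proof -
  have d: "DIM(real ^ 'n) = d" using assms(1) by simp
  obtain D where D: "hausdorff_dim euclidean_metric X = ereal D"
    using hausdorff_dim_nonneg[of euclidean_metric X] hausdorff_dim_finite[of X]
    by (cases "hausdorff_dim euclidean_metric X") auto
  \<comment> \<open>One constant serves both comparisons: exceeding \<open>k\<close> yields the
    Mattila side, exceeding \<open>D\<close> the Peres--Schlag side.\<close>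
  define m where "m = max (real k) D"
  have m: "1 \<le> m" using assms(3) by (simp add: m_def le_max_iff_disj)
  from assms(6) obtain \<theta>0 where \<theta>0: "0 \<le> \<theta>0" "\<theta>0 < 1" "ereal (\<theta>0 * m) < fourier_spectrum \<theta>0 X"
    by (auto simp: D m_def max_def split: if_splits)
  have "\<exists>\<theta>. 0 < \<theta> \<and> \<theta> \<le> 1 \<and> ereal (\<theta> * m) < fourier_spectrum \<theta> X"
  proof (cases "\<theta>0 = 0")
    case True
    then have "0 < fourier_spectrum 0 X" using \<theta>0(3) by (simp add: zero_ereal_def)
    then obtain t where t: "0 < t" "\<And>\<theta>. 0 < \<theta> \<Longrightarrow> ereal t \<le> fourier_spectrum \<theta> X"
      using fourier_spectrum_pos_of_dimension_pos by blast
    \<comment> \<open>The spectrum at this \<theta> is still at least \<open>t\<close>, whereas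
      \<open>\<theta> * m \<le> t / 2\<close>.\<close>
    define \<theta> where "\<theta> = min 1 (t / (2 * m))"
    have "0 < \<theta>" "\<theta> \<le> 1" using t(1) m by (auto simp: \<theta>_def)
    have "\<theta> * m \<le> t / (2 * m) * m" using m by (intro mult_right_mono) (auto simp: \<theta>_def)
    also have "\<dots> < t" using t(1) m by simp
    finally have "ereal (\<theta> * m) < ereal t" by simp
    also have "\<dots> \<le> fourier_spectrum \<theta> X" by (rule t(2)) fact
    finally show ?thesis using \<open>0 < \<theta>\<close> \<open>\<theta> \<le> 1\<close> by blast
  qed (use \<theta>0 in \<open>auto intro!: exI[of _ \<theta>0]\<close>)
  then obtain \<theta> where \<theta>: "0 < \<theta>" "\<theta> \<le> 1" and gt: "ereal (\<theta> * m) < fourier_spectrum \<theta> X" by blast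
  obtain s where s: "fourier_spectrum \<theta> X = ereal s"
    using gt fourier_spectrum_le_dim[of \<theta> X] by (cases "fourier_spectrum \<theta> X") auto
  have sm: "\<theta> * m < s" using gt s by simp
  have "0 < \<theta> * m" using \<theta> m by simp
  then have "0 < s" using sm by linarith
  \<comment> \<open>The bound \<open>u < s - \<theta> * m\<close> gives
    \<open>(u - s) / \<theta> < - m\<close>, and \<open>u < 1\<close> ensures
    \<open>u < k\<close>.\<close>
  have "0 < min 1 (s - \<theta> * m)" using sm by simp
  then have "\<forall>\<^sub>F u in at_right (0::real). u \<in> {0<..<min 1 (s - \<theta> * m)}"
    by (rule eventually_at_right_real)
  then show ?thesis
  proof eventually_elim
    case (elim u)
    define c where "c = real k * (real d - real k)"
    have "(u - s) / \<theta> < - m" using elim \<theta> by (simp add: pos_divide_less_eq mult.commute)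
    then have lt: "c + (u - s) / \<theta> < c - m" by simp
    have B: "fourier_bound k X u \<le> ereal (c + (u - s) / \<theta>)"
      using fourier_bound_le[OF \<theta> s, of k u] d by (simp add: c_def)
    have k: "k \<le> DIM(real ^ 'n)" and u: "0 \<le> u" "u < real k"
      using assms(3,4) d elim by auto
    have "0 \<le> c" using assms(4) by (simp add: c_def)
    have "exceptional_dim k X u \<le> ereal (max 0 (c + (u - s) / \<theta>))"
      using exceptional_dim_le_of_spectrum[OF s \<open>0 < s\<close> \<theta> assms(3) k u] d by (simp add: c_def)
    \<comment> \<open>The estimate at this one \<theta> already lies below
      \<open>k * (d - k)\<close>, which is the side condition of
      \<open>exceptional_dim_le_fourier_bound\<close>; that lemma then passes to the infimum over
      all \<theta>.\<close>
    also have "\<dots> \<le> ereal c" using lt \<open>0 \<le> c\<close> m by simp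
    finally have "exceptional_dim k X u \<le> max 0 (fourier_bound k X u)"
      using exceptional_dim_le_fourier_bound[OF assms(3) k u] d by (simp add: c_def)
    moreover have "fourier_bound k X u < ereal (c + u) - hausdorff_dim euclidean_metric X"
    proof -
      have "c + (u - s) / \<theta> < c + u - D" using lt elim by (auto simp: m_def)
      then show ?thesis using B by (auto simp: D intro: order_le_less_trans)
    qed
    moreover have "fourier_bound k X u < ereal (real k * (real d - real k - 1) + u)"
    proof -
      have "c + (u - s) / \<theta> < c - real k + u" using lt elim by (auto simp: m_def)
      also have "c - real k + u = real k * (real d - real k - 1) + u" by (simp add: c_def algebra_simps)
      finally show ?thesis using B by (auto intro: order_le_less_trans)
    qed
    ultimately show ?case by (simp add: exceptional_dim_def c_def)
  qed
qed

end
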